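(* Suppose that $G\leqslant F_1\times F_2$ is a full subdirect product of acylindrically hyperbolic groups $F_1$ and $F_2$ which do not have non-trivial finite normal subgroups. If $G$ is $p$-conjugacy separable for at least two distinct primes $p$, then $G=F_1\times F_2$.
   Context: For a prime $p$, a group $G$ is $p$-conjugacy separable if for any two non-conjugate elements $x,y\in G$ there is a homomorphism $\varphi$ from $G$ to a finite $p$-group $M$ such that $\varphi(x)$ and $\varphi(y)$ are not conjugate in $M$. A group is elementary if it has a cyclic subgroup of finite index. A group is acylindrically hyperbolic if it is non-elementary and admits an acylindrical cobounded isometric action on a (Gromov) hyperbolic metric space with unbounded orbits; an isometric action of $F$ on $(\mathcal{S},d)$ is acylindrical if for every $\varepsilon>0$ there are $R,N>0$ such that for all $x,y\in\mathcal{S}$ with $d(x,y)\ge R$ there are at most $N$ elements $g\in F$ with $d(x,gx)\le\varepsilon$ and $d(y,gy)\le\varepsilon$. In $F_1\times F_2$ one identifies $F_1$ with $F_1\times\{1\}$ and $F_2$ with $\{1\}\times F_2$. A subgroup $G\leqslant F_1\times F_2$ is a subdirect product if both coordinate projections map $G$ onto $F_1$ and $F_2$ respectively; it is a full subdirect product if in addition $G\cap F_i\neq\{1\}$ for $i=1,2$. *)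

theory Defs
  imports "HOL-Algebra.Group_Action" "HOL-Algebra.Elementary_Groups"
    "HOL-Analysis.Abstract_Metric_Spaces" "HOL-Computational_Algebra.Primes"
begin

definition conjugate_in :: "('a, 'm) monoid_scheme \<Rightarrow> 'a \<Rightarrow> 'a \<Rightarrow> bool" where
  "conjugate_in G x y \<longleftrightarrow> (\<exists>g\<in>carrier G. y = g \<otimes>\<^bsub>G\<^esub> x \<otimes>\<^bsub>G\<^esub> inv\<^bsub>G\<^esub> g)"

definition finite_p_group :: "nat \<Rightarrow> ('a, 'm) monoid_scheme \<Rightarrow> bool" where
  "finite_p_group p M \<longleftrightarrow> group M \<and> finite (carrier M) \<and> (\<exists>k. order M = p ^ k)"

text \<open>Every finite group is isomorphic to one whose elements are natural numbers, so taking the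
  finite quotients on the type \<^typ>\<open>nat\<close> loses nothing; this is proved in
  \<open>p_conjugacy_separableI\<close> below.\<close>

definition p_conjugacy_separable :: "nat \<Rightarrow> ('a, 'm) monoid_scheme \<Rightarrow> bool" where
  "p_conjugacy_separable p G \<longleftrightarrow>
    (\<forall>x\<in>carrier G. \<forall>y\<in>carrier G. \<not> conjugate_in G x y \<longrightarrow>
      (\<exists>(M :: nat monoid) h. finite_p_group p M \<and> h \<in> hom G M \<and> \<not> conjugate_in M (h x) (h y)))"

lemma finite_p_group_nat_copy:
  fixes M :: "('b, 'n) monoid_scheme"
  assumes M: "finite_p_group p M" and h: "h \<in> hom G M"
    and x: "x \<in> carrier G" and y: "y \<in> carrier G" and nc: "\<not> conjugate_in M (h x) (h y)"
  shows "\<exists>(M' :: nat monoid) h'. finite_p_group p M' \<and> h' \<in> hom G M' \<and> \<not> conjugate_in M' (h' x) (h' y)"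
proof -
  interpret M: group M using M by (simp add: finite_p_group_def)
  have fin: "finite (carrier M)" using M by (simp add: finite_p_group_def)
  obtain f :: "'b \<Rightarrow> nat" where f: "inj_on f (carrier M)"
    using finite_imp_inj_to_nat_seg[OF fin] by blast
  let ?i = "inv_into (carrier M) f"
  define M' :: "nat monoid" where
    "M' = \<lparr>carrier = f ` carrier M, monoid.mult = (\<lambda>a b. f (?i a \<otimes>\<^bsub>M\<^esub> ?i b)), one = f \<one>\<^bsub>M\<^esub>\<rparr>"
  have c: "carrier M' = f ` carrier M" by (simp add: M'_def)
  have fi: "f a \<otimes>\<^bsub>M'\<^esub> f b = f (a \<otimes>\<^bsub>M\<^esub> b)" if "a \<in> carrier M" "b \<in> carrier M" for a b
    using that f by (simp add: M'_def inv_into_f_f)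
  have o: "\<one>\<^bsub>M'\<^esub> = f \<one>\<^bsub>M\<^esub>" by (simp add: M'_def)
  interpret M': group M'
  proof (rule groupI)
    fix a b assume "a \<in> carrier M'" "b \<in> carrier M'"
    then show "a \<otimes>\<^bsub>M'\<^esub> b \<in> carrier M'" by (auto simp: c fi)
  next
    show "\<one>\<^bsub>M'\<^esub> \<in> carrier M'" by (simp add: c o)
  next
    fix a b d assume "a \<in> carrier M'" "b \<in> carrier M'" "d \<in> carrier M'"
    then show "a \<otimes>\<^bsub>M'\<^esub> b \<otimes>\<^bsub>M'\<^esub> d = a \<otimes>\<^bsub>M'\<^esub> (b \<otimes>\<^bsub>M'\<^esub> d)"
      by (auto simp: c fi M.m_assoc)
  next
    fix a assume "a \<in> carrier M'"
    then show "\<one>\<^bsub>M'\<^esub> \<otimes>\<^bsub>M'\<^esub> a = a" by (auto simp: c o fi)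
  next
    fix a assume "a \<in> carrier M'"
    then obtain b where b: "b \<in> carrier M" "a = f b" by (auto simp: c)
    then have "f (inv\<^bsub>M\<^esub> b) \<otimes>\<^bsub>M'\<^esub> a = \<one>\<^bsub>M'\<^esub>" by (simp add: fi o)
    then show "\<exists>b\<in>carrier M'. b \<otimes>\<^bsub>M'\<^esub> a = \<one>\<^bsub>M'\<^esub>" using b by (auto simp: c)
  qed
  have ord: "order M' = order M" using f by (simp add: order_def c card_image)
  have pM': "finite_p_group p M'"
    using M M'.is_group fin ord by (simp add: finite_p_group_def c)
  have hc: "h z \<in> carrier M" if "z \<in> carrier G" for z
    using h that by (auto simp: hom_def)
  have hom': "f \<circ> h \<in> hom G M'"
    using h hc by (auto simp: hom_def c fi)
  have "\<not> conjugate_in M' ((f \<circ> h) x) ((f \<circ> h) y)"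
  proof
    assume "conjugate_in M' ((f \<circ> h) x) ((f \<circ> h) y)"
    then obtain g where g: "g \<in> carrier M"
      and e: "f (h y) = f g \<otimes>\<^bsub>M'\<^esub> f (h x) \<otimes>\<^bsub>M'\<^esub> inv\<^bsub>M'\<^esub> (f g)"
      by (auto simp: conjugate_in_def c)
    have "f (inv\<^bsub>M\<^esub> g) \<otimes>\<^bsub>M'\<^esub> f g = \<one>\<^bsub>M'\<^esub>" using g by (simp add: fi o)
    then have "inv\<^bsub>M'\<^esub> (f g) = f (inv\<^bsub>M\<^esub> g)"
      using g by (intro M'.inv_equality) (auto simp: c)
    with e have "f (h y) = f (g \<otimes>\<^bsub>M\<^esub> h x \<otimes>\<^bsub>M\<^esub> inv\<^bsub>M\<^esub> g)"
      using g hc[OF x] by (simp add: fi)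
    then have "h y = g \<otimes>\<^bsub>M\<^esub> h x \<otimes>\<^bsub>M\<^esub> inv\<^bsub>M\<^esub> g"
      using f g hc[OF x] hc[OF y] by (auto dest: inj_onD)
    then show False using nc g by (auto simp: conjugate_in_def)
  qed
  with pM' hom' show ?thesis by blast
qed

lemma p_conjugacy_separableI:
  assumes "\<And>x y. x \<in> carrier G \<Longrightarrow> y \<in> carrier G \<Longrightarrow> \<not> conjugate_in G x y \<Longrightarrow>
    \<exists>(M :: 'b monoid) h. finite_p_group p M \<and> h \<in> hom G M \<and> \<not> conjugate_in M (h x) (h y)"
  shows "p_conjugacy_separable p G"
  unfolding p_conjugacy_separable_def
proof (intro ballI impI)
  fix x y assume xy: "x \<in> carrier G" "y \<in> carrier G" and n: "\<not> conjugate_in G x y"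
  obtain M :: "'b monoid" and h where
    "finite_p_group p M" "h \<in> hom G M" "\<not> conjugate_in M (h x) (h y)"
    using assms[OF xy n] by blast
  from finite_p_group_nat_copy[OF this(1,2) xy this(3)]
  show "\<exists>(M :: nat monoid) h. finite_p_group p M \<and> h \<in> hom G M \<and> \<not> conjugate_in M (h x) (h y)" .
qed

definition elementary_group :: "('a, 'm) monoid_scheme \<Rightarrow> bool" where
  "elementary_group F \<longleftrightarrow>
    (\<exists>H. subgroup H F \<and> cyclic_group (F\<lparr>carrier := H\<rparr>) \<and> finite (rcosets\<^bsub>F\<^esub> H))"

definition geodesic_metric_space :: "'s set \<Rightarrow> ('s \<Rightarrow> 's \<Rightarrow> real) \<Rightarrow> bool" where
  "geodesic_metric_space S d \<longleftrightarrow> Metric_space S d \<and>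
    (\<forall>x\<in>S. \<forall>y\<in>S. \<exists>c. c \<in> {0..d x y} \<rightarrow> S \<and> c 0 = x \<and> c (d x y) = y \<and>
      (\<forall>s\<in>{0..d x y}. \<forall>t\<in>{0..d x y}. d (c s) (c t) = \<bar>s - t\<bar>))"

definition Gromov_product :: "('s \<Rightarrow> 's \<Rightarrow> real) \<Rightarrow> 's \<Rightarrow> 's \<Rightarrow> 's \<Rightarrow> real" where
  "Gromov_product d w x y = (d x w + d y w - d x y) / 2"

text \<open>As usual for acylindrical actions, hyperbolic spaces are geodesic. Without this requirement
  the notion degenerates: every infinite finitely generated group acts properly and transitively
  by isometries on itself with the metric \<open>ln (1 + \<bar>g\<inverse> h\<bar>)\<close>, where \<open>\<bar>g\<bar>\<close> is the word
  length, and this metric satisfies the four-point inequality below.\<close>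

definition Gromov_hyperbolic_space :: "'s set \<Rightarrow> ('s \<Rightarrow> 's \<Rightarrow> real) \<Rightarrow> bool" where
  "Gromov_hyperbolic_space S d \<longleftrightarrow> geodesic_metric_space S d \<and>
    (\<exists>\<delta>. \<forall>w\<in>S. \<forall>x\<in>S. \<forall>y\<in>S. \<forall>z\<in>S.
      Gromov_product d w x z \<ge> min (Gromov_product d w x y) (Gromov_product d w y z) - \<delta>)"

definition isometric_action ::
  "('a, 'm) monoid_scheme \<Rightarrow> 's set \<Rightarrow> ('s \<Rightarrow> 's \<Rightarrow> real) \<Rightarrow> ('a \<Rightarrow> 's \<Rightarrow> 's) \<Rightarrow> bool" where
  "isometric_action F S d \<phi> \<longleftrightarrow> group_action F S \<phi> \<and>
    (\<forall>g\<in>carrier F. \<forall>x\<in>S. \<forall>y\<in>S. d (\<phi> g x) (\<phi> g y) = d x y)"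

definition acylindrical_action ::
  "('a, 'm) monoid_scheme \<Rightarrow> 's set \<Rightarrow> ('s \<Rightarrow> 's \<Rightarrow> real) \<Rightarrow> ('a \<Rightarrow> 's \<Rightarrow> 's) \<Rightarrow> bool" where
  "acylindrical_action F S d \<phi> \<longleftrightarrow> isometric_action F S d \<phi> \<and>
    (\<forall>\<epsilon>>0. \<exists>R>0. \<exists>N::nat. N > 0 \<and> (\<forall>x\<in>S. \<forall>y\<in>S. d x y \<ge> R \<longrightarrow>
      finite {g \<in> carrier F. d x (\<phi> g x) \<le> \<epsilon> \<and> d y (\<phi> g y) \<le> \<epsilon>} \<and>
      card {g \<in> carrier F. d x (\<phi> g x) \<le> \<epsilon> \<and> d y (\<phi> g y) \<le> \<epsilon>} \<le> N))"

definition cobounded_action ::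
  "('a, 'm) monoid_scheme \<Rightarrow> 's set \<Rightarrow> ('s \<Rightarrow> 's \<Rightarrow> real) \<Rightarrow> ('a \<Rightarrow> 's \<Rightarrow> 's) \<Rightarrow> bool" where
  "cobounded_action F S d \<phi> \<longleftrightarrow>
    (\<exists>B. Metric_space.mbounded S d B \<and> S = (\<Union>g\<in>carrier F. \<phi> g ` B))"

definition unbounded_orbits ::
  "('a, 'm) monoid_scheme \<Rightarrow> 's set \<Rightarrow> ('s \<Rightarrow> 's \<Rightarrow> real) \<Rightarrow> ('a \<Rightarrow> 's \<Rightarrow> 's) \<Rightarrow> bool" where
  "unbounded_orbits F S d \<phi> \<longleftrightarrow>
    S \<noteq> {} \<and> (\<forall>x\<in>S. \<not> Metric_space.mbounded S d (orbit F \<phi> x))"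

text \<open>The points of the space are drawn from the type \<open>'s\<close>, which cannot be quantified inside the
  definition. A theorem that assumes this predicate for a free type variable \<open>'s\<close> covers
  spaces over every type.\<close>

definition acylindrically_hyperbolic :: "'s itself \<Rightarrow> ('a, 'm) monoid_scheme \<Rightarrow> bool" where
  "acylindrically_hyperbolic (_ :: 's itself) F \<longleftrightarrow>
    group F \<and> \<not> elementary_group F \<and>
    (\<exists>(S :: 's set) d \<phi>. Gromov_hyperbolic_space S d \<and> acylindrical_action F S d \<phi> \<and>
      cobounded_action F S d \<phi> \<and> unbounded_orbits F S d \<phi>)"

definition no_nontrivial_finite_normal_subgroups :: "('a, 'm) monoid_scheme \<Rightarrow> bool" where
  "no_nontrivial_finite_normal_subgroups F \<longleftrightarrow>
    (\<forall>N. N \<lhd> F \<and> finite N \<longrightarrow> N = {\<one>\<^bsub>F\<^esub>})"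

definition subdirect_product ::
  "('a \<times> 'b) set \<Rightarrow> ('a, 'm) monoid_scheme \<Rightarrow> ('b, 'n) monoid_scheme \<Rightarrow> bool" where
  "subdirect_product G F1 F2 \<longleftrightarrow>
    subgroup G (F1 \<times>\<times> F2) \<and> fst ` G = carrier F1 \<and> snd ` G = carrier F2"

definition full_subdirect_product ::
  "('a \<times> 'b) set \<Rightarrow> ('a, 'm) monoid_scheme \<Rightarrow> ('b, 'n) monoid_scheme \<Rightarrow> bool" where
  "full_subdirect_product G F1 F2 \<longleftrightarrow> subdirect_product G F1 F2 \<and>
    G \<inter> (carrier F1 \<times> {\<one>\<^bsub>F2\<^esub>}) \<noteq> {\<one>\<^bsub>F1 \<times>\<times> F2\<^esub>} \<and>
    G \<inter> ({\<one>\<^bsub>F1\<^esub>} \<times> carrier F2) \<noteq> {\<one>\<^bsub>F1 \<times>\<times> F2\<^esub>}"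

end

theory Submission
  imports Defs "HOL-Algebra.Multiplicative_Group"
begin

text \<open>
  Let \<open>N\<^sub>1 = {a. (a, 1) \<in> G}\<close>, \<open>N\<^sub>2 = {b. (1, b) \<in> G}\<close> and \<open>Q = F\<^sub>1 / N\<^sub>1 \<cong> F\<^sub>2 / N\<^sub>2\<close>. Being residually a finite
  \<open>p\<close>-group for two primes, \<open>G\<close> has the property that an element commutes with everything its
  powers commute with. Hence, for \<open>n \<in> N\<^sub>i\<close>, elements of \<open>F\<^sub>i\<close> commute with \<open>n\<close> as soon as some power of
  either does.

  Given \<open>(a, b) \<in> G\<close> and \<open>m\<close> prime to \<open>p\<close>, take \<open>h \<in> N\<^sub>1 a\<^sup>m\<close> and \<open>k \<in> N\<^sub>2 b\<^sup>m\<close> that generate their own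
  centralizers. In every finite \<open>p\<close>-quotient of \<open>G\<close> the elements \<open>(h, k)\<close> and \<open>(a h a\<inverse>, k)\<close> become
  conjugate, because there \<open>(a, b)\<close> is a power of \<open>(a, b)\<^sup>m\<close>. So they are conjugate in \<open>G\<close>, which forces
  the image \<open>c\<close> of \<open>a\<close> in \<open>Q\<close> to be a power of \<open>c\<^sup>m\<close>. For \<open>m = q\<close> this gives \<open>c\<^sup>t = 1\<close> with \<open>t\<close> prime
  to \<open>q\<close>; exchanging the primes and taking \<open>m = t\<close> gives \<open>c = 1\<close>.

  The elements \<open>h\<close> and \<open>k\<close> come from hyperbolic geometry. An infinite normal subgroup \<open>N\<close> contains a
  loxodromic element \<open>w\<close>. If \<open>u\<close> does not commute with \<open>w\<close>, then for large \<open>n\<close> the axis of \<open>h = w\<^sup>n u\<close>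
  is a concatenation of long segments of translates of the axis of \<open>w\<close>. An element centralizing \<open>h\<close>
  moves this axis along itself, and unless it is a power of \<open>h\<close> it makes a segment overlap with
  itself for a long time, so by acylindricity it commutes with \<open>w\<close>, which is impossible.
\<close>

section \<open>Chains in four-point hyperbolic spaces\<close>

text \<open>Distinct points at distance 0 are allowed because \<open>D\<close> will measure
  distances between orbit points that are indexed by group elements. In a geodesic hyperbolic space
  \<open>gp y a b\<close> is, up to a bounded error, the distance from \<open>y\<close> to a
  geodesic from \<open>a\<close> to \<open>b\<close>; a small product says that \<open>y\<close>
  lies almost between \<open>a\<close> and \<open>b\<close>.\<close>

locale hyperbolic_pseudometric =
  fixes X :: "'a set" and D :: "'a \<Rightarrow> 'a \<Rightarrow> real" and \<delta> :: real
  assumes \<delta>_pos: "0 < \<delta>"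
    and D_refl: "x \<in> X \<Longrightarrow> D x x = 0"
    and D_sym: "\<lbrakk>x \<in> X; y \<in> X\<rbrakk> \<Longrightarrow> D x y = D y x"
    and D_tri: "\<lbrakk>x \<in> X; y \<in> X; z \<in> X\<rbrakk> \<Longrightarrow> D x z \<le> D x y + D y z"
    and four_point: "\<lbrakk>w \<in> X; x \<in> X; y \<in> X; z \<in> X\<rbrakk> \<Longrightarrow>
      min (Gromov_product D w x y) (Gromov_product D w y z) - \<delta> \<le> Gromov_product D w x z"
begin

abbreviation gp :: "'a \<Rightarrow> 'a \<Rightarrow> 'a \<Rightarrow> real" where "gp \<equiv> Gromov_product D"

lemmas gp_def = Gromov_product_def[of D]

lemma D_nonneg: "\<lbrakk>x \<in> X; y \<in> X\<rbrakk> \<Longrightarrow> 0 \<le> D x y"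
  using D_tri[of x y x] D_sym[of x y] D_refl[of x] by simp

lemma gp_commute: "\<lbrakk>x \<in> X; y \<in> X\<rbrakk> \<Longrightarrow> gp w x y = gp w y x"
  by (simp add: gp_def D_sym)

lemma gp_nonneg: "\<lbrakk>w \<in> X; x \<in> X; y \<in> X\<rbrakk> \<Longrightarrow> 0 \<le> gp w x y"
  using D_tri[of x w y] D_sym[of w y] by (simp add: gp_def)

lemma gp_le_dist: "\<lbrakk>w \<in> X; x \<in> X; y \<in> X\<rbrakk> \<Longrightarrow> gp w x y \<le> D w x"
  using D_tri[of y x w] D_sym[of w x] D_sym[of x y] by (simp add: gp_def)

lemma gp_le_dist': "\<lbrakk>w \<in> X; x \<in> X; y \<in> X\<rbrakk> \<Longrightarrow> gp w x y \<le> D w y"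
  using gp_le_dist[of w y x] gp_commute[of x y w] by simp

lemma dist_le_gp: "\<lbrakk>w \<in> X; x \<in> X; y \<in> X\<rbrakk> \<Longrightarrow> D w x \<le> gp w x y + D x y"
  using D_tri[of w y x] D_sym[of w x] D_sym[of x y] D_sym[of w y] by (simp add: gp_def field_simps)

lemma gp_add: "\<lbrakk>w \<in> X; x \<in> X; y \<in> X\<rbrakk> \<Longrightarrow> gp w x y + gp x w y = D w x"
  using D_sym[of w x] D_sym[of x y] D_sym[of w y] by (simp add: gp_def field_simps)

lemma gp_change:
  "\<lbrakk>w \<in> X; x \<in> X; y \<in> X; y' \<in> X\<rbrakk> \<Longrightarrow> gp w x y' \<le> gp w x y + D y y'"
  using D_tri[of y' y w] D_tri[of x y' y] D_sym[of y y'] by (simp add: gp_def field_simps)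

lemma gp_change_base:
  "\<lbrakk>w \<in> X; x \<in> X; y \<in> X; w' \<in> X\<rbrakk> \<Longrightarrow> gp w' x y \<le> gp w x y + D w w'"
  using D_tri[of x w w'] D_tri[of y w w'] by (simp add: gp_def field_simps)

lemma gp_change2:
  assumes "w \<in> X" "x \<in> X" "y \<in> X" "x' \<in> X" "y' \<in> X"
  shows "gp w x' y' \<le> gp w x y + D x x' + D y y'"
  using gp_change[of w x y y'] gp_change[of w y' x x'] assms
    gp_commute[of x y' w] gp_commute[of x' y' w] by simp

lemma four_point': "\<lbrakk>w \<in> X; x \<in> X; y \<in> X; z \<in> X; gp w x z \<le> k; k + \<delta> < gp w y z\<rbrakk> \<Longrightarrow>
      gp w x y \<le> k + \<delta>"
  using four_point[of w x y z] by linarith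

text \<open>\<open>p\<close> lies almost on the way from \<open>s\<close> to \<open>x\<close> and no
  farther than the place where the ways to \<open>x\<close> and to \<open>y\<close> part, so it lies
  almost on the way to \<open>y\<close> as well.\<close>

lemma fellow_travel:
  assumes "s \<in> X" "p \<in> X" "x \<in> X" "y \<in> X"
    and "gp p s x \<le> c" and "D s p \<le> gp s x y"
  shows "gp p s y \<le> c + \<delta>"
  using four_point[of s p x y] gp_add[of s p x] gp_add[of s p y] gp_nonneg[of p s x] assms by linarith

text \<open>Local-to-global principle: almost straight corners and long sides. Seen from
  \<open>x (Suc j)\<close>, the points \<open>x j\<close> and \<open>x 0\<close> lie in nearly the
  same direction, because the side just passed is long and the product at \<open>x j\<close> is
  small. The four-point condition then carries the bound at the corner over from \<open>x j\<close>
  to \<open>x 0\<close>.\<close>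

lemma chain_left:
  fixes x :: "nat \<Rightarrow> 'a"
  assumes c: "0 \<le> c" and X: "\<And>i. i \<le> n \<Longrightarrow> x i \<in> X"
    and g: "\<And>i. i + 2 \<le> n \<Longrightarrow> gp (x (Suc i)) (x i) (x (i + 2)) \<le> c"
    and d: "\<And>i. i < n \<Longrightarrow> 2 * c + 4 * \<delta> \<le> D (x i) (x (Suc i))"
    and j: "j < n"
  shows "gp (x j) (x 0) (x (Suc j)) \<le> c + \<delta>"
  using j
proof (induction j)
  case 0
  then show ?case using c \<delta>_pos gp_le_dist[of "x 0" "x 0" "x (Suc 0)"] X D_refl[of "x 0"] by simp
next
  case (Suc j)
  then have IH: "gp (x j) (x 0) (x (Suc j)) \<le> c + \<delta>" by simp
  have X': "x 0 \<in> X" "x j \<in> X" "x (Suc j) \<in> X" "x (Suc (Suc j)) \<in> X" using X Suc.prems by auto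
  have "gp (x (Suc j)) (x j) (x 0) = D (x (Suc j)) (x j) - gp (x j) (x (Suc j)) (x 0)"
    using gp_add[of "x (Suc j)" "x j" "x 0"] X' by simp
  moreover have "gp (x j) (x (Suc j)) (x 0) = gp (x j) (x 0) (x (Suc j))"
    using gp_commute X' by auto
  moreover have "2 * c + 4 * \<delta> \<le> D (x (Suc j)) (x j)"
    using d[of j] D_sym[of "x j" "x (Suc j)"] X' Suc.prems by simp
  moreover have "gp (x (Suc j)) (x j) (x (Suc (Suc j))) \<le> c" using g[of j] Suc.prems by simp
  ultimately show ?case
    using four_point[of "x (Suc j)" "x j" "x 0" "x (Suc (Suc j))"] IH X' \<delta>_pos by linarith
qed

lemma chain_between:
  fixes x :: "nat \<Rightarrow> 'a"
  assumes c: "0 \<le> c" and X: "\<And>i. i \<le> n \<Longrightarrow> x i \<in> X"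
    and g: "\<And>i. i + 2 \<le> n \<Longrightarrow> gp (x (Suc i)) (x i) (x (i + 2)) \<le> c"
    and d: "\<And>i. i < n \<Longrightarrow> 2 * c + 4 * \<delta> \<le> D (x i) (x (Suc i))"
    and j: "j \<le> n"
  shows "gp (x j) (x 0) (x n) \<le> c + 2 * \<delta>"
proof (cases "j = n \<or> n = 0")
  case True
  then have "j = n" using j by auto
  then show ?thesis
    using c \<delta>_pos gp_le_dist'[of "x n" "x 0" "x n"] X D_refl[of "x n"] by simp
next
  case False
  then have jn: "j < n" using j by simp
  have X': "x 0 \<in> X" "x j \<in> X" "x (Suc j) \<in> X" "x n \<in> X" using X jn by auto
  have l: "gp (x j) (x 0) (x (Suc j)) \<le> c + \<delta>"
    by (rule chain_left[where n=n]) (use assms jn in auto)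
  \<comment> \<open>This is \<open>chain_left\<close> for the reversed chain. It shows that
    \<open>x (Suc j)\<close> and \<open>x n\<close> lie in nearly the same direction from
    \<open>x j\<close>, so that the bound \<open>l\<close> extends to the far end.\<close>
  have "gp (x (n - (n - Suc j))) (x (n - 0)) (x (n - Suc (n - Suc j))) \<le> c + \<delta>"
  proof (rule chain_left[where n=n and x="\<lambda>i. x (n - i)", OF c])
    fix i assume i: "i + 2 \<le> n"
    have e: "n - Suc i = Suc (n - (i + 2))" "n - i = n - (i + 2) + 2" using i by auto
    have "gp (x (n - Suc i)) (x (n - i)) (x (n - (i + 2))) = gp (x (n - Suc i)) (x (n - (i + 2))) (x (n - i))"
      using X i by (intro gp_commute) auto
    then show "gp (x (n - Suc i)) (x (n - i)) (x (n - (i + 2))) \<le> c"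
      using g[of "n - (i + 2)"] i by (simp only: e)
  next
    fix i assume i: "i < n"
    then have e: "n - i = Suc (n - Suc i)" by auto
    have "D (x (n - i)) (x (n - Suc i)) = D (x (n - Suc i)) (x (n - i))"
      using X i by (intro D_sym) auto
    then show "2 * c + 4 * \<delta> \<le> D (x (n - i)) (x (n - Suc i))"
      using d[of "n - Suc i"] i by (simp only: e)
  qed (use X jn in auto)
  moreover have "n - (n - Suc j) = Suc j" "n - Suc (n - Suc j) = j" using jn by auto
  ultimately have r: "gp (x (Suc j)) (x n) (x j) \<le> c + \<delta>" by simp
  have "gp (x j) (x (Suc j)) (x n) + gp (x (Suc j)) (x j) (x n) = D (x j) (x (Suc j))"
    using gp_add X' by auto
  moreover have "gp (x (Suc j)) (x n) (x j) = gp (x (Suc j)) (x j) (x n)"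
    "gp (x j) (x (Suc j)) (x n) = gp (x j) (x n) (x (Suc j))"
    using gp_commute X' by auto
  ultimately show ?thesis
    using r l d[of j] jn four_point[of "x j" "x 0" "x n" "x (Suc j)"] X' \<delta>_pos by linarith
qed

text \<open>By \<open>chain_left\<close> each new side adds its length minus twice the product
  \<open>c + \<delta>\<close> at the corner, which leaves at least \<open>\<eta>\<close>.\<close>

lemma chain_growth:
  fixes x :: "nat \<Rightarrow> 'a"
  assumes c: "0 \<le> c" and e: "0 \<le> \<eta>"
    and X: "\<And>i. x i \<in> X"
    and g: "\<And>i. gp (x (Suc i)) (x i) (x (i + 2)) \<le> c"
    and d: "\<And>i. 2 * c + 4 * \<delta> + \<eta> \<le> D (x i) (x (Suc i))"
  shows "\<eta> * real n \<le> D (x 0) (x n)"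
proof (induction n)
  case 0
  then show ?case using D_refl[of "x 0"] X by simp
next
  case (Suc n)
  have d': "2 * c + 4 * \<delta> \<le> D (x i) (x (Suc i))" for i using d[of i] e by simp
  have "gp (x n) (x 0) (x (Suc n)) \<le> c + \<delta>"
    by (rule chain_left[where n="Suc n", OF c]) (use X g d' in auto)
  then have "D (x 0) (x (Suc n)) \<ge> D (x 0) (x n) + D (x n) (x (Suc n)) - 2 * (c + \<delta>)"
    using D_sym[of "x (Suc n)" "x n"] X by (simp add: gp_def)
  with Suc d[of n] \<delta>_pos show ?case by (simp add: algebra_simps)
qed

text \<open>The side on which \<open>y\<close> sees the ends of the chain must change somewhere.\<close>

lemma chain_locate:
  fixes x :: "nat \<Rightarrow> 'a"
  assumes n: "0 < n" and X: "\<And>i. i \<le> n \<Longrightarrow> x i \<in> X" and y: "y \<in> X"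
    and g: "\<And>i j k. \<lbrakk>i \<le> j; j \<le> k; k \<le> n\<rbrakk> \<Longrightarrow> gp (x j) (x i) (x k) \<le> c"
    and k: "gp y (x 0) (x n) \<le> \<kappa>"
  shows "\<exists>j<n. gp y (x j) (x (Suc j)) \<le> 2 * \<kappa> + 2 * \<delta> + 2 * c"
proof -
  have AP: "gp y (x 0) (x j) \<le> \<kappa> + \<delta> \<or> gp y (x j) (x n) \<le> \<kappa> + \<delta>" if "j \<le> n" for j
    using four_point[of y "x 0" "x j" "x n"] X[of 0] X[of j] X[of n] y k that by linarith
  have "\<exists>j<n. gp y (x j) (x n) \<le> \<kappa> + \<delta> \<and> gp y (x 0) (x (Suc j)) \<le> \<kappa> + \<delta>"
  proof (rule ccontr)
    assume na: "\<not> ?thesis"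
    \<comment> \<open>Without a switch the second alternative of \<open>AP\<close> propagates from
      \<open>0\<close> up to \<open>n - 1\<close>; there the hypothesis \<open>k\<close> supplies
      the missing half, since \<open>Suc (n - 1) = n\<close>.\<close>
    have P: "gp y (x j) (x n) \<le> \<kappa> + \<delta>" if "j < n" for j
      using that
    proof (induction j)
      case 0
      then show ?case using k \<delta>_pos by simp
    next
      case (Suc j)
      then show ?case using na AP[of "Suc j"] by auto
    qed
    have "n - 1 < n" "Suc (n - 1) = n" using n by auto
    with P[of "n - 1"] na k \<delta>_pos show False by fastforce
  qed
  then obtain j where j: "j < n" "gp y (x j) (x n) \<le> \<kappa> + \<delta>" "gp y (x 0) (x (Suc j)) \<le> \<kappa> + \<delta>" by blast
  have X': "x 0 \<in> X" "x j \<in> X" "x (Suc j) \<in> X" "x n \<in> X" using X j by auto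
  have "gp (x j) (x 0) (x n) \<le> c" "gp (x (Suc j)) (x j) (x n) \<le> c" using g j by auto
  \<comment> \<open>Along the nearly straight chain distances add up to a defect of
    \<open>4 * c\<close>. When the two bounds on products at \<open>y\<close> are added, everything
    outside the side from \<open>x j\<close> to \<open>x (Suc j)\<close> cancels.\<close>
  then have a: "D (x 0) (x n) \<ge> D (x 0) (x j) + D (x j) (x (Suc j)) + D (x (Suc j)) (x n) - 4 * c"
    using D_sym[of "x n"  "x j"] D_sym[of "x (Suc j)" "x n"] X' by (simp add: gp_def)
  have "D (x j) y + D (x n) y - D (x j) (x n) \<le> 2 * \<kappa> + 2 * \<delta>"
    "D (x 0) y + D (x (Suc j)) y - D (x 0) (x (Suc j)) \<le> 2 * \<kappa> + 2 * \<delta>"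
    using j by (simp_all add: gp_def)
  moreover have "D (x 0) (x n) \<le> D (x 0) y + D (x n) y"
    using D_tri[of "x 0" y "x n"] D_sym[of y "x n"] X' y by simp
  moreover have "D (x j) (x n) \<le> D (x j) (x (Suc j)) + D (x (Suc j)) (x n)"
    "D (x 0) (x (Suc j)) \<le> D (x 0) (x j) + D (x j) (x (Suc j))" using D_tri X' by auto
  ultimately have "D (x j) y + D (x (Suc j)) y - D (x j) (x (Suc j)) \<le> 4 * \<kappa> + 4 * \<delta> + 4 * c"
    using a by linarith
  then show ?thesis using j(1) by (intro exI[of _ j]) (simp add: gp_def)
qed

end

section \<open>Loxodromic elements\<close>

text \<open>The group plays the part of an orbit: points are group elements and the action is left
  translation. \<open>acylindrical\<close> records the finiteness part of acylindricity for pairs of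
  orbit points.\<close>

locale hyperbolic_group = group F + hyperbolic_pseudometric "carrier F" D \<delta>
  for F :: "('a, 'm) monoid_scheme" (structure) and D :: "'a \<Rightarrow> 'a \<Rightarrow> real" and \<delta> :: real +
  assumes D_left: "\<lbrakk>g \<in> carrier F; x \<in> carrier F; y \<in> carrier F\<rbrakk> \<Longrightarrow> D (g \<otimes> x) (g \<otimes> y) = D x y"
    and acylindrical: "0 < \<epsilon> \<Longrightarrow> \<exists>R. \<forall>x\<in>carrier F. \<forall>y\<in>carrier F. R \<le> D x y \<longrightarrow>
      finite {g \<in> carrier F. D x (g \<otimes> x) \<le> \<epsilon> \<and> D y (g \<otimes> y) \<le> \<epsilon>}"
begin

lemma gp_left: "\<lbrakk>g \<in> carrier F; w \<in> carrier F; x \<in> carrier F; y \<in> carrier F\<rbrakk> \<Longrightarrow>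
    gp (g \<otimes> w) (g \<otimes> x) (g \<otimes> y) = gp w x y"
  by (simp add: gp_def D_left)

lemma D_shift: "\<lbrakk>g \<in> carrier F; x \<in> carrier F; y \<in> carrier F\<rbrakk> \<Longrightarrow> D (g \<otimes> x) y = D x (inv g \<otimes> y)"
  using D_left[of "inv g" "g \<otimes> x" y] by (simp add: m_assoc[symmetric])

lemma D_shift1: "\<lbrakk>g \<in> carrier F; x \<in> carrier F\<rbrakk> \<Longrightarrow> D g (g \<otimes> x) = D \<one> x"
  using D_left[of g \<one> x] by simp

lemma D_inv: "g \<in> carrier F \<Longrightarrow> D \<one> (inv g) = D \<one> g"
  using D_shift1[of g "inv g"] D_sym[of g \<one>] by simp

text \<open>A local certificate in place of the usual asymptotic notion: the powers of
  \<open>w\<close> form a chain as in \<open>chain_growth\<close>, where \<open>c\<close> bounds the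
  product at each corner and \<open>\<eta>\<close> is the growth per step. The powers then stand for
  the axis of \<open>w\<close>.\<close>

definition loxodromic :: "real \<Rightarrow> real \<Rightarrow> 'a \<Rightarrow> bool" where
  "loxodromic c \<eta> w \<longleftrightarrow> w \<in> carrier F \<and> 0 \<le> c \<and> 0 < \<eta> \<and> gp \<one> (inv w) w \<le> c \<and>
    2 * c + 4 * \<delta> + \<eta> \<le> D \<one> w"

lemma loxodromic_closed: "loxodromic c \<eta> w \<Longrightarrow> w \<in> carrier F"
  by (simp add: loxodromic_def)

lemma loxodromic_inv: "loxodromic c \<eta> w \<Longrightarrow> loxodromic c \<eta> (inv w)"
  using gp_commute[of w "inv w" \<one>] by (auto simp: loxodromic_def D_inv)

lemma D_pow: "w \<in> carrier F \<Longrightarrow> D (w [^] (i::int)) (w [^] (j::int)) = D \<one> (w [^] (j - i))"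
  using D_shift1[of "w [^] i" "w [^] (j - i)"] by (simp add: int_pow_mult[symmetric])

lemma D_pow_minus: "w \<in> carrier F \<Longrightarrow> D \<one> (w [^] (- i::int)) = D \<one> (w [^] i)"
  using D_inv[of "w [^] i"] by (simp add: int_pow_neg)

lemma D_pow_abs: "w \<in> carrier F \<Longrightarrow> D \<one> (w [^] \<bar>i::int\<bar>) = D \<one> (w [^] i)"
  by (simp add: abs_if D_pow_minus)

context
  fixes c \<eta> w
  assumes lox: "loxodromic c \<eta> w"
begin

private lemma w: "w \<in> carrier F" using lox by (simp add: loxodromic_def)

private lemma step_gp: "gp (w [^] (i + 1::int)) (w [^] i) (w [^] (i + 2)) \<le> c"
proof -
  have "gp (w [^] (i + 1) \<otimes> \<one>) (w [^] (i + 1) \<otimes> w [^] (- 1::int)) (w [^] (i + 1) \<otimes> w [^] (1::int))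
      = gp \<one> (w [^] (- 1::int)) (w [^] (1::int))"
    by (rule gp_left) (use w in auto)
  also have "w [^] (i + 1) \<otimes> w [^] (- 1::int) = w [^] i"
    using w by (simp add: int_pow_mult[symmetric])
  also have "w [^] (i + 1) \<otimes> w [^] (1::int) = w [^] (i + 2)"
    using int_pow_mult[OF w, of "i + 1" 1] by (simp add: add.assoc)
  finally show ?thesis using lox w by (simp add: loxodromic_def int_pow_neg)
qed

private lemma step_D: "2 * c + 4 * \<delta> + \<eta> \<le> D (w [^] (i::int)) (w [^] (i + 1))"
  using lox w by (simp add: loxodromic_def D_pow)

lemma lox_between:
  assumes "i \<le> j" "j \<le> (k::int)"
  shows "gp (w [^] j) (w [^] i) (w [^] k) \<le> c + 2 * \<delta>"
proof -
  have "gp (w [^] (i + int (nat (j - i)))) (w [^] (i + int 0)) (w [^] (i + int (nat (k - i)))) \<le> c + 2 * \<delta>"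
  proof (rule chain_between[where x = "\<lambda>m. w [^] (i + int m)" and n = "nat (k - i)"])
    show "0 \<le> c" using lox by (simp add: loxodromic_def)
  next
    fix m
    show "gp (w [^] (i + int (Suc m))) (w [^] (i + int m)) (w [^] (i + int (m + 2))) \<le> c"
      using step_gp[of "i + int m"] by (simp add: algebra_simps)
  next
    fix m
    have "0 < \<eta>" using lox by (simp add: loxodromic_def)
    then show "2 * c + 4 * \<delta> \<le> D (w [^] (i + int m)) (w [^] (i + int (Suc m)))"
      using step_D[of "i + int m"] by (simp add: algebra_simps)
  qed (use w assms in auto)
  then show ?thesis using assms by simp
qed

lemma lox_growth: "\<eta> * real_of_int \<bar>i\<bar> \<le> D \<one> (w [^] (i::int))"
proof -
  have "\<eta> * real (nat \<bar>i\<bar>) \<le> D (w [^] int 0) (w [^] int (nat \<bar>i\<bar>))"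
  proof (rule chain_growth[where x = "\<lambda>m. w [^] int m" and n = "nat \<bar>i\<bar>"])
    show "0 \<le> c" "0 \<le> \<eta>" using lox by (simp_all add: loxodromic_def)
  next
    fix m
    show "gp (w [^] int (Suc m)) (w [^] int m) (w [^] int (m + 2)) \<le> c"
      using step_gp[of "int m"] by (simp add: algebra_simps)
  next
    fix m
    show "2 * c + 4 * \<delta> + \<eta> \<le> D (w [^] int m) (w [^] int (Suc m))"
      using step_D[of "int m"] by (simp add: algebra_simps)
  qed (use w in auto)
  then show ?thesis using D_pow_abs[OF w, of i] by simp
qed

lemma lox_add:
  assumes "0 \<le> i" "0 \<le> (j::int)"
  shows "D \<one> (w [^] i) + D \<one> (w [^] j) - 2 * (c + 2 * \<delta>) \<le> D \<one> (w [^] (i + j))"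
proof -
  have "gp (w [^] i) (w [^] (0::int)) (w [^] (i + j)) \<le> c + 2 * \<delta>"
    by (rule lox_between) (use assms in auto)
  moreover have "D (w [^] (i + j)) (w [^] i) = D \<one> (w [^] j)"
    using D_pow[OF w, of "i + j" i] D_pow_minus[OF w] by simp
  ultimately show ?thesis by (simp add: gp_def)
qed

text \<open>\<open>chain_locate\<close> finds consecutive powers with \<open>y\<close> almost
  between them; they are only \<open>D \<one> w\<close> apart, so \<open>y\<close> is near one of
  them. The rest of the constant is that of \<open>chain_locate\<close> for the corner bound
  \<open>c + 2 * \<delta>\<close> from \<open>lox_between\<close>.\<close>

lemma lox_near_le:
  assumes y: "y \<in> carrier F" and ij: "i \<le> (j::int)" and k: "gp y (w [^] i) (w [^] j) \<le> \<kappa>"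
  shows "\<exists>k. i \<le> k \<and> k \<le> j \<and> D y (w [^] k) \<le> 2 * \<kappa> + 6 * \<delta> + 2 * c + D \<one> w"
proof (cases "i = j")
  case True
  have "D y (w [^] i) = gp y (w [^] i) (w [^] i)"
    using D_refl[of "w [^] i"] D_sym[of y "w [^] i"] w y by (simp add: gp_def)
  moreover have "0 \<le> gp y (w [^] i) (w [^] j)" using gp_nonneg w y by simp
  moreover have "0 \<le> c" using lox by (simp add: loxodromic_def)
  moreover have "0 \<le> D \<one> w" using D_nonneg w by simp
  moreover have "gp y (w [^] i) (w [^] i) \<le> \<kappa>" using k True by simp
  ultimately have "D y (w [^] i) \<le> 2 * \<kappa> + 6 * \<delta> + 2 * c + D \<one> w"
    using True \<delta>_pos by simp
  then show ?thesis using True by blast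
next
  case False
  have "\<exists>m<nat (j - i). gp y (w [^] (i + int m)) (w [^] (i + int (Suc m)))
      \<le> 2 * \<kappa> + 2 * \<delta> + 2 * (c + 2 * \<delta>)"
  proof (rule chain_locate[where x = "\<lambda>m. w [^] (i + int m)"])
    fix a b d :: nat
    assume "a \<le> b" "b \<le> d"
    then show "gp (w [^] (i + int b)) (w [^] (i + int a)) (w [^] (i + int d)) \<le> c + 2 * \<delta>"
      by (intro lox_between) auto
  qed (use False ij w y k in auto)
  then obtain m where m: "m < nat (j - i)"
    "gp y (w [^] (i + int m)) (w [^] (i + int (Suc m))) \<le> 2 * \<kappa> + 2 * \<delta> + 2 * (c + 2 * \<delta>)" by blast
  have "D y (w [^] (i + int m)) \<le> gp y (w [^] (i + int m)) (w [^] (i + int (Suc m)))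
      + D (w [^] (i + int m)) (w [^] (i + int (Suc m)))"
    by (rule dist_le_gp) (use w y in auto)
  also have "D (w [^] (i + int m)) (w [^] (i + int (Suc m))) = D \<one> w"
    using w by (simp add: D_pow)
  finally have "D y (w [^] (i + int m)) \<le> 2 * \<kappa> + 6 * \<delta> + 2 * c + D \<one> w" using m(2) by simp
  then show ?thesis using m(1) by (intro exI[of _ "i + int m"]) auto
qed

lemma lox_near:
  assumes y: "y \<in> carrier F" and k: "gp y (w [^] (i::int)) (w [^] (j::int)) \<le> \<kappa>"
  shows "\<exists>k. min i j \<le> k \<and> k \<le> max i j \<and> D y (w [^] k) \<le> 2 * \<kappa> + 6 * \<delta> + 2 * c + D \<one> w"
proof (cases "i \<le> j")
  case True
  then show ?thesis using lox_near_le[OF y True k] by auto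
next
  case False
  then have "gp y (w [^] j) (w [^] i) \<le> \<kappa>" using k gp_commute[of "w [^] i" "w [^] j" y] w by simp
  then show ?thesis using lox_near_le[of y j i \<kappa>] y False by auto
qed

end

end

text \<open>Geometry yields relations between powers; this property brings them down to the
  elements. It is what separability for two primes provides for the elements of \<open>N1\<close>
  and \<open>N2\<close>.\<close>

definition root_commuting :: "('a, 'm) monoid_scheme \<Rightarrow> 'a \<Rightarrow> bool" where
  "root_commuting F w \<longleftrightarrow> (\<forall>f\<in>carrier F. \<forall>m::nat. 0 < m \<longrightarrow>
    (f [^]\<^bsub>F\<^esub> m \<otimes>\<^bsub>F\<^esub> w = w \<otimes>\<^bsub>F\<^esub> f [^]\<^bsub>F\<^esub> m \<longrightarrow> f \<otimes>\<^bsub>F\<^esub> w = w \<otimes>\<^bsub>F\<^esub> f) \<and>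
    (f \<otimes>\<^bsub>F\<^esub> w [^]\<^bsub>F\<^esub> m = w [^]\<^bsub>F\<^esub> m \<otimes>\<^bsub>F\<^esub> f \<longrightarrow> f \<otimes>\<^bsub>F\<^esub> w = w \<otimes>\<^bsub>F\<^esub> f))"

section \<open>Intertwining and commutation relations\<close>

context group
begin

lemma intertwine_inv:
  assumes "v \<in> carrier G" "x \<in> carrier G" "y \<in> carrier G" "v \<otimes> x = y \<otimes> v"
  shows "v \<otimes> inv x = inv y \<otimes> v"
proof -
  have "inv y \<otimes> v = inv y \<otimes> ((v \<otimes> x) \<otimes> inv x)" using assms(1-3) by (simp add: m_assoc)
  also have "\<dots> = (inv y \<otimes> y) \<otimes> (v \<otimes> inv x)"
    unfolding assms(4) using assms(1-3) by (simp only: m_assoc m_closed inv_closed)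
  finally show ?thesis using assms(1-3) by simp
qed

lemma intertwine_swap:
  assumes "v \<in> carrier G" "x \<in> carrier G" "y \<in> carrier G" "v \<otimes> x = y \<otimes> v"
  shows "inv v \<otimes> y = x \<otimes> inv v"
proof -
  have "inv v \<otimes> y = inv v \<otimes> ((y \<otimes> v) \<otimes> inv v)" using assms(1-3) by (simp add: m_assoc)
  also have "\<dots> = (inv v \<otimes> v) \<otimes> (x \<otimes> inv v)"
    unfolding assms(4)[symmetric] using assms(1-3) by (simp only: m_assoc m_closed inv_closed)
  finally show ?thesis using assms(1-3) by simp
qed

lemma intertwine_pow:
  assumes "v \<in> carrier G" "x \<in> carrier G" "y \<in> carrier G" "v \<otimes> x = y \<otimes> v"
  shows "v \<otimes> x [^] (n::nat) = y [^] n \<otimes> v"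
proof (induction n)
  case 0
  then show ?case using assms by simp
next
  case (Suc n)
  have "v \<otimes> x [^] Suc n = (v \<otimes> x [^] n) \<otimes> x" using assms(1-3) by (simp add: m_assoc)
  also have "\<dots> = y [^] n \<otimes> (v \<otimes> x)" using assms(1-3) by (simp add: Suc m_assoc)
  also have "\<dots> = y [^] Suc n \<otimes> v" unfolding assms(4) using assms(1-3) by (simp add: m_assoc)
  finally show ?case .
qed

lemma commute_inv:
  "\<lbrakk>x \<in> carrier G; y \<in> carrier G; x \<otimes> y = y \<otimes> x\<rbrakk> \<Longrightarrow> x \<otimes> inv y = inv y \<otimes> x"
  by (rule intertwine_inv)

lemma commute_inv_iff:
  "\<lbrakk>x \<in> carrier G; y \<in> carrier G\<rbrakk> \<Longrightarrow> x \<otimes> inv y = inv y \<otimes> x \<longleftrightarrow> x \<otimes> y = y \<otimes> x"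
  using commute_inv[of x y] commute_inv[of x "inv y"] inv_inv[of y] inv_closed[of y] by metis

lemma commute_mult:
  assumes "x \<in> carrier G" "y \<in> carrier G" "z \<in> carrier G" "x \<otimes> y = y \<otimes> x" "x \<otimes> z = z \<otimes> x"
  shows "x \<otimes> (y \<otimes> z) = (y \<otimes> z) \<otimes> x"
proof -
  have "x \<otimes> (y \<otimes> z) = (y \<otimes> x) \<otimes> z" using assms(1-3) by (simp add: m_assoc[symmetric] assms(4))
  also have "\<dots> = y \<otimes> (z \<otimes> x)" using assms(1-3) by (simp add: m_assoc assms(5))
  finally show ?thesis using assms(1-3) by (simp add: m_assoc)
qed

lemma commute_nat_pow:
  "\<lbrakk>x \<in> carrier G; y \<in> carrier G; x \<otimes> y = y \<otimes> x\<rbrakk> \<Longrightarrow> x \<otimes> y [^] (n::nat) = y [^] n \<otimes> x"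
  by (rule intertwine_pow)

lemma commute_int_pow:
  "\<lbrakk>x \<in> carrier G; y \<in> carrier G; x \<otimes> y = y \<otimes> x\<rbrakk> \<Longrightarrow> x \<otimes> y [^] (n::int) = y [^] n \<otimes> x"
  by (cases n rule: int_cases2) (simp_all only: int_pow_int int_pow_neg_int commute_nat_pow commute_inv nat_pow_closed)

lemma commute_int_pow_abs:
  assumes "x \<in> carrier G" "y \<in> carrier G"
  shows "x \<otimes> y [^] (n::int) = y [^] n \<otimes> x \<longleftrightarrow> x \<otimes> y [^] (nat \<bar>n\<bar>) = y [^] (nat \<bar>n\<bar>) \<otimes> x"
  by (cases n rule: int_cases2)
    (simp_all only: int_pow_int int_pow_neg_int abs_minus_cancel abs_of_nat nat_int commute_inv_iff
      nat_pow_closed assms)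

lemma root_commutingD1:
  "\<lbrakk>root_commuting G w; f \<in> carrier G; 0 < m; f [^] (m::nat) \<otimes> w = w \<otimes> f [^] m\<rbrakk> \<Longrightarrow> f \<otimes> w = w \<otimes> f"
  by (simp add: root_commuting_def)

lemma root_commutingD2:
  assumes "root_commuting G w" "f \<in> carrier G" "w \<in> carrier G" "n \<noteq> 0"
    "f \<otimes> w [^] (n::int) = w [^] n \<otimes> f"
  shows "f \<otimes> w = w \<otimes> f"
proof -
  have "f \<otimes> w [^] (nat \<bar>n\<bar>) = w [^] (nat \<bar>n\<bar>) \<otimes> f"
    using assms commute_int_pow_abs[of f w n] by simp
  then show ?thesis using assms unfolding root_commuting_def by (metis zero_less_abs_iff zero_less_nat_eq)
qed

lemma root_commuting_inv:
  assumes "root_commuting G w" "w \<in> carrier G"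
  shows "root_commuting G (inv w)"
  unfolding root_commuting_def
proof (intro ballI allI impI conjI)
  fix f and m :: nat
  assume f: "f \<in> carrier G" and m: "0 < m"
  {
    assume "f [^] m \<otimes> inv w = inv w \<otimes> f [^] m"
    then have "f [^] m \<otimes> w = w \<otimes> f [^] m" using commute_inv_iff[of "f [^] m" w] f assms by simp
    then have "f \<otimes> w = w \<otimes> f" using root_commutingD1[OF assms(1) f m] by simp
    then show "f \<otimes> inv w = inv w \<otimes> f" using f assms by (simp add: commute_inv)
  next
    assume "f \<otimes> inv w [^] m = inv w [^] m \<otimes> f"
    then have "f \<otimes> w [^] m = w [^] m \<otimes> f" using commute_inv_iff[of f "w [^] m"] f assms by (simp add: nat_pow_inv)
    then have "f \<otimes> w = w \<otimes> f" using assms(1) f m by (simp add: root_commuting_def)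
    then show "f \<otimes> inv w = inv w \<otimes> f" using f assms by (simp add: commute_inv)
  }
qed

end

section \<open>Elements that overlap or centralize the axis of a loxodromic element\<close>

context hyperbolic_group
begin

lemma D_mult_le: "\<lbrakk>x \<in> carrier F; y \<in> carrier F\<rbrakk> \<Longrightarrow> D \<one> (x \<otimes> y) \<le> D \<one> x + D \<one> y"
  using D_tri[of \<one> x "x \<otimes> y"] D_shift1[of x y] by simp

text \<open>Take \<open>n\<close>-th powers of the relation. Conjugation by \<open>v\<close> changes
  lengths by at most \<open>2 * D \<one> v\<close>, whereas for
  \<open>\<bar>a\<bar> < \<bar>b\<bar>\<close> the length of \<open>w [^] (b * int n)\<close>
  exceeds that of \<open>w [^] (a * int n)\<close> by an amount that grows at least linearly in
  \<open>n\<close>.\<close>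

lemma lox_conj_exponent_le:
  assumes lox: "loxodromic c \<eta> w" and v: "v \<in> carrier F"
    and e: "v \<otimes> w [^] (a::int) = w [^] (b::int) \<otimes> v"
  shows "\<bar>b\<bar> \<le> \<bar>a\<bar>"
proof (rule ccontr)
  assume "\<not> ?thesis"
  then have ab: "\<bar>a\<bar> < \<bar>b\<bar>" by simp
  have w: "w \<in> carrier F" and \<eta>: "0 < \<eta>" using lox by (simp_all add: loxodromic_def)
  obtain n :: nat where n: "2 * (c + 2 * \<delta>) + 2 * D \<one> v < \<eta> * real n"
    using reals_Archimedean3[OF \<eta>] by (metis mult.commute)
  have "v \<otimes> (w [^] a) [^] n = (w [^] b) [^] n \<otimes> v"
    using e v w by (intro intertwine_pow) auto
  then have "v \<otimes> w [^] (a * int n) = w [^] (b * int n) \<otimes> v"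
    using w by (metis int_pow_int int_pow_pow)
  then have "w [^] (b * int n) = (v \<otimes> w [^] (a * int n)) \<otimes> inv v"
    using v w by (simp add: m_assoc)
  then have "D \<one> (w [^] (b * int n)) \<le> D \<one> (v \<otimes> w [^] (a * int n)) + D \<one> (inv v)"
    using D_mult_le[of "v \<otimes> w [^] (a * int n)" "inv v"] v w by simp
  also have "\<dots> \<le> D \<one> (w [^] (a * int n)) + 2 * D \<one> v"
    using D_mult_le[of v "w [^] (a * int n)"] v w by (simp add: D_inv)
  finally have le: "D \<one> (w [^] \<bar>b * int n\<bar>) \<le> D \<one> (w [^] \<bar>a * int n\<bar>) + 2 * D \<one> v"
    using w by (simp add: D_pow_abs)
  have "D \<one> (w [^] \<bar>a * int n\<bar>) + D \<one> (w [^] ((\<bar>b\<bar> - \<bar>a\<bar>) * int n)) - 2 * (c + 2 * \<delta>)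
      \<le> D \<one> (w [^] (\<bar>a * int n\<bar> + (\<bar>b\<bar> - \<bar>a\<bar>) * int n))"
    by (rule lox_add[OF lox]) (use ab in auto)
  also have "\<bar>a * int n\<bar> + (\<bar>b\<bar> - \<bar>a\<bar>) * int n = \<bar>b * int n\<bar>" by (simp add: abs_mult algebra_simps)
  finally have "D \<one> (w [^] ((\<bar>b\<bar> - \<bar>a\<bar>) * int n)) \<le> 2 * (c + 2 * \<delta>) + 2 * D \<one> v"
    using le by simp
  moreover have "\<eta> * real_of_int \<bar>(\<bar>b\<bar> - \<bar>a\<bar>) * int n\<bar> \<le> D \<one> (w [^] ((\<bar>b\<bar> - \<bar>a\<bar>) * int n))"
    by (rule lox_growth[OF lox])
  moreover have "int n \<le> \<bar>(\<bar>b\<bar> - \<bar>a\<bar>) * int n\<bar>"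
    using ab mult_right_mono[of 1 "\<bar>b\<bar> - \<bar>a\<bar>" "int n"] by simp
  then have "real n \<le> real_of_int \<bar>(\<bar>b\<bar> - \<bar>a\<bar>) * int n\<bar>" by linarith
  then have "\<eta> * real n \<le> \<eta> * real_of_int \<bar>(\<bar>b\<bar> - \<bar>a\<bar>) * int n\<bar>"
    using \<eta> by (intro mult_left_mono) auto
  ultimately show False using n by linarith
qed

lemma lox_conj_exponent:
  assumes lox: "loxodromic c \<eta> w" and v: "v \<in> carrier F"
    and e: "v \<otimes> w [^] (a::int) = w [^] (b::int) \<otimes> v"
  shows "\<bar>a\<bar> = \<bar>b\<bar>"
proof -
  have w: "w \<in> carrier F" using lox by (rule loxodromic_closed)
  have "inv v \<otimes> w [^] b = w [^] a \<otimes> inv v"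
    by (rule intertwine_swap) (use e v w in auto)
  then have "\<bar>a\<bar> \<le> \<bar>b\<bar>" by (rule lox_conj_exponent_le[OF lox, rotated]) (use v in auto)
  then show ?thesis using lox_conj_exponent_le[OF assms] by simp
qed

text \<open>The exponents agree up to sign. If the signs differ, \<open>v\<close> inverts
  \<open>w [^] a\<close>, so its square commutes with \<open>w [^] a\<close>;
  \<open>root_commuting\<close> then passes from the square to \<open>v\<close>.\<close>

lemma lox_intertwine_commute:
  assumes lox: "loxodromic c \<eta> w" and rc: "root_commuting F w" and v: "v \<in> carrier F"
    and e: "v \<otimes> w [^] (a::int) = w [^] (b::int) \<otimes> v" and a: "a \<noteq> 0"
  shows "v \<otimes> w = w \<otimes> v"
proof -
  have w: "w \<in> carrier F" using lox by (rule loxodromic_closed)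
  consider "b = a" | "b = - a" using lox_conj_exponent[OF lox v e] by linarith
  then show ?thesis
  proof cases
    case 1
    then show ?thesis using root_commutingD2[OF rc v w a] e by simp
  next
    case 2
    have wa: "w [^] a \<in> carrier F" "w [^] (- a) \<in> carrier F" using w by auto
    have e1: "v \<otimes> w [^] a = w [^] (- a) \<otimes> v" using e 2 by simp
    have "v \<otimes> inv (w [^] a) = inv (w [^] (- a)) \<otimes> v"
      by (rule intertwine_inv) (use e1 v wa in auto)
    then have e2: "v \<otimes> w [^] (- a) = w [^] a \<otimes> v" using w by (simp add: int_pow_neg)
    have "v [^] (2::nat) \<otimes> w [^] a = v \<otimes> (v \<otimes> w [^] a)" using v w by (simp add: numeral_2_eq_2 m_assoc)
    also have "\<dots> = (v \<otimes> w [^] (- a)) \<otimes> v" using v wa e1 by (simp add: m_assoc)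
    also have "\<dots> = w [^] a \<otimes> v [^] (2::nat)" using v wa e2 by (simp add: numeral_2_eq_2 m_assoc)
    finally have "v [^] (2::nat) \<otimes> w = w \<otimes> v [^] (2::nat)"
      using root_commutingD2[OF rc _ w a] v by simp
    then show ?thesis by (rule root_commutingD1[OF rc v, rotated]) simp
  qed
qed

text \<open>Two such elements with the same \<open>e\<close> differ by an element that moves both
  \<open>\<one>\<close> and \<open>w [^] int T\<close> by at most \<open>2 * C\<close>. For large
  \<open>T\<close> acylindricity leaves finitely many for each \<open>e\<close>, and linear growth
  of the powers bounds \<open>\<bar>e\<bar>\<close>.\<close>

lemma lox_displacement_finite:
  assumes lox: "loxodromic c \<eta> w" and C: "0 < C"
  shows "\<exists>T::nat. finite {g \<in> carrier F. D \<one> g \<le> C \<and> (\<exists>e::int. D (g \<otimes> w [^] int T) (w [^] e) \<le> C)}"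
proof -
  have w: "w \<in> carrier F" and \<eta>: "0 < \<eta>" using lox by (simp_all add: loxodromic_def)
  obtain R where R: "\<And>x y. \<lbrakk>x \<in> carrier F; y \<in> carrier F; R \<le> D x y\<rbrakk> \<Longrightarrow>
      finite {g \<in> carrier F. D x (g \<otimes> x) \<le> 2 * C \<and> D y (g \<otimes> y) \<le> 2 * C}"
    using acylindrical[of "2 * C"] C by auto
  obtain T :: nat where "R < \<eta> * real T" using reals_Archimedean3[OF \<eta>] by (metis mult.commute)
  then have T: "R \<le> D \<one> (w [^] int T)" using lox_growth[OF lox, of "int T"] by simp
  define A where "A = {g \<in> carrier F. D \<one> (g \<otimes> \<one>) \<le> 2 * C \<and> D (w [^] int T) (g \<otimes> w [^] int T) \<le> 2 * C}"
  have A: "finite A" unfolding A_def by (rule R) (use w T in auto)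
  define S where "S e = {g \<in> carrier F. D \<one> g \<le> C \<and> D (g \<otimes> w [^] int T) (w [^] e) \<le> C}" for e :: int
  have S: "finite (S e)" for e
  proof (cases "S e = {}")
    case False
    then obtain g0 where g0: "g0 \<in> carrier F" "D \<one> g0 \<le> C" "D (g0 \<otimes> w [^] int T) (w [^] e) \<le> C"
      by (auto simp: S_def)
    have "(\<lambda>g. inv g0 \<otimes> g) ` S e \<subseteq> A"
    proof
      fix x assume "x \<in> (\<lambda>g. inv g0 \<otimes> g) ` S e"
      then obtain g where g: "g \<in> carrier F" "D \<one> g \<le> C" "D (g \<otimes> w [^] int T) (w [^] e) \<le> C"
        and x: "x = inv g0 \<otimes> g" by (auto simp: S_def)
      have "D \<one> x \<le> D \<one> (inv g0) + D \<one> g" unfolding x by (rule D_mult_le) (use g g0 in auto)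
      then have "D \<one> x \<le> 2 * C" using g g0 by (simp add: D_inv)
      moreover have "D (w [^] int T) (x \<otimes> w [^] int T) = D (g0 \<otimes> w [^] int T) (g \<otimes> w [^] int T)"
        using D_shift[of g0 "w [^] int T" "g \<otimes> w [^] int T"] g g0 w x by (simp add: m_assoc)
      then have "D (w [^] int T) (x \<otimes> w [^] int T) \<le> 2 * C"
        using D_tri[of "g0 \<otimes> w [^] int T" "w [^] e" "g \<otimes> w [^] int T"]
          D_sym[of "w [^] e" "g \<otimes> w [^] int T"] g g0 w by simp
      ultimately show "x \<in> A" using g g0 x by (simp add: A_def)
    qed
    then have "finite ((\<lambda>g. inv g0 \<otimes> g) ` S e)" using A finite_subset by blast
    moreover have "inj_on (\<lambda>g. inv g0 \<otimes> g) (S e)"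
      using g0 by (intro inj_onI) (auto simp: S_def)
    ultimately show ?thesis using finite_imageD by blast
  qed simp
  define E where "E = \<lceil>(2 * C + D \<one> (w [^] int T)) / \<eta>\<rceil>"
  have "{g \<in> carrier F. D \<one> g \<le> C \<and> (\<exists>e::int. D (g \<otimes> w [^] int T) (w [^] e) \<le> C)} \<subseteq> (\<Union>e\<in>{-E..E}. S e)"
  proof clarify
    fix g and e :: int assume g: "g \<in> carrier F" "D \<one> g \<le> C" "D (g \<otimes> w [^] int T) (w [^] e) \<le> C"
    have "D \<one> (w [^] e) \<le> D \<one> (g \<otimes> w [^] int T) + D (g \<otimes> w [^] int T) (w [^] e)"
      by (rule D_tri) (use g w in auto)
    also have "\<dots> \<le> 2 * C + D \<one> (w [^] int T)" using g w D_mult_le[of g "w [^] int T"] by simp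
    finally have "\<eta> * real_of_int \<bar>e\<bar> \<le> 2 * C + D \<one> (w [^] int T)"
      using lox_growth[OF lox, of e] by simp
    then have "real_of_int \<bar>e\<bar> \<le> (2 * C + D \<one> (w [^] int T)) / \<eta>"
      using \<eta> by (simp add: field_simps)
    then have "\<bar>e\<bar> \<le> E" unfolding E_def by linarith
    then show "g \<in> (\<Union>e\<in>{-E..E}. S e)" using g by (auto simp: S_def intro!: bexI[of _ e])
  qed
  moreover have "finite (\<Union>e\<in>{-E..E}. S e)" using S by auto
  ultimately show ?thesis using finite_subset by blast
qed

text \<open>Translating the long overlap along the axis by powers of \<open>w\<close> on both sides yields elements of
  bounded displacement; acylindricity forces two of them to coincide.\<close>

lemma lox_overlap_commute:
  assumes lox: "loxodromic c \<eta> w" and rc: "root_commuting F w" and C: "0 < C"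
  shows "\<exists>L::nat. \<forall>v\<in>carrier F. \<forall>(i::int) (j::int). D v (w [^] i) \<le> C \<and> D (v \<otimes> w [^] int L) (w [^] j) \<le> C
    \<longrightarrow> v \<otimes> w = w \<otimes> v"
proof -
  have w: "w \<in> carrier F" and \<eta>: "0 < \<eta>" and c: "0 \<le> c" using lox by (simp_all add: loxodromic_def)
  \<comment> \<open>\<open>c + 2 * \<delta>\<close> is the product along the translated axis, and
    each of its two ends is moved by \<open>C\<close> to a power of \<open>w\<close>.\<close>
  define \<kappa> where "\<kappa> = c + 2 * \<delta> + C + C"
  define C' where "C' = 2 * \<kappa> + 6 * \<delta> + 2 * c + D \<one> w"
  have "0 < C'" using C c \<delta>_pos D_nonneg[of \<one> w] w by (simp add: C'_def \<kappa>_def)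
  then obtain T :: nat where "finite {g \<in> carrier F. D \<one> g \<le> C' \<and> (\<exists>e::int. D (g \<otimes> w [^] int T) (w [^] e) \<le> C')}"
    (is "finite ?S") using lox_displacement_finite[OF lox] by blast
  then have fin: "finite ?S" .
  \<comment> \<open>The pigeonhole argument takes the \<open>card ?S + 1\<close> shifts
    \<open>m \<le> card ?S\<close>, and \<open>m + T\<close> must still lie on the overlap.\<close>
  define L where "L = card ?S + T"
  have *: "v \<otimes> w = w \<otimes> v" if v: "v \<in> carrier F" and i: "D v (w [^] i) \<le> C"
      and j: "D (v \<otimes> w [^] int L) (w [^] j) \<le> C" for v and i j :: int
  proof -
    have "\<exists>k::int. D (v \<otimes> w [^] int m) (w [^] k) \<le> C'" if m: "m \<le> L" for m
    proof -
      have "gp (v \<otimes> w [^] int m) (v \<otimes> w [^] int 0) (v \<otimes> w [^] int L)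
          = gp (w [^] int m) (w [^] int 0) (w [^] int L)"
        by (rule gp_left) (use v w in auto)
      also have "\<dots> \<le> c + 2 * \<delta>" by (rule lox_between[OF lox]) (use m in auto)
      finally have "gp (v \<otimes> w [^] int m) (w [^] i) (w [^] j) \<le> \<kappa>"
        using gp_change2[of "v \<otimes> w [^] int m" v "v \<otimes> w [^] int L" "w [^] i" "w [^] j"] i j v w
        by (simp add: \<kappa>_def)
      then show ?thesis using lox_near[OF lox, of "v \<otimes> w [^] int m" i j \<kappa>] v w by (auto simp: C'_def)
    qed
    then obtain k where k: "\<And>m. m \<le> L \<Longrightarrow> D (v \<otimes> w [^] int m) (w [^] (k m :: int)) \<le> C'" by metis
    define g where "g m = inv (w [^] k m) \<otimes> (v \<otimes> w [^] int m)" for m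
    have g: "g m \<in> carrier F" for m using v w by (simp add: g_def)
    have "g ` {..card ?S} \<subseteq> ?S"
    proof
      fix x assume "x \<in> g ` {..card ?S}"
      then obtain m where m: "m \<le> card ?S" "x = g m" by auto
      have "D \<one> (g m) = D (w [^] k m) (v \<otimes> w [^] int m)"
        using D_shift[of "w [^] k m" \<one> "v \<otimes> w [^] int m"] v w by (simp add: g_def)
      then have 1: "D \<one> (g m) \<le> C'" using k[of m] m D_sym[of "w [^] k m" "v \<otimes> w [^] int m"] v w by (simp add: L_def)
      have "w [^] k m \<otimes> (g m \<otimes> w [^] int T) = v \<otimes> (w [^] int m \<otimes> w [^] int T)"
        using v w by (simp add: g_def m_assoc[symmetric])
      also have "\<dots> = v \<otimes> w [^] int (m + T)" using w by (simp add: int_pow_mult)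
      finally have a: "w [^] k m \<otimes> (g m \<otimes> w [^] int T) = v \<otimes> w [^] int (m + T)" .
      have b: "w [^] k m \<otimes> w [^] (k (m + T) - k m) = w [^] k (m + T)" using w by (simp add: int_pow_mult[symmetric])
      have "D (g m \<otimes> w [^] int T) (w [^] (k (m + T) - k m)) = D (v \<otimes> w [^] int (m + T)) (w [^] k (m + T))"
        using D_left[of "w [^] k m" "g m \<otimes> w [^] int T" "w [^] (k (m + T) - k m)"] w g by (simp only: a b int_pow_closed m_closed)
      then have "D (g m \<otimes> w [^] int T) (w [^] (k (m + T) - k m)) \<le> C'"
        using k[of "m + T"] m by (simp add: L_def)
      with 1 show "x \<in> ?S" using m g by auto
    qed
    then have "card (g ` {..card ?S}) \<le> card ?S" using fin by (rule card_mono[rotated])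
    then have "\<not> inj_on g {..card ?S}" by (intro pigeonhole) simp
    then obtain m m' where mm: "m \<noteq> m'" "g m = g m'" by (auto simp: inj_on_def)
    \<comment> \<open>Equality of \<open>g m\<close> and \<open>g m'\<close> means that
      \<open>v\<close> intertwines the nonzero power \<open>w [^] (int m - int m')\<close> with a
      power of \<open>w\<close>.\<close>
    have "v \<otimes> w [^] int m = w [^] k m \<otimes> (inv (w [^] k m') \<otimes> (v \<otimes> w [^] int m'))"
      using mm(2) v w unfolding g_def by (metis g_def inv_solve_left g int_pow_closed m_closed)
    also have "\<dots> = (w [^] k m \<otimes> w [^] (- k m')) \<otimes> (v \<otimes> w [^] int m')"
      using v w by (simp add: m_assoc int_pow_neg)
    also have "\<dots> = w [^] (k m - k m') \<otimes> (v \<otimes> w [^] int m')"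
      using w by (simp add: int_pow_mult[symmetric])
    finally have "(v \<otimes> w [^] int m) \<otimes> w [^] (- int m') = (w [^] (k m - k m') \<otimes> (v \<otimes> w [^] int m')) \<otimes> w [^] (- int m')"
      by simp
    then have "v \<otimes> (w [^] int m \<otimes> w [^] (- int m')) = w [^] (k m - k m') \<otimes> (v \<otimes> (w [^] int m' \<otimes> w [^] (- int m')))"
      using v w by (simp add: m_assoc)
    then have "v \<otimes> w [^] (int m - int m') = w [^] (k m - k m') \<otimes> v"
      using v w by (simp add: int_pow_mult[symmetric])
    then show ?thesis by (rule lox_intertwine_commute[OF lox rc v]) (use mm in auto)
  qed
  show ?thesis
    by (intro exI[of _ L] ballI allI impI, elim conjE) (rule *, assumption+)
qed

end

context group
begin

lemma mult_inv_cancel [simp]: "\<lbrakk>x \<in> carrier G; y \<in> carrier G\<rbrakk> \<Longrightarrow> x \<otimes> (inv x \<otimes> y) = y"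
  by (simp add: m_assoc[symmetric])

lemma inv_mult_cancel [simp]: "\<lbrakk>x \<in> carrier G; y \<in> carrier G\<rbrakk> \<Longrightarrow> inv x \<otimes> (x \<otimes> y) = y"
  by (simp add: m_assoc[symmetric])

end

context hyperbolic_group
begin

lemma D_pow_le: "w \<in> carrier F \<Longrightarrow> D \<one> (w [^] (n::nat)) \<le> real n * D \<one> w"
proof (induction n)
  case 0
  then show ?case using D_refl[of \<one>] by simp
next
  case (Suc n)
  then show ?case using D_mult_le[of "w [^] n" w] by (simp add: algebra_simps)
qed

text \<open>Let \<open>H\<close> be a power of \<open>h\<close> at least as long as
  \<open>v\<close>. The points \<open>\<one>\<close>, \<open>v\<close>,
  \<open>v \<otimes> H = H \<otimes> v\<close>, \<open>H\<close> form a parallelogram with equal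
  opposite sides, and the four-point condition bounds the sum of the distances from \<open>v\<close>
  to \<open>H\<close> and to \<open>inv H\<close> by \<open>2 * D \<one> H + 2 * \<delta>\<close>.
  Up to a constant, \<open>H\<close> and \<open>inv H\<close> are themselves that far apart, so
  \<open>v\<close> lies almost between them.\<close>

lemma lox_centralizer_between:
  assumes lox: "loxodromic c \<eta> h" and v: "v \<in> carrier F" and e: "v \<otimes> h = h \<otimes> v"
  shows "\<exists>K::nat. 0 < K \<and> gp v (h [^] (- int K)) (h [^] int K) \<le> c + 3 * \<delta>"
proof -
  have h: "h \<in> carrier F" and \<eta>: "0 < \<eta>" using lox by (simp_all add: loxodromic_def)
  obtain k :: nat where k: "D \<one> v < \<eta> * real k" using reals_Archimedean3[OF \<eta>] by (metis mult.commute)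
  define H where "H = h [^] int (Suc k)"
  have H: "H \<in> carrier F" using h by (simp add: H_def)
  have iH: "h [^] (- int (Suc k)) = inv H" unfolding H_def by (rule int_pow_neg[OF h])
  have vH: "v \<otimes> H = H \<otimes> v" unfolding H_def by (rule commute_int_pow[OF v h e])
  have lam: "D \<one> v \<le> D \<one> H"
  proof -
    have "\<eta> * real k \<le> \<eta> * real_of_int \<bar>int (Suc k)\<bar>" using \<eta> by (intro mult_left_mono) auto
    then show ?thesis using lox_growth[OF lox, of "int (Suc k)"] k by (simp add: H_def)
  qed
  have "D (v \<otimes> H) v = D \<one> H" using D_shift1[of v H] D_sym[of v "v \<otimes> H"] v H by simp
  then have g1: "2 * gp \<one> v (v \<otimes> H) = D \<one> v + D \<one> (v \<otimes> H) - D \<one> H"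
    using D_sym[of "v \<otimes> H" v] D_sym[of v \<one>] D_sym[of "v \<otimes> H" \<one>] v H by (simp add: gp_def)
  have "D (v \<otimes> H) H = D \<one> v" using D_shift1[of H v] D_sym[of H "H \<otimes> v"] v H by (simp add: vH)
  then have g2: "2 * gp \<one> (v \<otimes> H) H = D \<one> (v \<otimes> H) + D \<one> H - D \<one> v"
    using D_sym[of "v \<otimes> H" \<one>] D_sym[of H \<one>] v H by (simp add: gp_def)
  have g3: "2 * gp \<one> v H = D \<one> v + D \<one> H - D v H"
    using D_sym[of v \<one>] D_sym[of H \<one>] v H by (simp add: gp_def)
  have sum: "D v H + D \<one> (v \<otimes> H) \<le> 2 * D \<one> H + 2 * \<delta>"
    using four_point[of \<one> v "v \<otimes> H" H] g1 g2 g3 lam v H by auto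
  have "D (inv H) v = D \<one> (v \<otimes> H)" using D_left[of H "inv H" v] v H by (simp add: vH)
  moreover have "D \<one> H + D \<one> H - 2 * (c + 2 * \<delta>) \<le> D (inv H) H"
  proof -
    have "D \<one> H + D \<one> H - 2 * (c + 2 * \<delta>) \<le> D \<one> (h [^] (int (Suc k) + int (Suc k)))"
      unfolding H_def by (rule lox_add[OF lox]) auto
    also have "h [^] (int (Suc k) + int (Suc k)) = H \<otimes> H" unfolding H_def by (rule int_pow_mult[OF h])
    also have "D \<one> (H \<otimes> H) = D (inv H) H" using D_left[of H "inv H" H] H by simp
    finally show ?thesis .
  qed
  ultimately have "gp v (inv H) H \<le> c + 3 * \<delta>"
    using sum D_sym[of H v] v H by (simp add: gp_def)
  then show ?thesis using iH by (intro exI[of _ "Suc k"]) (simp add: H_def)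
qed

text \<open>\<open>v\<close> lies near some \<open>w [^] k\<close> by
  \<open>lox_centralizer_between\<close>. The remainder \<open>x\<close> commutes with
  \<open>w\<close>, so it moves \<open>w [^] int T\<close> exactly as far as \<open>\<one>\<close>,
  and \<open>lox_displacement_finite\<close> applies.\<close>

lemma lox_centralizer_finite:
  assumes lox: "loxodromic c \<eta> w"
  shows "\<exists>X. finite X \<and> X \<subseteq> carrier F \<and>
    (\<forall>v\<in>carrier F. v \<otimes> w = w \<otimes> v \<longrightarrow> (\<exists>k::int. \<exists>x\<in>X. v = w [^] k \<otimes> x))"
proof -
  have w: "w \<in> carrier F" and c: "0 \<le> c" using lox by (simp_all add: loxodromic_def)
  define C where "C = 2 * (c + 3 * \<delta>) + 6 * \<delta> + 2 * c + D \<one> w"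
  have C: "0 < C" using c \<delta>_pos D_nonneg[of \<one> w] w by (simp add: C_def)
  obtain T :: nat where T: "finite {g \<in> carrier F. D \<one> g \<le> C \<and> (\<exists>e::int. D (g \<otimes> w [^] int T) (w [^] e) \<le> C)}"
    (is "finite ?X") using lox_displacement_finite[OF lox C] by blast
  have "\<exists>k::int. \<exists>x\<in>?X. v = w [^] k \<otimes> x" if v: "v \<in> carrier F" and e: "v \<otimes> w = w \<otimes> v" for v
  proof -
    obtain K :: nat where "gp v (w [^] (- int K)) (w [^] int K) \<le> c + 3 * \<delta>"
      using lox_centralizer_between[OF lox v e] by blast
    then obtain k :: int where k: "D v (w [^] k) \<le> C"
      using lox_near[OF lox v, of "- int K" "int K"] unfolding C_def by blast
    define x where "x = inv (w [^] k) \<otimes> v"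
    have x: "x \<in> carrier F" using v w by (simp add: x_def)
    have v_eq: "v = w [^] k \<otimes> x" using v w by (simp add: x_def)
    have D1: "D \<one> x \<le> C"
      using D_shift[of "w [^] k" \<one> v] k D_sym[of v "w [^] k"] v w by (simp add: x_def)
    have "w \<otimes> x = x \<otimes> w" unfolding x_def
    proof (rule commute_mult)
      show "w \<otimes> inv (w [^] k) = inv (w [^] k) \<otimes> w"
        by (intro commute_inv commute_int_pow) (use w in auto)
    qed (use v w e in auto)
    then have "x \<otimes> w [^] int T = w [^] int T \<otimes> x"
      by (intro commute_int_pow) (use x w in auto)
    then have "D (x \<otimes> w [^] int T) (w [^] int T) \<le> C"
      using D_shift1[of "w [^] int T" x] D_sym[of "w [^] int T" "w [^] int T \<otimes> x"] x w D1 by simp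
    then have "x \<in> ?X" using x D1 by blast
    then show ?thesis using v_eq by blast
  qed
  then show ?thesis using T by (intro exI[of _ ?X]) auto
qed

lemma lox_centralizer_power:
  assumes lox: "loxodromic c \<eta> w" and v: "v \<in> carrier F" and e: "v \<otimes> w = w \<otimes> v"
  shows "\<exists>(a::nat) (b::int). 0 < a \<and> v [^] a = w [^] b"
proof -
  have w: "w \<in> carrier F" using lox by (rule loxodromic_closed)
  obtain X where X: "finite X" "X \<subseteq> carrier F"
    and *: "\<And>v. \<lbrakk>v \<in> carrier F; v \<otimes> w = w \<otimes> v\<rbrakk> \<Longrightarrow> \<exists>k::int. \<exists>x\<in>X. v = w [^] k \<otimes> x"
    using lox_centralizer_finite[OF lox] by metis
  have "v [^] n \<otimes> w = w \<otimes> v [^] n" for n :: nat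
    using commute_nat_pow[of w v n] v w e by metis
  then have "\<exists>(k::int) x. x \<in> X \<and> v [^] n = w [^] k \<otimes> x" for n :: nat
    using *[of "v [^] n"] v by blast
  then obtain k x where kx: "\<And>n::nat. x n \<in> X \<and> v [^] n = w [^] (k n :: int) \<otimes> x n" by metis
  have "\<not> inj_on x UNIV"
  proof
    assume "inj_on x UNIV"
    moreover have "finite (range x)" using X kx by (meson finite_subset image_subsetI)
    ultimately show False using finite_imageD by blast
  qed
  then obtain m m' where "m \<noteq> m'" "x m = x m'" by (auto simp: inj_on_def)
  then obtain m n where mn: "m < n" "x m = x n" by (metis linorder_neqE_nat)
  have xn: "x n \<in> carrier F" using kx X by blast
  have "v [^] (n - m) \<otimes> v [^] m = v [^] n" using v mn by (simp add: nat_pow_mult)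
  then have "v [^] (n - m) = v [^] n \<otimes> inv (v [^] m)" using v by (metis inv_solve_right nat_pow_closed)
  also have "\<dots> = (w [^] k n \<otimes> x n) \<otimes> inv (w [^] k m \<otimes> x n)" using kx[of n] kx[of m] mn(2) by simp
  also have "\<dots> = w [^] k n \<otimes> inv (w [^] k m)"
    using xn w by (simp add: inv_mult_group m_assoc)
  also have "\<dots> = w [^] (k n - k m)" using w by (simp add: int_pow_diff)
  finally show ?thesis using mn by (intro exI[of _ "n - m"] exI[of _ "k n - k m"]) simp
qed

text \<open>Some positive power of \<open>t\<close> is a power \<open>w [^] b\<close>. It commutes
  with \<open>y\<close>, which for \<open>b \<noteq> 0\<close> would make \<open>y\<close> commute
  with \<open>w\<close>.\<close>

lemma lox_centralizer_torsion:
  assumes lox: "loxodromic c \<eta> w" and rc: "root_commuting F w" and t: "t \<in> carrier F"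
    and tw: "t \<otimes> w = w \<otimes> t" and y: "y \<in> carrier F" and ty: "t \<otimes> y = y \<otimes> t"
    and yw: "y \<otimes> w \<noteq> w \<otimes> y"
  shows "\<exists>a::nat. 0 < a \<and> t [^] a = \<one>"
proof -
  have w: "w \<in> carrier F" using lox by (rule loxodromic_closed)
  obtain a :: nat and b :: int where ab: "0 < a" "t [^] a = w [^] b"
    using lox_centralizer_power[OF lox t tw] by blast
  have "y \<otimes> t [^] a = t [^] a \<otimes> y" by (rule commute_nat_pow[OF y t ty[symmetric]])
  then have "y \<otimes> w [^] b = w [^] b \<otimes> y" using ab by simp
  then have "b = 0" using root_commutingD2[OF rc y w] yw by blast
  then show ?thesis using ab by auto
qed

text \<open>The forward axis of \<open>w\<close> and the \<open>inv u\<close>-translate of its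
  backward axis diverge. Otherwise \<open>p = inv u \<otimes> inv (w [^] L)\<close> would lie near
  the axis, and so would the end \<open>inv u\<close> of the segment of length \<open>L\<close>
  translated by \<open>p\<close>. Then \<open>lox_overlap_commute\<close> makes \<open>p\<close>
  commute with \<open>w\<close>, and with it \<open>inv u = p \<otimes> w [^] L\<close>.\<close>

lemma lox_gp_bounded:
  assumes lox: "loxodromic c \<eta> w" and rc: "root_commuting F w"
    and u: "u \<in> carrier F" and uw: "u \<otimes> w \<noteq> w \<otimes> u"
  shows "\<exists>B\<ge>0. \<forall>(m::nat) (j::nat). gp \<one> (inv u \<otimes> inv (w [^] m)) (w [^] j) \<le> B"
proof -
  have w: "w \<in> carrier F" and c: "0 \<le> c" using lox by (simp_all add: loxodromic_def)
  define C where "C = D \<one> u"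
  have C: "0 \<le> C" using D_nonneg u by (simp add: C_def)
  \<comment> \<open>The summands come from \<open>lox_between\<close>, from replacing
    \<open>inv u\<close> by \<open>\<one>\<close>, and from \<open>fellow_travel\<close>.\<close>
  define \<kappa> where "\<kappa> = c + 2 * \<delta> + C + \<delta>"
  define C' where "C' = 2 * \<kappa> + 6 * \<delta> + 2 * c + D \<one> w"
  have D1w: "0 \<le> D \<one> w" using D_nonneg w by simp
  have C': "0 < C'" using C c \<delta>_pos D1w by (simp add: C'_def \<kappa>_def)
  obtain L :: nat where L: "\<And>v i j. \<lbrakk>v \<in> carrier F; D v (w [^] (i::int)) \<le> C + C'; D (v \<otimes> w [^] int L) (w [^] (j::int)) \<le> C + C'\<rbrakk>
      \<Longrightarrow> v \<otimes> w = w \<otimes> v"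
    using lox_overlap_commute[OF lox rc, of "C + C'"] C C' by (metis add_nonneg_pos)
  \<comment> \<open>A bound on the length of \<open>inv u \<otimes> inv (w [^] m)\<close> for
    \<open>m \<le> L\<close>; a larger product therefore forces \<open>L < m\<close>.\<close>
  define B where "B = C + real L * D \<one> w"
  have D1: "D \<one> (inv u \<otimes> inv (w [^] m)) \<le> B" if "m \<le> L" for m :: nat
  proof -
    have "D \<one> (inv u \<otimes> inv (w [^] m)) \<le> C + D \<one> (w [^] m)"
      using D_mult_le[of "inv u" "inv (w [^] m)"] u w by (simp add: D_inv C_def)
    also have "\<dots> \<le> C + real m * D \<one> w" using D_pow_le[OF w] by simp
    also have "\<dots> \<le> B" using that D1w by (simp add: B_def mult_right_mono)
    finally show ?thesis .
  qed
  have "gp \<one> (inv u \<otimes> inv (w [^] m)) (w [^] j) \<le> B" for m j :: nat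
  proof (rule ccontr)
    define x where "x = inv u \<otimes> inv (w [^] m)"
    assume "\<not> gp \<one> (inv u \<otimes> inv (w [^] m)) (w [^] j) \<le> B"
    then have gt: "B < gp \<one> x (w [^] j)" by (simp add: x_def)
    have x: "x \<in> carrier F" using u w by (simp add: x_def)
    have "gp \<one> x (w [^] j) \<le> D \<one> x" using gp_le_dist x w by simp
    then have Lm: "L < m" using D1[of m] gt by (fastforce simp: x_def)
    define p where "p = inv u \<otimes> inv (w [^] L)"
    have p: "p \<in> carrier F" using u w by (simp add: p_def)
    have pow: "inv (w [^] n) = w [^] (- int n)" for n :: nat using w by (simp add: int_pow_neg_int)
    have "gp p (inv u \<otimes> \<one>) x = gp (inv (w [^] L)) \<one> (inv (w [^] m))"
      unfolding p_def x_def by (rule gp_left) (use u w in auto)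
    also have "\<dots> = gp (w [^] (- int L)) (w [^] (- int m)) (w [^] (0::int))"
      using gp_commute[of "w [^] (- int m)" \<one> "w [^] (- int L)"] w by (simp add: pow)
    also have "\<dots> \<le> c + 2 * \<delta>" by (rule lox_between[OF lox]) (use Lm in auto)
    finally have "gp p x (inv u) \<le> c + 2 * \<delta>" using gp_commute[of x "inv u" p] u x by simp
    then have "gp p x \<one> \<le> c + 2 * \<delta> + C"
      using gp_change[of p x "inv u" \<one>] D_sym[of "inv u" \<one>] u x p by (simp add: D_inv C_def)
    then have "gp p \<one> x \<le> c + 2 * \<delta> + C" using gp_commute[of x \<one> p] x by simp
    then have "gp p \<one> (w [^] j) \<le> \<kappa>" unfolding \<kappa>_def
      by (rule fellow_travel[rotated 4]) (use D1[of L] gt p x w in \<open>auto simp: p_def\<close>)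
    then have "gp p (w [^] (0::int)) (w [^] int j) \<le> \<kappa>" by (simp add: int_pow_int)
    then obtain k :: int where "D p (w [^] k) \<le> C'"
      using lox_near[OF lox p] unfolding C'_def by blast
    moreover have pw: "p \<otimes> w [^] int L = inv u" using u w by (simp add: p_def int_pow_int m_assoc)
    have "D (p \<otimes> w [^] int L) (w [^] (0::int)) = C"
      using D_sym[of "inv u" \<one>] u unfolding pw by (simp add: D_inv C_def)
    ultimately have "p \<otimes> w = w \<otimes> p" using L[of p k 0] C C' p by simp
    then have "w \<otimes> (p \<otimes> w [^] int L) = (p \<otimes> w [^] int L) \<otimes> w"
      by (intro commute_mult commute_int_pow) (use p w in auto)
    then have "w \<otimes> u = u \<otimes> w" unfolding pw using commute_inv_iff[of w u] u w by simp
    then show False using uw by simp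
  qed
  moreover have "0 \<le> B" using C D1w by (simp add: B_def)
  ultimately show ?thesis by blast
qed

end

section \<open>Elements that generate their own centralizer\<close>

context hyperbolic_group
begin

text \<open>The axis of \<open>h = w\<^sup>n u\<close> follows the axis of \<open>w\<close> for time \<open>n\<close>. If \<open>v\<close> commutes with \<open>h\<close> and moves
  the base point to a point of this segment that is far from its end, then the \<open>v\<close>-translate of
  the segment overlaps with the segment itself.\<close>

lemma lox_axis_shift_commute:
  assumes lox: "loxodromic c \<eta> w" and rc: "root_commuting F w"
    and u: "u \<in> carrier F" and uw: "u \<otimes> w \<noteq> w \<otimes> u" and C3: "0 \<le> C3"
  shows "\<exists>M::nat. \<forall>(n::nat) (i::nat). \<forall>v\<in>carrier F. i + M \<le> n \<longrightarrow>
    v \<otimes> (w [^] n \<otimes> u) = (w [^] n \<otimes> u) \<otimes> v \<longrightarrow> D v (w [^] i) \<le> C3 \<longrightarrow> v \<otimes> w = w \<otimes> v"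
proof -
  have w: "w \<in> carrier F" and c: "0 \<le> c" and \<eta>: "0 < \<eta>" using lox by (simp_all add: loxodromic_def)
  define C where "C = D \<one> u"
  have C: "0 \<le> C" using D_nonneg u by (simp add: C_def)
  have D1w: "0 \<le> D \<one> w" using D_nonneg w by simp
  obtain B where B: "0 \<le> B" "\<And>m j::nat. gp \<one> (inv u \<otimes> inv (w [^] (m::nat))) (w [^] j) \<le> B"
    using lox_gp_bounded[OF lox rc u uw] by blast
  define \<kappa> where "\<kappa> = c + 2 * \<delta> + C3 + (C + C3)"
  define C4 where "C4 = 2 * (\<kappa> + \<delta>) + 6 * \<delta> + 2 * c + D \<one> w"
  have C4: "0 < C4" using C C3 c \<delta>_pos D1w by (simp add: C4_def \<kappa>_def)
  obtain L :: nat where L: "\<And>v i j. \<lbrakk>v \<in> carrier F; D v (w [^] (i::int)) \<le> C3 + C4; D (v \<otimes> w [^] int L) (w [^] (j::int)) \<le> C3 + C4\<rbrakk>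
      \<Longrightarrow> v \<otimes> w = w \<otimes> v"
    using lox_overlap_commute[OF lox rc, of "C3 + C4"] C3 C4 by (metis add_nonneg_pos)
  \<comment> \<open>At the far end \<open>w [^] n\<close> the ways may stay together over a length
    \<open>B + C\<close>, and \<open>p\<close> is at most \<open>C3 + real L * D \<one> w\<close>
    away from \<open>w [^] i\<close>; the segment from \<open>w [^] i\<close> to
    \<open>w [^] n\<close> has to be longer than both together.\<close>
  obtain M0 :: nat where M0: "B + C + C3 + real L * D \<one> w < \<eta> * real M0"
    using reals_Archimedean3[OF \<eta>] by (metis mult.commute)
  have *: "v \<otimes> w = w \<otimes> v" if v: "v \<in> carrier F" and i: "i + (M0 + L) \<le> n"
    and e: "v \<otimes> (w [^] n \<otimes> u) = (w [^] n \<otimes> u) \<otimes> v" and Dv: "D v (w [^] i) \<le> C3" for n i :: nat and v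
  proof -
    define h where "h = w [^] n \<otimes> u"
    have h: "h \<in> carrier F" using w u by (simp add: h_def)
    have eh: "v \<otimes> h = h \<otimes> v" using e by (simp add: h_def)
    have wn: "w [^] n = h \<otimes> inv u" using w u by (simp add: h_def m_assoc)
    define p where "p = v \<otimes> w [^] L"
    have p: "p \<in> carrier F" using v w by (simp add: p_def)
    \<comment> \<open>As \<open>v\<close> commutes with \<open>h\<close>, it carries
      \<open>w [^] n = h \<otimes> inv u\<close> to a point near \<open>h \<otimes> v\<close>, hence
      near \<open>y\<close>. So the translated segment runs from near \<open>w [^] i\<close> to near
      \<open>y\<close>.\<close>
    define y where "y = h \<otimes> w [^] i"
    have y: "y \<in> carrier F" using h w by (simp add: y_def)
    have "v \<otimes> w [^] n = (h \<otimes> v) \<otimes> inv u" unfolding wn using v h u by (simp add: m_assoc[symmetric] eh)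
    then have "D (v \<otimes> w [^] n) (h \<otimes> v) = C"
      using D_shift1[of "h \<otimes> v" "inv u"] D_sym[of "h \<otimes> v" "(h \<otimes> v) \<otimes> inv u"] h v u by (simp add: D_inv C_def)
    moreover have "D (h \<otimes> v) y \<le> C3" unfolding y_def using D_left[of h v "w [^] i"] h v w Dv by simp
    ultimately have vy: "D (v \<otimes> w [^] n) y \<le> C + C3"
      using D_tri[of "v \<otimes> w [^] n" "h \<otimes> v" y] h v w y by simp
    have "gp p (v \<otimes> \<one>) (v \<otimes> w [^] n) = gp (w [^] L) \<one> (w [^] n)"
      unfolding p_def by (rule gp_left) (use v w in auto)
    also have "\<dots> = gp (w [^] int L) (w [^] (0::int)) (w [^] int n)" by (simp add: int_pow_int)
    also have "\<dots> \<le> c + 2 * \<delta>" by (rule lox_between[OF lox]) (use i in auto)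
    finally have "gp p (w [^] i) y \<le> \<kappa>"
      using gp_change2[of p v "v \<otimes> w [^] n" "w [^] i" y] vy Dv p v w y by (simp add: \<kappa>_def)
    \<comment> \<open>The ways from \<open>w [^] i\<close> to \<open>y\<close> and to
      \<open>w [^] n\<close> part only close to \<open>w [^] n\<close>, because
      \<open>lox_gp_bounded\<close> controls the product there; \<open>p\<close> comes well before
      that place, as \<open>fellow_travel\<close> requires.\<close>
    moreover have "D (w [^] i) p \<le> gp (w [^] i) y (w [^] n)"
    proof -
      have "D (w [^] i) p \<le> D (w [^] i) v + D v p" by (rule D_tri) (use v w p in auto)
      also have "D v p = D \<one> (w [^] L)" unfolding p_def using D_shift1 v w by simp
      finally have 1: "D (w [^] i) p \<le> C3 + real L * D \<one> w"
        using Dv D_sym[of v "w [^] i"] D_pow_le[OF w, of L] v w by simp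
      have wni: "w [^] n = w [^] i \<otimes> w [^] (n - i)" using w i by (simp add: nat_pow_mult)
      have inv_ni: "inv (w [^] n) \<otimes> w [^] i = inv (w [^] (n - i))"
      proof -
        have "inv (w [^] n) = inv (w [^] (n - i)) \<otimes> inv (w [^] i)" using w wni by (simp add: inv_mult_group)
        then show ?thesis using w by (simp add: m_assoc)
      qed
      have "gp (w [^] n) (w [^] i) y = gp (w [^] n \<otimes> \<one>) (w [^] n \<otimes> inv (w [^] (n - i))) (w [^] n \<otimes> (u \<otimes> w [^] i))"
        using w u by (simp add: y_def h_def m_assoc inv_ni[symmetric])
      also have "\<dots> = gp \<one> (inv (w [^] (n - i))) (u \<otimes> w [^] i)"
        by (rule gp_left) (use w u in auto)
      also have "\<dots> = gp (u \<otimes> inv u) (u \<otimes> (inv u \<otimes> inv (w [^] (n - i)))) (u \<otimes> w [^] i)"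
        using w u by simp
      also have "\<dots> = gp (inv u) (inv u \<otimes> inv (w [^] (n - i))) (w [^] i)"
        by (rule gp_left) (use w u in auto)
      also have "\<dots> \<le> gp \<one> (inv u \<otimes> inv (w [^] (n - i))) (w [^] i) + D \<one> (inv u)"
        by (rule gp_change_base) (use w u in auto)
      also have "\<dots> \<le> B + C" using B(2)[of "n - i" i] u by (simp add: D_inv C_def)
      finally have 2: "gp (w [^] n) (w [^] i) y \<le> B + C" .
      have "D (w [^] i) (w [^] n) = D \<one> (w [^] int (n - i))" unfolding wni
        using D_shift1[of "w [^] i" "w [^] (n - i)"] w by (simp add: int_pow_int)
      then have "\<eta> * real (n - i) \<le> D (w [^] i) (w [^] n)"
        using lox_growth[OF lox, of "int (n - i)"] by simp
      moreover have "\<eta> * real M0 \<le> \<eta> * real (n - i)" using i \<eta> by (intro mult_left_mono) auto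
      ultimately have "\<eta> * real M0 \<le> D (w [^] i) (w [^] n)" by linarith
      moreover have "gp (w [^] i) (w [^] n) y + gp (w [^] n) (w [^] i) y = D (w [^] i) (w [^] n)"
        by (rule gp_add) (use w y in auto)
      moreover have "gp (w [^] i) (w [^] n) y = gp (w [^] i) y (w [^] n)"
        by (rule gp_commute) (use w y in auto)
      ultimately show ?thesis using 1 2 M0 by linarith
    qed
    ultimately have "gp p (w [^] i) (w [^] n) \<le> \<kappa> + \<delta>"
      using fellow_travel[of "w [^] i" p y "w [^] n" \<kappa>] w p y by simp
    then have "gp p (w [^] int i) (w [^] int n) \<le> \<kappa> + \<delta>" by (simp add: int_pow_int)
    then obtain j :: int where "D p (w [^] j) \<le> C4" using lox_near[OF lox p] unfolding C4_def by blast
    then have "D (v \<otimes> w [^] int L) (w [^] j) \<le> C3 + C4" using C3 by (simp add: p_def int_pow_int)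
    moreover have "D v (w [^] int i) \<le> C3 + C4" using Dv C4 by (simp add: int_pow_int)
    ultimately show ?thesis by (rule L[OF v, rotated])
  qed
  show ?thesis
    by (intro exI[of _ "M0 + L"] allI ballI impI) (rule *, assumption+)
qed

text \<open>For large \<open>n\<close> the element \<open>h = w [^] n \<otimes> u\<close> is
  loxodromic, and whatever commutes with it lies near its axis. Division by a power of
  \<open>h\<close> leaves an element \<open>v'\<close> near some \<open>w [^] i\<close> with
  \<open>i \<le> n\<close>. Away from the end, \<open>lox_axis_shift_commute\<close> makes
  \<open>v'\<close> commute with \<open>w\<close>, so it is torsion and trivial; near the end the
  same argument on the reversed axis gives \<open>v' = h\<close>.\<close>

lemma lox_translate_centralizer:
  assumes lox: "loxodromic c \<eta> w" and rc: "root_commuting F w"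
    and u: "u \<in> carrier F" and uw: "u \<otimes> w \<noteq> w \<otimes> u"
    and tf: "\<And>t a. \<lbrakk>t \<in> carrier F; 0 < a; t [^] (a::nat) = \<one>\<rbrakk> \<Longrightarrow> t = \<one>"
  shows "\<exists>n::nat. \<forall>v\<in>carrier F. v \<otimes> (w [^] n \<otimes> u) = (w [^] n \<otimes> u) \<otimes> v \<longrightarrow>
    (\<exists>k::int. v = (w [^] n \<otimes> u) [^] k)"
proof -
  have w: "w \<in> carrier F" and c: "0 \<le> c" and \<eta>: "0 < \<eta>" using lox by (simp_all add: loxodromic_def)
  define C where "C = D \<one> u"
  have C: "0 \<le> C" using D_nonneg u by (simp add: C_def)
  have D1w: "0 \<le> D \<one> w" using D_nonneg w by simp
  obtain B where B: "0 \<le> B" "\<And>m j::nat. gp \<one> (inv u \<otimes> inv (w [^] (m::nat))) (w [^] j) \<le> B"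
    using lox_gp_bounded[OF lox rc u uw] by blast
  define b where "b = B + C"
  \<comment> \<open>With \<open>b\<close> as corner bound for \<open>h\<close>, this is
    \<open>chain_locate\<close> applied to the bound of \<open>lox_centralizer_between\<close>.
    \<open>C3\<close> is the bound of \<open>lox_near\<close>, where \<open>C\<close> pays for
    replacing \<open>h\<close> by \<open>w [^] n\<close>.\<close>
  define \<kappa> where "\<kappa> = 2 * (b + 3 * \<delta>) + 2 * \<delta> + 2 * (b + 2 * \<delta>)"
  define C3 where "C3 = 2 * (\<kappa> + C) + 6 * \<delta> + 2 * c + D \<one> w"
  have C3: "0 \<le> C3" using B C c D1w \<delta>_pos by (simp add: C3_def \<kappa>_def b_def)
  obtain M1 :: nat where M1: "\<And>(n::nat) (i::nat) v. \<lbrakk>v \<in> carrier F; i + M1 \<le> n;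
      v \<otimes> (w [^] n \<otimes> u) = (w [^] n \<otimes> u) \<otimes> v; D v (w [^] i) \<le> C3\<rbrakk> \<Longrightarrow> v \<otimes> w = w \<otimes> v"
    using lox_axis_shift_commute[OF lox rc u uw C3] by blast
  have iu: "inv u \<in> carrier F" and iw: "inv w \<in> carrier F" using u w by auto
  have iuw: "inv u \<otimes> inv w \<noteq> inv w \<otimes> inv u" using uw u w by (metis inv_inv inv_mult_group iu iw)
  have lox': "loxodromic c \<eta> (inv w)" and rc': "root_commuting F (inv w)"
    using loxodromic_inv[OF lox] root_commuting_inv[OF rc w] by auto
  have "0 \<le> C3 + C" using C3 C by simp
  then obtain M2 :: nat where M2: "\<And>(n::nat) (i::nat) v. \<lbrakk>v \<in> carrier F; i + M2 \<le> n;
      v \<otimes> (inv w [^] n \<otimes> inv u) = (inv w [^] n \<otimes> inv u) \<otimes> v; D v (inv w [^] i) \<le> C3 + C\<rbrakk> \<Longrightarrow>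
      v \<otimes> inv w = inv w \<otimes> v"
    using lox_axis_shift_commute[OF lox' rc' iu iuw] by blast
  obtain M0 :: nat where M0: "2 * b + 4 * \<delta> + 1 + C < \<eta> * real M0"
    using reals_Archimedean3[OF \<eta>] by (metis mult.commute)
  \<comment> \<open>\<open>M0\<close> makes \<open>h\<close> loxodromic; with \<open>M1\<close> and
    \<open>M2\<close> every \<open>i \<le> n\<close> is far enough from one of the two ends.\<close>
  define n where "n = M0 + M1 + M2"
  define h where "h = w [^] n \<otimes> u"
  have h: "h \<in> carrier F" using w u by (simp add: h_def)
  have ih: "inv h = inv u \<otimes> inv (w [^] n)" using w u by (simp add: h_def inv_mult_group)
  have Dwh: "D (w [^] n) h = C" unfolding h_def C_def by (rule D_shift1) (use w u in auto)
  have hlox: "loxodromic b 1 h"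
  proof -
    have "gp \<one> (inv h) h \<le> gp \<one> (inv h) (w [^] n) + D (w [^] n) h"
      by (rule gp_change) (use h w in auto)
    also have "\<dots> \<le> b" using B(2)[of n n] Dwh by (simp add: ih b_def)
    finally have 1: "gp \<one> (inv h) h \<le> b" .
    have "\<eta> * real M0 \<le> \<eta> * real n" using \<eta> by (intro mult_left_mono) (auto simp: n_def)
    also have "\<dots> \<le> D \<one> (w [^] n)" using lox_growth[OF lox, of "int n"] by (simp add: int_pow_int)
    also have "\<dots> \<le> D \<one> h + D h (w [^] n)" by (rule D_tri) (use h w in auto)
    finally have "2 * b + 4 * \<delta> + 1 \<le> D \<one> h" using M0 Dwh D_sym[of h "w [^] n"] h w by simp
    with 1 show ?thesis using h B C by (simp add: loxodromic_def b_def)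
  qed
  have hw: "h \<otimes> w \<noteq> w \<otimes> h"
  proof
    assume "h \<otimes> w = w \<otimes> h"
    then have "w \<otimes> (inv (w [^] n) \<otimes> h) = (inv (w [^] n) \<otimes> h) \<otimes> w"
      by (intro commute_mult commute_inv commute_nat_pow) (use w h in auto)
    then show False using uw w u by (simp add: h_def)
  qed
  have *: "\<exists>k::int. v = h [^] k" if v: "v \<in> carrier F" and vh: "v \<otimes> h = h \<otimes> v" for v
  proof -
    obtain K :: nat where K: "0 < K" "gp v (h [^] (- int K)) (h [^] int K) \<le> b + 3 * \<delta>"
      using lox_centralizer_between[OF hlox v vh] by blast
    have "\<exists>m<2 * K. gp v (h [^] (- int K + int m)) (h [^] (- int K + int (Suc m))) \<le> \<kappa>"
      unfolding \<kappa>_def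
    proof (rule chain_locate[where x = "\<lambda>m. h [^] (- int K + int m)"])
      fix i j k :: nat
      assume "i \<le> j" "j \<le> k"
      then show "gp (h [^] (- int K + int j)) (h [^] (- int K + int i)) (h [^] (- int K + int k)) \<le> b + 2 * \<delta>"
        by (intro lox_between[OF hlox]) auto
    qed (use K h v in auto)
    then obtain m where m: "gp v (h [^] (- int K + int m)) (h [^] (- int K + int (Suc m))) \<le> \<kappa>" by blast
    define k where "k = - int K + int m"
    have k1: "- int K + int (Suc m) = k + 1" by (simp add: k_def)
    have k: "gp v (h [^] k) (h [^] (k + 1)) \<le> \<kappa>" using m by (simp only: k1 k_def[symmetric])
    define v' where "v' = inv (h [^] k) \<otimes> v"
    have v': "v' \<in> carrier F" using v h by (simp add: v'_def)
    have v_eq: "v = h [^] k \<otimes> v'" using v h by (simp add: v'_def)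
    have v'h: "v' \<otimes> h = h \<otimes> v'" unfolding v'_def
      by (rule commute_mult[symmetric, OF h])
         (use v h vh in \<open>auto intro!: commute_inv commute_int_pow\<close>)
    have "gp v' \<one> h = gp (h [^] k \<otimes> v') (h [^] k \<otimes> \<one>) (h [^] k \<otimes> h)"
      by (rule gp_left[symmetric]) (use v' h in auto)
    also have "h [^] k \<otimes> h = h [^] (k + 1)" using h by (simp add: int_pow_mult)
    finally have "gp v' \<one> h \<le> \<kappa>" using k h by (simp add: v_eq[symmetric])
    then have "gp v' (w [^] (0::int)) (w [^] int n) \<le> \<kappa> + C"
      using gp_change[of v' \<one> h "w [^] n"] D_sym[of h "w [^] n"] Dwh v' h w by (simp add: int_pow_int)
    then obtain j :: int where j: "0 \<le> j" "j \<le> int n" "D v' (w [^] j) \<le> C3"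
      using lox_near[OF lox v', of 0 "int n" "\<kappa> + C"] unfolding C3_def by auto
    define i where "i = nat j"
    have i: "i \<le> n" "D v' (w [^] i) \<le> C3" using j by (auto simp: i_def pow_nat)
    show ?thesis
    proof (cases "i + M1 \<le> n")
      case True
      then have "v' \<otimes> w = w \<otimes> v'" using M1[OF v' True _ i(2)] v'h by (simp add: h_def)
      then obtain a :: nat where "0 < a" "v' [^] a = \<one>"
        using lox_centralizer_torsion[OF lox rc v' _ h v'h hw] by blast
      then have "v' = \<one>" using tf v' by blast
      then show ?thesis using v_eq h by auto
    next
      case False
      \<comment> \<open>Conjugation by \<open>u\<close> turns \<open>inv h\<close> into
        \<open>H\<close>, a word of the same shape in \<open>inv w\<close> and \<open>inv u\<close>.
        Position \<open>i\<close> becomes \<open>n - i\<close> seen from the other end, and the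
        additional \<open>C\<close> in \<open>M2\<close> pays for the step from
        \<open>V \<otimes> u\<close> to \<open>V\<close>.\<close>
      define V where "V = u \<otimes> (inv h \<otimes> v') \<otimes> inv u"
      define H where "H = inv w [^] n \<otimes> inv u"
      have V: "V \<in> carrier F" and H: "H \<in> carrier F" using u h v' w by (simp_all add: V_def H_def)
      have H_eq: "H = u \<otimes> inv h \<otimes> inv u" using w u by (simp add: H_def ih m_assoc nat_pow_inv)
      have v'ih: "v' \<otimes> inv h = inv h \<otimes> v'" using v' h v'h by (rule commute_inv)
      have VH: "V \<otimes> H = H \<otimes> V"
      proof -
        have "V \<otimes> H = u \<otimes> (inv h \<otimes> (v' \<otimes> inv h)) \<otimes> inv u"
          unfolding V_def H_eq using u h v' by (simp add: m_assoc)
        also have "\<dots> = H \<otimes> V" unfolding v'ih V_def H_eq using u h v' by (simp add: m_assoc)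
        finally show ?thesis .
      qed
      have ni: "(n - i) + M2 \<le> n" using False by (simp add: n_def)
      have "inv w [^] (n - i) = inv (w [^] n) \<otimes> w [^] i"
      proof -
        have "w [^] n = w [^] i \<otimes> w [^] (n - i)" using w i by (simp add: nat_pow_mult)
        then have "inv (w [^] n) \<otimes> w [^] i = inv (w [^] (n - i)) \<otimes> inv (w [^] i) \<otimes> w [^] i"
          using w by (simp add: inv_mult_group)
        then show ?thesis using w by (simp add: m_assoc nat_pow_inv)
      qed
      also have "\<dots> = u \<otimes> (inv h \<otimes> w [^] i)" using w u by (simp add: ih m_assoc)
      finally have pw: "inv w [^] (n - i) = u \<otimes> (inv h \<otimes> w [^] i)" .
      have "V \<otimes> u = u \<otimes> (inv h \<otimes> v')" using u h v' by (simp add: V_def m_assoc)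
      then have "D (V \<otimes> u) (inv w [^] (n - i)) = D v' (w [^] i)"
        unfolding pw using u h v' w by (simp add: D_left)
      moreover have "D V (V \<otimes> u) = C" using D_shift1 V u by (simp add: C_def)
      ultimately have "D V (inv w [^] (n - i)) \<le> C3 + C"
        using D_tri[of V "V \<otimes> u" "inv w [^] (n - i)"] i V u w by simp
      then have "V \<otimes> inv w = inv w \<otimes> V" using M2[OF V ni] VH unfolding H_def by blast
      moreover have "H \<otimes> inv w \<noteq> inv w \<otimes> H"
      proof
        assume e: "H \<otimes> inv w = inv w \<otimes> H"
        have W: "inv w [^] n \<in> carrier F" using iw by (rule nat_pow_closed)
        have "inv w \<otimes> inv (inv w [^] n) = inv (inv w [^] n) \<otimes> inv w"
          by (rule commute_inv[OF iw W commute_nat_pow[OF iw iw refl]])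
        then have "inv w \<otimes> (inv (inv w [^] n) \<otimes> H) = (inv (inv w [^] n) \<otimes> H) \<otimes> inv w"
          by (rule commute_mult[OF iw inv_closed[OF W] H _ e[symmetric]])
        moreover have "inv (inv w [^] n) \<otimes> H = inv u" unfolding H_def by (rule inv_mult_cancel[OF W iu])
        ultimately show False using iuw by simp
      qed
      ultimately obtain a :: nat where "0 < a" "V [^] a = \<one>"
        using lox_centralizer_torsion[OF lox' rc' V _ H VH] by blast
      then have "V = \<one>" using tf V by blast
      then have "inv u \<otimes> (V \<otimes> u) = \<one>" using u by simp
      then have "inv h \<otimes> v' = \<one>" using u h v' by (simp add: V_def m_assoc)
      then have "v' = h" using h v' by (metis inv_mult_cancel mult_inv_cancel r_one)
      then have "v = h [^] (k + 1)" using v_eq h by (simp add: int_pow_mult)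
      then show ?thesis by blast
    qed
  qed
  show ?thesis
    by (intro exI[of _ n] ballI impI) (rule *[unfolded h_def], assumption+)
qed

end

section \<open>Centralizers and cosets of a normal subgroup that contains a loxodromic
  element\<close>

context hyperbolic_group
begin

lemma elementary_if_lox_central:
  assumes lox: "loxodromic c \<eta> w" and cen: "\<And>f. f \<in> carrier F \<Longrightarrow> f \<otimes> w = w \<otimes> f"
  shows "elementary_group F"
proof -
  have w: "w \<in> carrier F" using lox by (rule loxodromic_closed)
  obtain X where X: "finite X" "X \<subseteq> carrier F"
    "\<And>v. v \<in> carrier F \<Longrightarrow> \<exists>k::int. \<exists>x\<in>X. v = w [^] k \<otimes> x"
    using lox_centralizer_finite[OF lox] cen by metis
  define H where "H = generate F {w}"
  have H: "subgroup H F" unfolding H_def by (rule generate_is_subgroup) (use w in auto)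
  have H_eq: "H = range (\<lambda>k::int. w [^] k)" unfolding H_def using generate_pow[OF w] by auto
  have wH: "w \<in> H" unfolding H_def by (rule generate.incl) simp
  have gH: "group (F\<lparr>carrier := H\<rparr>)" using H by (rule subgroup_imp_group)
  have cH: "carrier (F\<lparr>carrier := H\<rparr>) = H" by simp
  have "H = range (\<lambda>k::int. w [^]\<^bsub>F\<lparr>carrier := H\<rparr>\<^esub> k)"
    unfolding int_pow_consistent[OF H wH, symmetric] by (rule H_eq)
  then have cyc: "cyclic_group (F\<lparr>carrier := H\<rparr>)"
    unfolding group.cyclic_group[OF gH] cH using wH by blast
  have "rcosets H \<subseteq> (\<lambda>x. H #> x) ` X"
  proof
    fix Y assume "Y \<in> rcosets H"
    then obtain v where v: "v \<in> carrier F" "Y = H #> v" by (auto simp: RCOSETS_def)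
    obtain k :: int and x where kx: "x \<in> X" "v = w [^] k \<otimes> x" using X(3)[OF v(1)] by blast
    have "w [^] k \<in> H" using H_eq by blast
    then have "v \<in> H #> x" using kx by (auto simp: r_coset_def)
    then have "H #> x = H #> v" using repr_independence[OF _ _ H] kx X(2) by blast
    then show "Y \<in> (\<lambda>x. H #> x) ` X" using v kx by blast
  qed
  then have "finite (rcosets H)" using X(1) finite_surj by blast
  then show ?thesis using H cyc by (auto simp: elementary_group_def)
qed

text \<open>Otherwise each conjugate of \<open>w\<close> lies in \<open>N\<close> and commutes with
  \<open>w\<close>, so it shares a nontrivial power with it. By
  \<open>lox_intertwine_commute\<close> all of \<open>F\<close> then commutes with \<open>w\<close>,
  and \<open>lox_centralizer_finite\<close> gives the subgroup generated by \<open>w\<close> finite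
  index.\<close>

lemma lox_not_central:
  assumes ne: "\<not> elementary_group F" and N: "N \<lhd> F" and rc: "root_commuting F w"
    and lox: "loxodromic c \<eta> w" and wN: "w \<in> N"
  shows "\<exists>n\<in>N. n \<otimes> w \<noteq> w \<otimes> n"
proof (rule ccontr)
  assume "\<not> ?thesis"
  then have cen: "\<And>n. n \<in> N \<Longrightarrow> n \<otimes> w = w \<otimes> n" by blast
  have w: "w \<in> carrier F" using lox by (rule loxodromic_closed)
  have "f \<otimes> w = w \<otimes> f" if f: "f \<in> carrier F" for f
  proof -
    define x where "x = f \<otimes> w \<otimes> inv f"
    have x: "x \<in> carrier F" using f w by (simp add: x_def)
    have "x \<in> N" using N f wN by (simp add: normal_inv_iff x_def)
    then have "x \<otimes> w = w \<otimes> x" by (rule cen)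
    then obtain a :: nat and b :: int where ab: "0 < a" "x [^] a = w [^] b"
      using lox_centralizer_power[OF lox x] by blast
    have "f \<otimes> w = x \<otimes> f" using f w by (simp add: x_def m_assoc)
    then have "f \<otimes> w [^] a = x [^] a \<otimes> f" by (rule intertwine_pow[OF f w x])
    then have "f \<otimes> w [^] int a = w [^] b \<otimes> f" using ab by (simp add: int_pow_int)
    then show ?thesis by (rule lox_intertwine_commute[OF lox rc f]) (use ab in simp)
  qed
  then show False using elementary_if_lox_central[OF lox] ne by blast
qed

text \<open>The centralizer of \<open>N\<close> is normal. If it were infinite, two of its elements
  would lie in one coset of the powers of \<open>w\<close>, so a nontrivial power of
  \<open>w\<close>, and then \<open>w\<close> itself, would commute with all of \<open>N\<close>.
  Thus it is finite, hence trivial.\<close>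

lemma centralizer_trivial:
  assumes ne: "\<not> elementary_group F" and nf: "no_nontrivial_finite_normal_subgroups F"
    and N: "N \<lhd> F" and rc: "\<And>n. n \<in> N \<Longrightarrow> root_commuting F n"
    and lox: "loxodromic c \<eta> w" and wN: "w \<in> N"
    and z: "z \<in> carrier F" "\<And>n. n \<in> N \<Longrightarrow> z \<otimes> n = n \<otimes> z"
  shows "z = \<one>"
proof -
  have w: "w \<in> carrier F" using lox by (rule loxodromic_closed)
  have sN: "N \<subseteq> carrier F" using N by (simp add: normal_imp_subgroup subgroup.subset)
  define Z where "Z = {z \<in> carrier F. \<forall>n\<in>N. z \<otimes> n = n \<otimes> z}"
  have sZ: "subgroup Z F"
  proof (rule subgroupI)
    have "\<one> \<in> Z" using sN by (auto simp: Z_def)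
    then show "Z \<noteq> {}" by blast
  next
    fix a assume "a \<in> Z"
    then show "inv a \<in> Z" using sN commute_inv[of _ a] by (fastforce simp: Z_def)
  next
    fix a b assume "a \<in> Z" "b \<in> Z"
    then show "a \<otimes> b \<in> Z" using sN commute_mult[of _ a b] by (fastforce simp: Z_def)
  qed (use sN in \<open>auto simp: Z_def\<close>)
  have nZ: "Z \<lhd> F"
  proof (rule normal_invI[OF sZ])
    fix f z assume f: "f \<in> carrier F" and "z \<in> Z"
    then have z: "z \<in> carrier F" "\<And>n. n \<in> N \<Longrightarrow> z \<otimes> n = n \<otimes> z" by (auto simp: Z_def)
    have "(f \<otimes> z \<otimes> inv f) \<otimes> n = n \<otimes> (f \<otimes> z \<otimes> inv f)" if n: "n \<in> N" for n
    proof -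
      have nc: "n \<in> carrier F" using n sN by blast
      define n' where "n' = inv f \<otimes> n \<otimes> f"
      have n'c: "n' \<in> carrier F" using nc f by (simp add: n'_def)
      have "inv f \<otimes> n \<otimes> inv (inv f) \<in> N" using N f n normal_inv_iff inv_closed by blast
      then have "z \<otimes> n' = n' \<otimes> z" using z f by (simp add: n'_def)
      moreover have "(f \<otimes> z \<otimes> inv f) \<otimes> n = f \<otimes> (z \<otimes> n') \<otimes> inv f"
        using f z nc by (simp add: n'_def m_assoc)
      moreover have "n \<otimes> (f \<otimes> z \<otimes> inv f) = f \<otimes> (n' \<otimes> z) \<otimes> inv f"
        using f z nc by (simp add: n'_def m_assoc)
      ultimately show ?thesis by simp
    qed
    then show "f \<otimes> z \<otimes> inv f \<in> Z" using f z by (simp add: Z_def)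
  qed
  have "finite Z"
  proof (rule ccontr)
    assume inf: "infinite Z"
    obtain X where X: "finite X" "X \<subseteq> carrier F"
      "\<And>v. \<lbrakk>v \<in> carrier F; v \<otimes> w = w \<otimes> v\<rbrakk> \<Longrightarrow> \<exists>k::int. \<exists>x\<in>X. v = w [^] k \<otimes> x"
      using lox_centralizer_finite[OF lox] by metis
    have "\<exists>x k. x \<in> X \<and> v = w [^] (k::int) \<otimes> x" if "v \<in> Z" for v
      using X(3)[of v] that wN by (auto simp: Z_def)
    then obtain x k where xk: "\<And>v. v \<in> Z \<Longrightarrow> x v \<in> X \<and> v = w [^] (k v :: int) \<otimes> x v" by metis
    have "\<not> inj_on x Z"
    proof
      assume "inj_on x Z"
      moreover have "finite (x ` Z)" using X(1) xk by (meson finite_subset image_subsetI)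
      ultimately show False using inf finite_imageD by blast
    qed
    then obtain z1 z2 where z12: "z1 \<in> Z" "z2 \<in> Z" "z1 \<noteq> z2" "x z1 = x z2" by (auto simp: inj_on_def)
    have xc: "x z2 \<in> carrier F" using xk z12 X(2) by blast
    have "z1 \<otimes> inv z2 = (w [^] k z1 \<otimes> x z2) \<otimes> inv (w [^] k z2 \<otimes> x z2)"
      using xk[OF z12(1)] xk[OF z12(2)] z12(4) by simp
    also have "\<dots> = w [^] (k z1 - k z2)" using xc w by (simp add: inv_mult_group m_assoc int_pow_diff)
    finally have wZ: "w [^] (k z1 - k z2) \<in> Z"
      using z12 sZ by (metis subgroup.m_closed subgroup.m_inv_closed)
    have "k z1 \<noteq> k z2" using z12 xk by metis
    then have "n \<otimes> w = w \<otimes> n" if "n \<in> N" for n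
      using root_commutingD2[OF rc[OF wN] _ w, of n "k z1 - k z2"] that sN wZ by (auto simp: Z_def)
    then show False using lox_not_central[OF ne N rc[OF wN] lox wN] by blast
  qed
  then have "Z = {\<one>}" using nZ nf by (simp add: no_nontrivial_finite_normal_subgroups_def)
  then show ?thesis using z by (auto simp: Z_def)
qed

lemma cyclic_centralizer_in_coset:
  assumes ne: "\<not> elementary_group F" and nf: "no_nontrivial_finite_normal_subgroups F"
    and N: "N \<lhd> F" and rc: "\<And>n. n \<in> N \<Longrightarrow> root_commuting F n"
    and lox: "loxodromic c \<eta> w" and wN: "w \<in> N" and x: "x \<in> carrier F"
  shows "\<exists>n\<in>N. \<forall>v\<in>carrier F. v \<otimes> (n \<otimes> x) = (n \<otimes> x) \<otimes> v \<longrightarrow> (\<exists>k::int. v = (n \<otimes> x) [^] k)"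
proof -
  have w: "w \<in> carrier F" using lox by (rule loxodromic_closed)
  have subN: "subgroup N F" using N by (rule normal_imp_subgroup)
  then have sN: "N \<subseteq> carrier F" by (rule subgroup.subset)
  \<comment> \<open>\<open>F\<close> is torsion-free: \<open>t [^] a = \<one>\<close> commutes with
    \<open>N\<close>, hence so does \<open>t\<close>.\<close>
  have tf: "t = \<one>" if t: "t \<in> carrier F" "0 < a" "t [^] a = \<one>" for t and a :: nat
  proof (rule centralizer_trivial[OF ne nf N rc lox wN t(1)])
    fix n assume n: "n \<in> N"
    show "t \<otimes> n = n \<otimes> t"
      by (rule root_commutingD1[OF rc[OF n] t(1,2)]) (use t n sN in auto)
  qed
  \<comment> \<open>\<open>lox_translate_centralizer\<close> needs a representative of the coset
    that does not commute with \<open>w\<close>.\<close>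
  have "\<exists>m\<in>N. (m \<otimes> x) \<otimes> w \<noteq> w \<otimes> (m \<otimes> x)"
  proof (cases "x \<otimes> w = w \<otimes> x")
    case False
    then show ?thesis using subgroup.one_closed[OF subN] x by (intro bexI[of _ \<one>]) auto
  next
    case True
    obtain m where m: "m \<in> N" "m \<otimes> w \<noteq> w \<otimes> m" using lox_not_central[OF ne N rc[OF wN] lox wN] by blast
    have mc: "m \<in> carrier F" using m sN by blast
    have "(m \<otimes> x) \<otimes> w \<noteq> w \<otimes> (m \<otimes> x)"
    proof
      assume e: "(m \<otimes> x) \<otimes> w = w \<otimes> (m \<otimes> x)"
      have "w \<otimes> ((m \<otimes> x) \<otimes> inv x) = ((m \<otimes> x) \<otimes> inv x) \<otimes> w"
        by (rule commute_mult[OF w m_closed[OF mc x] inv_closed[OF x] e[symmetric]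
            commute_inv[OF w x True[symmetric]]])
      moreover have "(m \<otimes> x) \<otimes> inv x = m" using mc x by (simp add: m_assoc)
      ultimately show False using m by simp
    qed
    then show ?thesis using m by blast
  qed
  then obtain m where m: "m \<in> N" "(m \<otimes> x) \<otimes> w \<noteq> w \<otimes> (m \<otimes> x)" by blast
  have mc: "m \<in> carrier F" using m sN by blast
  have "\<exists>n::nat. \<forall>v\<in>carrier F. v \<otimes> (w [^] n \<otimes> (m \<otimes> x)) = (w [^] n \<otimes> (m \<otimes> x)) \<otimes> v \<longrightarrow>
      (\<exists>k::int. v = (w [^] n \<otimes> (m \<otimes> x)) [^] k)"
    by (rule lox_translate_centralizer[OF lox rc[OF wN] m_closed[OF mc x] m(2)]) (rule tf, assumption+)
  then obtain n :: nat where n: "\<forall>v\<in>carrier F. v \<otimes> (w [^] n \<otimes> (m \<otimes> x)) = (w [^] n \<otimes> (m \<otimes> x)) \<otimes> v \<longrightarrow>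
      (\<exists>k::int. v = (w [^] n \<otimes> (m \<otimes> x)) [^] k)" by blast
  have "w [^] n \<in> N" using subN wN by (induction n) (auto simp: subgroup.one_closed subgroup.m_closed)
  then have "w [^] n \<otimes> m \<in> N" using m subN by (simp add: subgroup.m_closed)
  moreover have "w [^] n \<otimes> (m \<otimes> x) = (w [^] n \<otimes> m) \<otimes> x" using w mc x by (simp add: m_assoc)
  ultimately show ?thesis using n by (intro bexI[of _ "w [^] n \<otimes> m"]) simp_all
qed

section \<open>Subgroups without loxodromic elements\<close>

lemma no_lox_gp_inv:
  assumes "w \<in> carrier F" "\<And>c \<eta>. \<not> loxodromic c \<eta> w"
  shows "D \<one> w / 2 - 2 * \<delta> \<le> gp \<one> (inv w) w"
proof (rule ccontr)
  define c where "c = gp \<one> (inv w) w"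
  assume "\<not> ?thesis"
  then have "0 < D \<one> w - 2 * c - 4 * \<delta>" by (simp add: c_def)
  then have "loxodromic c (D \<one> w - 2 * c - 4 * \<delta>) w"
    using assms(1) gp_nonneg[of \<one> "inv w" w] by (simp add: loxodromic_def c_def)
  then show False using assms(2) by blast
qed

text \<open>Ping-pong: the word that alternates \<open>g\<close> and \<open>k\<close> backtracks
  little at both kinds of junction, so the points it passes form a chain. The corner of
  \<open>g \<otimes> k\<close> at \<open>\<one>\<close> is read off from the four steps around
  \<open>\<one>\<close>.\<close>

lemma lox_product:
  assumes g: "g \<in> carrier F" and k: "k \<in> carrier F"
    and c: "gp \<one> (inv g) k \<le> c" "gp \<one> (inv k) g \<le> c"
    and d: "2 * c + 4 * \<delta> < D \<one> g" "2 * c + 4 * \<delta> < D \<one> k"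
  shows "\<exists>c \<eta>. loxodromic c \<eta> (g \<otimes> k)"
proof -
  have c0: "0 \<le> c" using c(1) gp_nonneg[of \<one> "inv g" k] g k by simp
  define x where "x = (!) [inv (g \<otimes> k), inv k, \<one>, g, g \<otimes> k]"
  have x: "x 0 = inv (g \<otimes> k)" "x (Suc 0) = inv k" "x 2 = \<one>" "x 3 = g" "x 4 = g \<otimes> k"
    by (simp_all add: x_def numeral_eq_Suc)
  have ik: "inv (g \<otimes> k) = inv k \<otimes> inv g" using g k by (simp add: inv_mult_group)
  have cases4: "i = 0 \<or> i = Suc 0 \<or> i = 2 \<or> i = 3 \<or> i = 4" if "i \<le> 4" for i :: nat
    using that by linarith
  have "gp (x 2) (x 0) (x 4) \<le> c + 2 * \<delta>"
  proof (rule chain_between[OF c0])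
    fix i :: nat assume "i \<le> 4"
    then show "x i \<in> carrier F" using cases4[of i] g k by (auto simp: x)
  next
    fix i :: nat assume "i + 2 \<le> 4"
    then have "i = 0 \<or> i = Suc 0 \<or> i = 2" by linarith
    moreover have "gp (x 1) (x 0) (x 2) \<le> c"
      using gp_left[of "inv k" \<one> "inv g" k] g k c by (simp add: x ik)
    moreover have "gp (x 2) (x 1) (x 3) \<le> c" using c by (simp add: x)
    moreover have "gp (x 3) (x 2) (x 4) \<le> c"
      using gp_left[of g \<one> "inv g" k] g k c by (simp add: x)
    ultimately show "gp (x (Suc i)) (x i) (x (i + 2)) \<le> c" by (auto simp: numeral_eq_Suc)
  next
    fix i :: nat assume "i < 4"
    then have "i = 0 \<or> i = Suc 0 \<or> i = 2 \<or> i = 3" by linarith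
    moreover have "2 * c + 4 * \<delta> \<le> D (x 0) (x 1)"
      using D_left[of "inv k" "inv g" \<one>] D_sym[of "inv g" \<one>] g k d by (simp add: x ik D_inv)
    moreover have "2 * c + 4 * \<delta> \<le> D (x 1) (x 2)"
      using D_sym[of "inv k" \<one>] k d by (simp add: x D_inv)
    moreover have "2 * c + 4 * \<delta> \<le> D (x 2) (x 3)" "2 * c + 4 * \<delta> \<le> D (x 3) (x 4)"
      using g k d by (simp_all add: x D_shift1)
    ultimately show "2 * c + 4 * \<delta> \<le> D (x i) (x (Suc i))" by (auto simp: numeral_eq_Suc)
  qed simp
  then have 1: "gp \<one> (inv (g \<otimes> k)) (g \<otimes> k) \<le> c + 2 * \<delta>" by (simp add: x)
  have "gp g \<one> (g \<otimes> k) = gp \<one> (inv g) k" using gp_left[of g \<one> "inv g" k] g k by simp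
  moreover have "D (g \<otimes> k) g = D \<one> k" using D_shift1[of g k] D_sym[of g "g \<otimes> k"] g k by simp
  ultimately have "D \<one> g + D \<one> k - 2 * c \<le> D \<one> (g \<otimes> k)" using c(1) by (simp add: gp_def)
  then have "0 < D \<one> (g \<otimes> k) - 2 * (c + 2 * \<delta>) - 4 * \<delta>" using d by (simp add: algebra_simps)
  then have "loxodromic (c + 2 * \<delta>) (D \<one> (g \<otimes> k) - 2 * (c + 2 * \<delta>) - 4 * \<delta>) (g \<otimes> k)"
    using 1 g k c0 \<delta>_pos by (simp add: loxodromic_def)
  then show ?thesis by blast
qed

context
  fixes N
  assumes N: "subgroup N F" and no_lox: "\<And>c \<eta> w. w \<in> N \<Longrightarrow> \<not> loxodromic c \<eta> w"
begin

text \<open>All long elements of \<open>N\<close> point in one direction. Neither \<open>g\<close>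
  nor \<open>k\<close> is loxodromic, so each points the same way as its inverse;
  \<open>g \<otimes> k\<close> is not loxodromic either, so by \<open>lox_product\<close> one of the
  mixed products is large. The four-point condition combines the two.\<close>

lemma no_lox_gp:
  assumes g: "g \<in> N" and k: "k \<in> N"
  shows "min (D \<one> g) (D \<one> k) / 2 - 3 * \<delta> \<le> gp \<one> g k"
proof -
  have gc: "g \<in> carrier F" and kc: "k \<in> carrier F" using g k subgroup.subset[OF N] by auto
  have gk: "g \<otimes> k \<in> N" using g k N by (simp add: subgroup.m_closed)
  define c where "c = max (gp \<one> (inv g) k) (gp \<one> (inv k) g)"
  have "\<not> (2 * c + 4 * \<delta> < D \<one> g \<and> 2 * c + 4 * \<delta> < D \<one> k)"
    using lox_product[OF gc kc, of c] no_lox[OF gk] by (auto simp: c_def)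
  then have m: "min (D \<one> g) (D \<one> k) / 2 - 2 * \<delta> \<le> c" by linarith
  have "D \<one> g / 2 - 2 * \<delta> \<le> gp \<one> (inv g) g" "D \<one> k / 2 - 2 * \<delta> \<le> gp \<one> (inv k) k"
    using no_lox_gp_inv no_lox g k gc kc by auto
  moreover have "gp \<one> (inv g) g = gp \<one> g (inv g)" "gp \<one> (inv k) g = gp \<one> g (inv k)"
    using gp_commute gc kc by auto
  moreover have "min (gp \<one> g (inv g)) (gp \<one> (inv g) k) - \<delta> \<le> gp \<one> g k"
    "min (gp \<one> g (inv k)) (gp \<one> (inv k) k) - \<delta> \<le> gp \<one> g k"
    using four_point gc kc by auto
  moreover have "c = gp \<one> (inv g) k \<or> c = gp \<one> (inv k) g" unfolding c_def max_def by presburger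
  ultimately show ?thesis using m \<delta>_pos by linarith
qed

text \<open>By \<open>no_lox_gp\<close> for \<open>inv g\<close> and \<open>k\<close>, the shorter
  factor is cancelled almost completely: up to \<open>6 * \<delta>\<close> the length on
  \<open>N\<close> is an ultrametric norm.\<close>

lemma no_lox_mult:
  assumes g: "g \<in> N" and k: "k \<in> N"
  shows "D \<one> (g \<otimes> k) \<le> max (D \<one> g) (D \<one> k) + 6 * \<delta>"
proof -
  have gc: "g \<in> carrier F" and kc: "k \<in> carrier F" using g k subgroup.subset[OF N] by auto
  have "min (D \<one> (inv g)) (D \<one> k) / 2 - 3 * \<delta> \<le> gp \<one> (inv g) k"
    by (rule no_lox_gp) (rule subgroup.m_inv_closed[OF N g], rule k)
  moreover have "gp g \<one> (g \<otimes> k) = gp \<one> (inv g) k" using gp_left[of g \<one> "inv g" k] gc kc by simp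
  moreover have "D (g \<otimes> k) g = D \<one> k" using D_shift1[of g k] D_sym[of g "g \<otimes> k"] gc kc by simp
  then have "2 * gp g \<one> (g \<otimes> k) = D \<one> g + D \<one> k - D \<one> (g \<otimes> k)" by (simp add: gp_def)
  ultimately show ?thesis using gc by (simp add: D_inv min_def max_def split: if_splits)
qed

lemma no_lox_mult_ge:
  assumes g: "g \<in> N" and k: "k \<in> N" and gk: "D \<one> g + 6 * \<delta> < D \<one> k"
  shows "D \<one> k - 6 * \<delta> \<le> D \<one> (g \<otimes> k)"
proof -
  have gc: "g \<in> carrier F" and kc: "k \<in> carrier F" using g k subgroup.subset[OF N] by auto
  have "D \<one> (inv g \<otimes> (g \<otimes> k)) \<le> max (D \<one> (inv g)) (D \<one> (g \<otimes> k)) + 6 * \<delta>"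
    by (rule no_lox_mult) (rule subgroup.m_inv_closed[OF N g], rule subgroup.m_closed[OF N g k])
  then show ?thesis using gk gc kc by (simp add: D_inv max_def split: if_splits)
qed

end

end

section \<open>Loxodromic elements in normal subgroups\<close>

text \<open>Acylindricity keeps its uniform bound here and holds at all points of the space.
  \<open>normal_has_lox\<close> counts elements at points inside a geodesic, which
  \<open>geodesic\<close> supplies and which may lie off the orbit of \<open>s\<close>.\<close>

locale acylindrical_space = group_action F S \<phi> + hyperbolic_pseudometric S d \<delta>
  for F :: "('a, 'm) monoid_scheme" (structure) and S :: "'s set" and \<phi> and d :: "'s \<Rightarrow> 's \<Rightarrow> real" and \<delta> :: real +
  fixes s :: 's
  assumes s: "s \<in> S"
    and isometric: "\<lbrakk>g \<in> carrier F; x \<in> S; y \<in> S\<rbrakk> \<Longrightarrow> d (\<phi> g x) (\<phi> g y) = d x y"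
    and geodesic: "\<lbrakk>x \<in> S; y \<in> S; 0 \<le> t; t \<le> d x y\<rbrakk> \<Longrightarrow> \<exists>p\<in>S. d x p = t \<and> d p y = d x y - t"
    and acylindrical_uniform: "0 < \<epsilon> \<Longrightarrow> \<exists>R>0. \<exists>n::nat. \<forall>x\<in>S. \<forall>y\<in>S. R \<le> d x y \<longrightarrow>
      finite {g \<in> carrier F. d x (\<phi> g x) \<le> \<epsilon> \<and> d y (\<phi> g y) \<le> \<epsilon>} \<and>
      card {g \<in> carrier F. d x (\<phi> g x) \<le> \<epsilon> \<and> d y (\<phi> g y) \<le> \<epsilon>} \<le> n"
    and unbounded: "\<exists>g\<in>carrier F. R \<le> d s (\<phi> g s)"
begin

lemma act_closed: "\<lbrakk>g \<in> carrier F; x \<in> S\<rbrakk> \<Longrightarrow> \<phi> g x \<in> S"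
  using element_image by blast

lemma act_one: "x \<in> S \<Longrightarrow> \<phi> \<one> x = x"
  using id_eq_one by (metis restrict_apply')

lemma group_F: "group F"
  using group_hom group_hom.axioms(1) by blast

definition orbit_dist :: "'a \<Rightarrow> 'a \<Rightarrow> real" where
  "orbit_dist g h = d (\<phi> g s) (\<phi> h s)"

sublocale orb: hyperbolic_group F orbit_dist \<delta>
proof -
  interpret group F by (rule group_F)
  show "hyperbolic_group F orbit_dist \<delta>"
  proof unfold_locales
    fix g x y assume "g \<in> carrier F" "x \<in> carrier F" "y \<in> carrier F"
    then show "orbit_dist (g \<otimes> x) (g \<otimes> y) = orbit_dist x y"
      using s by (simp add: orbit_dist_def composition_rule isometric act_closed)
  next
    fix \<epsilon> :: real assume "0 < \<epsilon>"
    then obtain R n where R: "\<And>x y. \<lbrakk>x \<in> S; y \<in> S; R \<le> d x y\<rbrakk> \<Longrightarrow>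
        finite {g \<in> carrier F. d x (\<phi> g x) \<le> \<epsilon> \<and> d y (\<phi> g y) \<le> \<epsilon>}"
      using acylindrical_uniform by meson
    have "{g \<in> carrier F. orbit_dist x (g \<otimes> x) \<le> \<epsilon> \<and> orbit_dist y (g \<otimes> y) \<le> \<epsilon>}
        = {g \<in> carrier F. d (\<phi> x s) (\<phi> g (\<phi> x s)) \<le> \<epsilon> \<and> d (\<phi> y s) (\<phi> g (\<phi> y s)) \<le> \<epsilon>}"
      if "x \<in> carrier F" "y \<in> carrier F" for x y
      using that s by (auto simp: orbit_dist_def composition_rule)
    then show "\<exists>R. \<forall>x\<in>carrier F. \<forall>y\<in>carrier F. R \<le> orbit_dist x y \<longrightarrow>
        finite {g \<in> carrier F. orbit_dist x (g \<otimes> x) \<le> \<epsilon> \<and> orbit_dist y (g \<otimes> y) \<le> \<epsilon>}"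
      using R act_closed s by (intro exI[of _ R]) (simp add: orbit_dist_def)
  next
    fix w x y z assume "w \<in> carrier F" "x \<in> carrier F" "y \<in> carrier F" "z \<in> carrier F"
    then show "min (Gromov_product orbit_dist w x y) (Gromov_product orbit_dist w y z) - \<delta>
        \<le> Gromov_product orbit_dist w x z"
      using four_point[of "\<phi> w s" "\<phi> x s" "\<phi> y s" "\<phi> z s"] act_closed s
      by (simp add: orbit_dist_def Gromov_product_def)
  qed (use \<delta>_pos s act_closed D_refl D_sym D_tri in \<open>auto simp: orbit_dist_def\<close>)
qed

lemma orbit_dist_one: "orbit_dist \<one> g = d s (\<phi> g s)"
  using s by (simp add: orbit_dist_def act_one)

lemma orbit_gp_one: "orb.gp \<one> g k = gp s (\<phi> g s) (\<phi> k s)"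
  using s by (simp add: orbit_dist_def Gromov_product_def act_one)

text \<open>If \<open>N\<close> moves \<open>s\<close> by a bounded amount, then by normality it
  moves every orbit point by the same bounded amount. Two orbit points far apart then show that
  \<open>N\<close> is finite.\<close>

lemma infinite_normal_unbounded:
  assumes N: "N \<lhd> F" and inf: "infinite N"
  shows "\<exists>n\<in>N. B < orbit_dist \<one> n"
proof (rule ccontr)
  assume "\<not> ?thesis"
  then have B: "\<And>n. n \<in> N \<Longrightarrow> orbit_dist \<one> n \<le> max B 1" by fastforce
  have sN: "N \<subseteq> carrier F" using N by (simp add: normal_imp_subgroup subgroup.subset)
  obtain R where R: "\<And>x y. \<lbrakk>x \<in> carrier F; y \<in> carrier F; R \<le> orbit_dist x y\<rbrakk> \<Longrightarrow>
      finite {g \<in> carrier F. orbit_dist x (g \<otimes> x) \<le> max B 1 \<and> orbit_dist y (g \<otimes> y) \<le> max B 1}"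
    using orb.acylindrical[of "max B 1"] by fastforce
  obtain g where g: "g \<in> carrier F" "R \<le> orbit_dist \<one> g" using unbounded[of R] orbit_dist_one by auto
  have "N \<subseteq> {n \<in> carrier F. orbit_dist \<one> (n \<otimes> \<one>) \<le> max B 1 \<and> orbit_dist g (n \<otimes> g) \<le> max B 1}"
  proof
    fix n assume n: "n \<in> N"
    then have nc: "n \<in> carrier F" using sN by blast
    have "inv g \<otimes> n \<otimes> inv (inv g) \<in> N" using N g(1) n orb.normal_inv_iff orb.inv_closed by blast
    then have "orbit_dist \<one> (inv g \<otimes> (n \<otimes> g)) \<le> max B 1" using B g(1) nc by (simp add: orb.m_assoc)
    moreover have "orbit_dist g (n \<otimes> g) = orbit_dist \<one> (inv g \<otimes> (n \<otimes> g))"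
      using orb.D_shift[of g \<one> "n \<otimes> g"] g(1) nc by simp
    ultimately show "n \<in> {n \<in> carrier F. orbit_dist \<one> (n \<otimes> \<one>) \<le> max B 1 \<and> orbit_dist g (n \<otimes> g) \<le> max B 1}"
      using B[OF n] nc by simp
  qed
  moreover have "finite {n \<in> carrier F. orbit_dist \<one> (n \<otimes> \<one>) \<le> max B 1 \<and> orbit_dist g (n \<otimes> g) \<le> max B 1}"
    by (rule R) (use g in auto)
  ultimately show False using inf finite_subset by blast
qed

text \<open>Without loxodromic elements the orbit looks like that of a parabolic group, whose elements hardly
  move points deep in the direction of the fixed point at infinity.\<close>

lemma no_lox_displacement:
  assumes N: "subgroup N F" and nl: "\<And>c \<eta> w. w \<in> N \<Longrightarrow> \<not> orb.loxodromic c \<eta> w"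
    and g: "g \<in> N" and k: "k \<in> N" and p: "p \<in> S"
    and gk: "orbit_dist \<one> g + 6 * \<delta> < orbit_dist \<one> k"
    and dp: "d s p = t" "d p (\<phi> k s) = orbit_dist \<one> k - t"
    and t: "orbit_dist \<one> g / 2 + 3 * \<delta> \<le> t" "t \<le> orbit_dist \<one> k / 2 - 6 * \<delta>"
  shows "d p (\<phi> g p) \<le> 24 * \<delta>"
proof -
  define Dk where "Dk = orbit_dist \<one> k"
  define Dg where "Dg = orbit_dist \<one> g"
  define Dgk where "Dgk = orbit_dist \<one> (g \<otimes> k)"
  have gc: "g \<in> carrier F" and kc: "k \<in> carrier F" using g k subgroup.subset[OF N] by auto
  have gkN: "g \<otimes> k \<in> N" by (rule subgroup.m_closed[OF N g k])
  define z where "z = \<phi> (g \<otimes> k) s"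
  have z: "z \<in> S" using gc kc s act_closed by (simp add: z_def)
  have z_eq: "z = \<phi> g (\<phi> k s)" using gc kc s by (simp add: z_def composition_rule)
  define gs where "gs = \<phi> g s"
  define gq where "gq = \<phi> g p"
  define ks where "ks = \<phi> k s"
  have S: "gs \<in> S" "gq \<in> S" "ks \<in> S" using gc kc s p act_closed by (simp_all add: gs_def gq_def ks_def)
  have dgs: "d s gs = Dg" "d gs gq = t" "d gq z = Dk - t" "d gs z = Dk" "d s z = Dgk" "d s ks = Dk"
    "d p ks = Dk - t"
    using gc kc s p act_closed dp
    by (simp_all add: gs_def gq_def z_eq isometric Dg_def Dk_def Dgk_def orbit_dist_one ks_def composition_rule)
  have Dgk1: "Dgk \<le> Dk + 6 * \<delta>" "Dk - 6 * \<delta> \<le> Dgk"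
    using orb.no_lox_mult[OF N nl g k] orb.no_lox_mult_ge[OF N nl g k gk] gk \<delta>_pos
    by (simp_all add: Dk_def Dgk_def max_def)
  \<comment> \<open>The ways from \<open>s\<close> to \<open>ks\<close> and to \<open>z\<close> stay
    together at least up to distance \<open>t\<close>; this is where the upper bound on
    \<open>t\<close> enters. Hence \<open>p\<close> lies almost on the way to
    \<open>z\<close>.\<close>
  have "min Dk Dgk / 2 - 3 * \<delta> \<le> orb.gp \<one> k (g \<otimes> k)"
    using orb.no_lox_gp[OF N nl k gkN] by (simp add: Dk_def Dgk_def)
  then have 1: "t \<le> gp s ks z" using Dgk1 t \<delta>_pos by (simp add: orbit_gp_one ks_def z_def Dk_def[symmetric] min_def split: if_splits)
  have "gp s p ks = t"
    using dgs dp(1) D_sym[of p s] D_sym[of ks s] p s S by (simp add: gp_def)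
  then have "t - \<delta> \<le> gp s p z" using 1 four_point[of s p ks z] p s z S by simp
  then have dpz: "d p z \<le> Dgk - t + 2 * \<delta>"
    using dgs dp(1) D_sym[of p s] D_sym[of z s] p s z by (simp add: gp_def)
  have dpz': "Dgk - t \<le> d p z" using D_tri[of s p z] dgs dp(1) p s z by simp
  \<comment> \<open>Seen from \<open>z\<close>, \<open>p\<close> lies almost on the way to
    \<open>s\<close> and \<open>gq\<close> on the way to \<open>gs\<close>; by the lower bound on
    \<open>t\<close> these ways stay together up to distance \<open>Dk - t\<close>. Being nearly
    equally far from \<open>z\<close>, \<open>p\<close> and \<open>gq\<close> are close.\<close>
  have "gp z p s = (d p z + Dgk - t) / 2" using dgs dp(1) D_sym[of p s] p s by (simp add: gp_def)
  then have a: "Dk - t - 6 * \<delta> \<le> gp z p s" using dpz' Dgk1 by simp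
  have "gp z s gs = (Dgk + Dk - Dg) / 2" using dgs by (simp add: gp_def)
  then have b: "Dk - t \<le> gp z s gs" using Dgk1 t by (simp add: Dg_def)
  have c: "gp z gs gq = Dk - t" using dgs by (simp add: gp_def)
  have "Dk - t - \<delta> \<le> gp z s gq" using four_point[of z s gs gq] b c z s S by simp
  then have "Dk - t - 8 * \<delta> \<le> gp z p gq" using four_point[of z p s gq] a z s p S \<delta>_pos by linarith
  then have "d p gq \<le> d p z + d gq z - 2 * (Dk - t - 8 * \<delta>)" by (simp add: gp_def)
  then show ?thesis using dpz Dgk1 dgs by (simp add: gq_def)
qed

text \<open>Otherwise \<open>no_lox_displacement\<close> makes any \<open>n + 1\<close> elements of
  \<open>N\<close> almost fix two points at distance at least \<open>R\<close>, deep on a geodesic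
  to a far orbit point. This contradicts the uniform bound \<open>n\<close>.\<close>

lemma normal_has_lox:
  assumes N: "N \<lhd> F" and inf: "infinite N"
  shows "\<exists>w\<in>N. \<exists>c \<eta>. orb.loxodromic c \<eta> w"
proof (rule ccontr)
  assume "\<not> ?thesis"
  then have nl: "\<And>c \<eta> w. w \<in> N \<Longrightarrow> \<not> orb.loxodromic c \<eta> w" by blast
  have sub: "subgroup N F" using N by (rule normal_imp_subgroup)
  then have sN: "N \<subseteq> carrier F" by (rule subgroup.subset)
  have "0 < 24 * \<delta>" using \<delta>_pos by simp
  from acylindrical_uniform[OF this] obtain R n where R0: "0 < R" and
    R: "\<forall>x\<in>S. \<forall>y\<in>S. R \<le> d x y \<longrightarrow>
      finite {g \<in> carrier F. d x (\<phi> g x) \<le> 24 * \<delta> \<and> d y (\<phi> g y) \<le> 24 * \<delta>} \<and>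
      card {g \<in> carrier F. d x (\<phi> g x) \<le> 24 * \<delta> \<and> d y (\<phi> g y) \<le> 24 * \<delta>} \<le> n" by blast
  obtain T where T: "T \<subseteq> N" "finite T" "card T = Suc n" using inf infinite_arbitrarily_large by blast
  define A where "A = Max (orbit_dist \<one> ` T)"
  have A: "orbit_dist \<one> g \<le> A" if "g \<in> T" for g using that T(2) by (simp add: A_def)
  have "T \<noteq> {}" using T(3) by auto
  then obtain g0 where "g0 \<in> T" by blast
  then have A0: "0 \<le> A" using A[of g0] orb.D_nonneg[of \<one> g0] T(1) sN by fastforce
  \<comment> \<open>The smallest depth that \<open>no_lox_displacement\<close> admits for all
    elements of \<open>T\<close> at once; \<open>k\<close> is then chosen long enough for the depth
    \<open>t2\<close> as well.\<close>
  define t1 where "t1 = A / 2 + 3 * \<delta>"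
  define t2 where "t2 = t1 + R"
  obtain k where k: "k \<in> N" "2 * t2 + 12 * \<delta> < orbit_dist \<one> k"
    using infinite_normal_unbounded[OF N inf] by blast
  have kc: "k \<in> carrier F" using k sN by blast
  have ks: "\<phi> k s \<in> S" using kc s act_closed by blast
  have tk: "0 \<le> t1" "t1 \<le> t2" "t2 \<le> orbit_dist \<one> k / 2 - 6 * \<delta>" "t2 \<le> orbit_dist \<one> k"
    using k A0 R0 \<delta>_pos by (simp_all add: t1_def t2_def)
  obtain p2 where p2: "p2 \<in> S" "d s p2 = t2" "d p2 (\<phi> k s) = orbit_dist \<one> k - t2"
    using geodesic[OF s ks, of t2] tk by (auto simp: orbit_dist_one)
  obtain p1 where p1: "p1 \<in> S" "d s p1 = t1" "d p1 (\<phi> k s) = orbit_dist \<one> k - t1"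
    using geodesic[OF s ks, of t1] tk by (auto simp: orbit_dist_one)
  have "R \<le> d p1 p2" using D_tri[of s p1 p2] p1 p2 s by (simp add: t2_def)
  note fin = R[rule_format, OF p1(1) p2(1) this]
  have "T \<subseteq> {g \<in> carrier F. d p1 (\<phi> g p1) \<le> 24 * \<delta> \<and> d p2 (\<phi> g p2) \<le> 24 * \<delta>}"
  proof
    fix g assume g: "g \<in> T"
    then have gN: "g \<in> N" using T(1) by blast
    have gA: "orbit_dist \<one> g + 6 * \<delta> < orbit_dist \<one> k" "orbit_dist \<one> g / 2 + 3 * \<delta> \<le> t1"
      using A[OF g] k R0 \<delta>_pos by (simp_all add: t1_def t2_def)
    have "d p1 (\<phi> g p1) \<le> 24 * \<delta>"
      by (rule no_lox_displacement[OF sub nl gN k(1) p1(1) gA(1) p1(2,3) gA(2)]) (use tk in auto)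
    moreover have "d p2 (\<phi> g p2) \<le> 24 * \<delta>"
      by (rule no_lox_displacement[OF sub nl gN k(1) p2(1) gA(1) p2(2,3)]) (use tk gA in auto)
    ultimately show "g \<in> {g \<in> carrier F. d p1 (\<phi> g p1) \<le> 24 * \<delta> \<and> d p2 (\<phi> g p2) \<le> 24 * \<delta>}"
      using gN sN by blast
  qed
  then have "card T \<le> n" using fin card_mono by (meson order_trans)
  then show False using T(3) by simp
qed

end

text \<open>All that the algebra below takes from the geometry. A nontrivial normal subgroup is
  infinite here, so it contains an element that is loxodromic for the orbit distance.\<close>

lemma acylindrically_hyperbolic_cyclic_centralizer:
  assumes ah: "acylindrically_hyperbolic TYPE('s) F" and nf: "no_nontrivial_finite_normal_subgroups F"
    and N: "N \<lhd> F" and N1: "N \<noteq> {\<one>\<^bsub>F\<^esub>}" and rc: "\<And>n. n \<in> N \<Longrightarrow> root_commuting F n"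
    and x: "x \<in> carrier F"
  shows "\<exists>n\<in>N. \<forall>v\<in>carrier F. v \<otimes>\<^bsub>F\<^esub> (n \<otimes>\<^bsub>F\<^esub> x) = (n \<otimes>\<^bsub>F\<^esub> x) \<otimes>\<^bsub>F\<^esub> v \<longrightarrow>
    (\<exists>k::int. v = (n \<otimes>\<^bsub>F\<^esub> x) [^]\<^bsub>F\<^esub> k)"
proof -
  have ne: "\<not> elementary_group F" using ah by (simp add: acylindrically_hyperbolic_def)
  obtain S :: "'s set" and d \<phi> where hyp: "Gromov_hyperbolic_space S d" and acyl: "acylindrical_action F S d \<phi>"
    and unb: "unbounded_orbits F S d \<phi>"
    using ah unfolding acylindrically_hyperbolic_def by blast
  obtain s where s: "s \<in> S" using unb by (auto simp: unbounded_orbits_def)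
  interpret M: Metric_space S d
    using hyp by (simp add: Gromov_hyperbolic_space_def geodesic_metric_space_def)
  interpret act: group_action F S \<phi>
    using acyl by (simp add: acylindrical_action_def isometric_action_def)
  obtain \<delta>0 where \<delta>0: "\<And>w x y z. \<lbrakk>w \<in> S; x \<in> S; y \<in> S; z \<in> S\<rbrakk> \<Longrightarrow>
      min (Gromov_product d w x y) (Gromov_product d w y z) - \<delta>0 \<le> Gromov_product d w x z"
    using hyp unfolding Gromov_hyperbolic_space_def by blast
  interpret acylindrical_space F S \<phi> d "max \<delta>0 1" s
  proof unfold_locales
    fix w x y z assume "w \<in> S" "x \<in> S" "y \<in> S" "z \<in> S"
    then show "min (Gromov_product d w x y) (Gromov_product d w y z) - max \<delta>0 1 \<le> Gromov_product d w x z"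
      using \<delta>0[of w x y z] by linarith
  next
    fix g x y assume "g \<in> carrier F" "x \<in> S" "y \<in> S"
    then show "d (\<phi> g x) (\<phi> g y) = d x y"
      using acyl by (simp add: acylindrical_action_def isometric_action_def)
  next
    fix x y t assume xy: "x \<in> S" "y \<in> S" and t: "0 \<le> t" "t \<le> d x y"
    have "\<exists>c. c \<in> {0..d x y} \<rightarrow> S \<and> c 0 = x \<and> c (d x y) = y \<and>
        (\<forall>s\<in>{0..d x y}. \<forall>t\<in>{0..d x y}. d (c s) (c t) = \<bar>s - t\<bar>)"
      using hyp xy unfolding Gromov_hyperbolic_space_def geodesic_metric_space_def by blast
    then obtain c where c: "c \<in> {0..d x y} \<rightarrow> S" "c 0 = x" "c (d x y) = y"
      "\<And>s t. \<lbrakk>s \<in> {0..d x y}; t \<in> {0..d x y}\<rbrakk> \<Longrightarrow> d (c s) (c t) = \<bar>s - t\<bar>" by blast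
    show "\<exists>p\<in>S. d x p = t \<and> d p y = d x y - t"
      using c(1) c(4)[of 0 t] c(4)[of t "d x y"] c(2,3) t by (intro bexI[of _ "c t"]) auto
  next
    fix \<epsilon> :: real assume "0 < \<epsilon>"
    then show "\<exists>R>0. \<exists>n::nat. \<forall>x\<in>S. \<forall>y\<in>S. R \<le> d x y \<longrightarrow>
      finite {g \<in> carrier F. d x (\<phi> g x) \<le> \<epsilon> \<and> d y (\<phi> g y) \<le> \<epsilon>} \<and>
      card {g \<in> carrier F. d x (\<phi> g x) \<le> \<epsilon> \<and> d y (\<phi> g y) \<le> \<epsilon>} \<le> n"
      using acyl unfolding acylindrical_action_def by blast
  next
    fix R
    show "\<exists>g\<in>carrier F. R \<le> d s (\<phi> g s)"
    proof (rule ccontr)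
      assume "\<not> ?thesis"
      then have "d s (\<phi> g s) \<le> R" if "g \<in> carrier F" for g using that by fastforce
      then have "orbit F \<phi> s \<subseteq> M.mcball s R"
        using s act.element_image by (auto simp: orbit_def)
      then have "M.mbounded (orbit F \<phi> s)" by (auto simp: M.mbounded_def)
      then show False using unb s by (simp add: unbounded_orbits_def)
    qed
  qed (use s M.triangle in \<open>auto simp: M.commute\<close>)
  have "infinite N" using nf N N1 by (auto simp: no_nontrivial_finite_normal_subgroups_def)
  then obtain w c \<eta> where "w \<in> N" "orb.loxodromic c \<eta> w" using normal_has_lox[OF N] by blast
  then show ?thesis using orb.cyclic_centralizer_in_coset[OF ne nf N rc _ _ x] by blast
qed

section \<open>Subdirect products and finite quotients\<close>

text \<open>With \<open>m * r\<close> congruent to 1 modulo the order, every element of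
  \<open>M\<close> is the \<open>r\<close>-th power of its \<open>m\<close>-th power.\<close>

lemma finite_p_group_power_inverse:
  assumes M: "finite_p_group p M" and m: "coprime m p" "m \<noteq> 0"
  shows "\<exists>r s. m * r = order M * s + 1"
proof -
  obtain k where "order M = p ^ k" using M by (auto simp: finite_p_group_def)
  then have "gcd m (order M) = 1" using m by simp
  then show ?thesis using bezout_nat[OF m(2), of "order M"] by simp
qed

text \<open>The unit is conjugate only to itself, so separating \<open>x\<close> from it means that
  \<open>x\<close> survives in the quotient.\<close>

lemma p_conjugacy_separable_residually:
  assumes G: "group G" and cs: "p_conjugacy_separable p G" and x: "x \<in> carrier G" "x \<noteq> \<one>\<^bsub>G\<^esub>"
  shows "\<exists>(M :: nat monoid) h. finite_p_group p M \<and> h \<in> hom G M \<and> h x \<noteq> \<one>\<^bsub>M\<^esub>"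
proof -
  interpret G: group G by (rule G)
  have "\<not> conjugate_in G x \<one>\<^bsub>G\<^esub>"
  proof
    assume "conjugate_in G x \<one>\<^bsub>G\<^esub>"
    then obtain g where g: "g \<in> carrier G" "\<one>\<^bsub>G\<^esub> = g \<otimes>\<^bsub>G\<^esub> x \<otimes>\<^bsub>G\<^esub> inv\<^bsub>G\<^esub> g"
      by (auto simp: conjugate_in_def)
    have "x = inv\<^bsub>G\<^esub> g \<otimes>\<^bsub>G\<^esub> (g \<otimes>\<^bsub>G\<^esub> x \<otimes>\<^bsub>G\<^esub> inv\<^bsub>G\<^esub> g) \<otimes>\<^bsub>G\<^esub> g" using g(1) x by (simp add: G.m_assoc)
    also have "\<dots> = \<one>\<^bsub>G\<^esub>" unfolding g(2)[symmetric] using g(1) by simp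
    finally show False using x by simp
  qed
  then obtain M :: "nat monoid" and h where
    M: "finite_p_group p M" "h \<in> hom G M" "\<not> conjugate_in M (h x) (h \<one>\<^bsub>G\<^esub>)"
    using cs x(1) unfolding p_conjugacy_separable_def by blast
  interpret M: group M using M(1) by (simp add: finite_p_group_def)
  have "h \<one>\<^bsub>G\<^esub> = \<one>\<^bsub>M\<^esub>" using hom_one[OF M(2) G] M.is_group by simp
  then have "conjugate_in M (h x) (h \<one>\<^bsub>G\<^esub>)" if "h x = \<one>\<^bsub>M\<^esub>"
    unfolding conjugate_in_def using that by (intro bexI[of _ "\<one>\<^bsub>M\<^esub>"]) simp_all
  then have "h x \<noteq> \<one>\<^bsub>M\<^esub>" using M(3) by blast
  then show ?thesis using M by blast
qed

text \<open>In a finite \<open>p\<close>-group an element is a power of each of its \<open>m\<close>-th powers with \<open>m\<close> prime to \<open>p\<close>.\<close>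

lemma p_conjugacy_separable_commute_root:
  assumes G: "group G" and cs: "p_conjugacy_separable p G"
    and x: "x \<in> carrier G" and y: "y \<in> carrier G" and m: "coprime m p" "m \<noteq> 0"
    and e: "x [^]\<^bsub>G\<^esub> m \<otimes>\<^bsub>G\<^esub> y = y \<otimes>\<^bsub>G\<^esub> x [^]\<^bsub>G\<^esub> m"
  shows "x \<otimes>\<^bsub>G\<^esub> y = y \<otimes>\<^bsub>G\<^esub> x"
proof (rule ccontr)
  interpret G: group G by (rule G)
  assume ne: "x \<otimes>\<^bsub>G\<^esub> y \<noteq> y \<otimes>\<^bsub>G\<^esub> x"
  define a where "a = (x \<otimes>\<^bsub>G\<^esub> y) \<otimes>\<^bsub>G\<^esub> inv\<^bsub>G\<^esub> (y \<otimes>\<^bsub>G\<^esub> x)"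
  have a: "a \<in> carrier G" using x y by (simp add: a_def)
  have axy: "a \<otimes>\<^bsub>G\<^esub> (y \<otimes>\<^bsub>G\<^esub> x) = x \<otimes>\<^bsub>G\<^esub> y" using x y by (simp add: a_def G.m_assoc)
  then have "a \<noteq> \<one>\<^bsub>G\<^esub>" using ne x y by auto
  then obtain M :: "nat monoid" and h where M: "finite_p_group p M" "h \<in> hom G M" "h a \<noteq> \<one>\<^bsub>M\<^esub>"
    using p_conjugacy_separable_residually[OF G cs a] by blast
  interpret M: group M using M(1) by (simp add: finite_p_group_def)
  interpret h: group_hom G M h by unfold_locales (rule M(2))
  obtain r s where rs: "m * r = order M * s + 1" using finite_p_group_power_inverse[OF M(1) m] by blast
  have hx: "h x \<in> carrier M" "h y \<in> carrier M" "h a \<in> carrier M" using x y a by auto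
  have hc: "h x [^]\<^bsub>M\<^esub> m \<otimes>\<^bsub>M\<^esub> h y = h y \<otimes>\<^bsub>M\<^esub> h x [^]\<^bsub>M\<^esub> m"
    using arg_cong[OF e, of h] x y by (simp add: h.hom_nat_pow)
  have "h y \<otimes>\<^bsub>M\<^esub> (h x [^]\<^bsub>M\<^esub> m) [^]\<^bsub>M\<^esub> r = (h x [^]\<^bsub>M\<^esub> m) [^]\<^bsub>M\<^esub> r \<otimes>\<^bsub>M\<^esub> h y"
    by (rule M.commute_nat_pow[OF hx(2) M.nat_pow_closed[OF hx(1)] hc[symmetric]])
  moreover have "(h x [^]\<^bsub>M\<^esub> m) [^]\<^bsub>M\<^esub> r = (h x [^]\<^bsub>M\<^esub> order M) [^]\<^bsub>M\<^esub> s \<otimes>\<^bsub>M\<^esub> h x"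
    using hx rs by (simp add: M.nat_pow_pow M.nat_pow_mult)
  ultimately have "h y \<otimes>\<^bsub>M\<^esub> h x = h x \<otimes>\<^bsub>M\<^esub> h y" using hx by (simp add: M.pow_order_eq_1)
  then have "h a \<otimes>\<^bsub>M\<^esub> (h y \<otimes>\<^bsub>M\<^esub> h x) = h y \<otimes>\<^bsub>M\<^esub> h x" using arg_cong[OF axy, of h] x y a by simp
  then have "h a = \<one>\<^bsub>M\<^esub>" using hx M.r_cancel_one'[of "h y \<otimes>\<^bsub>M\<^esub> h x" "h a"] by simp
  then show False using M(3) by simp
qed

text \<open>Split \<open>m\<close> into a power of \<open>p\<close> and a factor prime to
  \<open>p\<close>. Separability for \<open>p\<close> removes the second factor, separability for
  \<open>q\<close> the first.\<close>

lemma two_primes_commute_root: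
  assumes G: "group G" and pq: "prime p" "prime q" "p \<noteq> q"
    and cs: "p_conjugacy_separable p G" "p_conjugacy_separable q G"
    and x: "x \<in> carrier G" and y: "y \<in> carrier G" and m: "0 < (m::nat)"
    and e: "x [^]\<^bsub>G\<^esub> m \<otimes>\<^bsub>G\<^esub> y = y \<otimes>\<^bsub>G\<^esub> x [^]\<^bsub>G\<^esub> m"
  shows "x \<otimes>\<^bsub>G\<^esub> y = y \<otimes>\<^bsub>G\<^esub> x"
proof -
  interpret G: group G by (rule G)
  have "\<not> is_unit p" using pq(1) by (meson not_prime_unit)
  then obtain m' where m': "m = p ^ multiplicity p m * m'" "\<not> p dvd m'"
    using multiplicity_decompose'[of m p] m by auto
  define k where "k = p ^ multiplicity p m"
  have "m' \<noteq> 0" using m m' by (metis mult_0_right neq0_conv)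
  moreover have "coprime m' p" using pq(1) m'(2) by (metis coprime_commute prime_imp_coprime)
  moreover have "(x [^]\<^bsub>G\<^esub> k) [^]\<^bsub>G\<^esub> m' \<otimes>\<^bsub>G\<^esub> y = y \<otimes>\<^bsub>G\<^esub> (x [^]\<^bsub>G\<^esub> k) [^]\<^bsub>G\<^esub> m'"
    using e x m'(1) by (simp add: G.nat_pow_pow k_def)
  ultimately have "x [^]\<^bsub>G\<^esub> k \<otimes>\<^bsub>G\<^esub> y = y \<otimes>\<^bsub>G\<^esub> x [^]\<^bsub>G\<^esub> k"
    using p_conjugacy_separable_commute_root[OF G cs(1) G.nat_pow_closed[OF x] y] by blast
  moreover have "coprime k q" using pq by (simp add: k_def primes_coprime)
  moreover have "k \<noteq> 0" using pq(1) by (simp add: k_def prime_gt_0_nat)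
  ultimately show ?thesis using p_conjugacy_separable_commute_root[OF G cs(2) x y] by blast
qed

text \<open>Transfers root properties along a projection. \<open>lift\<close> holds for elements
  trivial in the other coordinate, because commuting with them is decided in one coordinate.\<close>

lemma root_commuting_image:
  assumes P: "group P" and F: "group F" and \<pi>: "\<pi> \<in> hom P F" and surj: "\<pi> ` carrier P = carrier F"
    and w': "w' \<in> carrier P" "\<pi> w' = w"
    and lift: "\<And>g k. \<lbrakk>g \<in> carrier P; \<pi> g \<otimes>\<^bsub>F\<^esub> w [^]\<^bsub>F\<^esub> (k::nat) = w [^]\<^bsub>F\<^esub> k \<otimes>\<^bsub>F\<^esub> \<pi> g\<rbrakk> \<Longrightarrow>
      g \<otimes>\<^bsub>P\<^esub> w' [^]\<^bsub>P\<^esub> k = w' [^]\<^bsub>P\<^esub> k \<otimes>\<^bsub>P\<^esub> g"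
    and root: "\<And>x y m. \<lbrakk>x \<in> carrier P; y \<in> carrier P; 0 < (m::nat);
      x [^]\<^bsub>P\<^esub> m \<otimes>\<^bsub>P\<^esub> y = y \<otimes>\<^bsub>P\<^esub> x [^]\<^bsub>P\<^esub> m\<rbrakk> \<Longrightarrow> x \<otimes>\<^bsub>P\<^esub> y = y \<otimes>\<^bsub>P\<^esub> x"
  shows "root_commuting F w"
  unfolding root_commuting_def
proof (intro ballI allI impI conjI)
  interpret P: group P by (rule P)
  interpret F: group F by (rule F)
  interpret h: group_hom P F \<pi> by unfold_locales (rule \<pi>)
  fix f and m :: nat assume "f \<in> carrier F" and m: "0 < m"
  then obtain g where g: "g \<in> carrier P" "f = \<pi> g" using surj by blast
  have w: "w \<in> carrier F" using w' by auto
  have down: "f \<otimes>\<^bsub>F\<^esub> w = w \<otimes>\<^bsub>F\<^esub> f" if "g \<otimes>\<^bsub>P\<^esub> w' = w' \<otimes>\<^bsub>P\<^esub> g"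
    using arg_cong[OF that, of \<pi>] g w' by simp
  {
    assume e: "f [^]\<^bsub>F\<^esub> m \<otimes>\<^bsub>F\<^esub> w = w \<otimes>\<^bsub>F\<^esub> f [^]\<^bsub>F\<^esub> m"
    have "g [^]\<^bsub>P\<^esub> m \<otimes>\<^bsub>P\<^esub> w' = w' \<otimes>\<^bsub>P\<^esub> g [^]\<^bsub>P\<^esub> m"
      using lift[of "g [^]\<^bsub>P\<^esub> m" 1] e g w w' by (simp add: h.hom_nat_pow)
    from root[OF g(1) w'(1) m this] show "f \<otimes>\<^bsub>F\<^esub> w = w \<otimes>\<^bsub>F\<^esub> f" by (rule down)
  next
    assume e: "f \<otimes>\<^bsub>F\<^esub> w [^]\<^bsub>F\<^esub> m = w [^]\<^bsub>F\<^esub> m \<otimes>\<^bsub>F\<^esub> f"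
    have "w' [^]\<^bsub>P\<^esub> m \<otimes>\<^bsub>P\<^esub> g = g \<otimes>\<^bsub>P\<^esub> w' [^]\<^bsub>P\<^esub> m"
      using lift[OF g(1), of m] e g by simp
    from root[OF w'(1) g(1) m this] show "f \<otimes>\<^bsub>F\<^esub> w = w \<otimes>\<^bsub>F\<^esub> f" by (intro down) simp
  }
qed

section \<open>Subdirect products and their intersections with the factors\<close>

locale subdirect = A: group A + B: group B
  for A :: "('a, 'm) monoid_scheme" and B :: "('b, 'n) monoid_scheme" +
  fixes G :: "('a \<times> 'b) set"
  assumes sub: "subdirect_product G A B"
begin

abbreviation P :: "('a \<times> 'b) monoid" where "P \<equiv> (A \<times>\<times> B)\<lparr>carrier := G\<rparr>"

definition N1 :: "'a set" where "N1 = {a \<in> carrier A. (a, \<one>\<^bsub>B\<^esub>) \<in> G}"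
definition N2 :: "'b set" where "N2 = {b \<in> carrier B. (\<one>\<^bsub>A\<^esub>, b) \<in> G}"

lemma subgroup_G: "subgroup G (A \<times>\<times> B)"
  using sub by (simp add: subdirect_product_def)

lemma group_P: "group P"
  using group.subgroup_imp_group[OF DirProd_group[OF A.is_group B.is_group] subgroup_G] .

lemma G_closed: "(a, b) \<in> G \<Longrightarrow> a \<in> carrier A \<and> b \<in> carrier B"
  using subgroup.subset[OF subgroup_G] by auto

lemma G_one: "(\<one>\<^bsub>A\<^esub>, \<one>\<^bsub>B\<^esub>) \<in> G"
  using subgroup.one_closed[OF subgroup_G] by simp

lemma G_mult: "\<lbrakk>(a, b) \<in> G; (c, d) \<in> G\<rbrakk> \<Longrightarrow> (a \<otimes>\<^bsub>A\<^esub> c, b \<otimes>\<^bsub>B\<^esub> d) \<in> G"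
  using subgroup.m_closed[OF subgroup_G, of "(a, b)" "(c, d)"] by simp

lemma G_inv: "(a, b) \<in> G \<Longrightarrow> (inv\<^bsub>A\<^esub> a, inv\<^bsub>B\<^esub> b) \<in> G"
  using subgroup.m_inv_closed[OF subgroup_G, of "(a, b)"] G_closed[of a b]
  by (simp add: inv_DirProd[OF A.is_group B.is_group])

lemma G_nat_pow: "(a, b) \<in> G \<Longrightarrow> (a [^]\<^bsub>A\<^esub> (n::nat), b [^]\<^bsub>B\<^esub> n) \<in> G"
  by (induction n) (simp_all add: G_one G_mult)

lemma G_int_pow: "(a, b) \<in> G \<Longrightarrow> (a [^]\<^bsub>A\<^esub> (n::int), b [^]\<^bsub>B\<^esub> n) \<in> G"
  using G_closed[of a b]
  by (cases n rule: int_cases2) (simp_all add: int_pow_int A.int_pow_neg_int B.int_pow_neg_int G_nat_pow G_inv)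

lemma P_inv: "(a, b) \<in> G \<Longrightarrow> inv\<^bsub>P\<^esub> (a, b) = (inv\<^bsub>A\<^esub> a, inv\<^bsub>B\<^esub> b)"
  using group.m_inv_consistent[OF DirProd_group[OF A.is_group B.is_group] subgroup_G] G_closed[of a b]
  by (simp add: inv_DirProd[OF A.is_group B.is_group])

lemma P_nat_pow: "(a, b) [^]\<^bsub>P\<^esub> (n::nat) = (a [^]\<^bsub>A\<^esub> n, b [^]\<^bsub>B\<^esub> n)"
  by (induction n) simp_all

lemma fst_hom: "fst \<in> hom P A"
  by (rule homI) (auto dest: G_closed)

lemma snd_hom: "snd \<in> hom P B"
  by (rule homI) (auto dest: G_closed)

lemma lift_fst: "a \<in> carrier A \<Longrightarrow> \<exists>b. (a, b) \<in> G"
  using sub by (force simp: subdirect_product_def)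

lemma lift_snd: "b \<in> carrier B \<Longrightarrow> \<exists>a. (a, b) \<in> G"
  using sub by (force simp: subdirect_product_def)

lemma N1_normal: "N1 \<lhd> A"
proof (rule A.normal_invI)
  show "subgroup N1 A"
  proof (rule A.subgroupI)
    show "N1 \<noteq> {}" using G_one by (auto simp: N1_def)
  next
    fix a assume "a \<in> N1"
    then show "inv\<^bsub>A\<^esub> a \<in> N1" using G_inv[of a "\<one>\<^bsub>B\<^esub>"] by (simp add: N1_def)
  next
    fix a c assume "a \<in> N1" "c \<in> N1"
    then show "a \<otimes>\<^bsub>A\<^esub> c \<in> N1" using G_mult[of a "\<one>\<^bsub>B\<^esub>" c "\<one>\<^bsub>B\<^esub>"] by (simp add: N1_def)
  qed (auto simp: N1_def)
next
  fix x n assume x: "x \<in> carrier A" and n: "n \<in> N1"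
  obtain b where b: "(x, b) \<in> G" using lift_fst x by blast
  have "(x \<otimes>\<^bsub>A\<^esub> n \<otimes>\<^bsub>A\<^esub> inv\<^bsub>A\<^esub> x, b \<otimes>\<^bsub>B\<^esub> \<one>\<^bsub>B\<^esub> \<otimes>\<^bsub>B\<^esub> inv\<^bsub>B\<^esub> b) \<in> G"
    using b n by (intro G_mult G_inv) (auto simp: N1_def)
  then show "x \<otimes>\<^bsub>A\<^esub> n \<otimes>\<^bsub>A\<^esub> inv\<^bsub>A\<^esub> x \<in> N1" using G_closed[OF b] n by (simp add: N1_def)
qed

lemma N2_normal: "N2 \<lhd> B"
proof (rule B.normal_invI)
  show "subgroup N2 B"
  proof (rule B.subgroupI)
    show "N2 \<noteq> {}" using G_one by (auto simp: N2_def)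
  next
    fix a assume "a \<in> N2"
    then show "inv\<^bsub>B\<^esub> a \<in> N2" using G_inv[of "\<one>\<^bsub>A\<^esub>" a] by (simp add: N2_def)
  next
    fix a c assume "a \<in> N2" "c \<in> N2"
    then show "a \<otimes>\<^bsub>B\<^esub> c \<in> N2" using G_mult[of "\<one>\<^bsub>A\<^esub>" a "\<one>\<^bsub>A\<^esub>" c] by (simp add: N2_def)
  qed (auto simp: N2_def)
next
  fix x n assume x: "x \<in> carrier B" and n: "n \<in> N2"
  obtain a where a: "(a, x) \<in> G" using lift_snd x by blast
  have "(a \<otimes>\<^bsub>A\<^esub> \<one>\<^bsub>A\<^esub> \<otimes>\<^bsub>A\<^esub> inv\<^bsub>A\<^esub> a, x \<otimes>\<^bsub>B\<^esub> n \<otimes>\<^bsub>B\<^esub> inv\<^bsub>B\<^esub> x) \<in> G"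
    using a n by (intro G_mult G_inv) (auto simp: N2_def)
  then show "x \<otimes>\<^bsub>B\<^esub> n \<otimes>\<^bsub>B\<^esub> inv\<^bsub>B\<^esub> x \<in> N2" using G_closed[OF a] n by (simp add: N2_def)
qed

lemma N1_root_commuting:
  assumes root: "\<And>x y m. \<lbrakk>x \<in> carrier P; y \<in> carrier P; 0 < (m::nat);
      x [^]\<^bsub>P\<^esub> m \<otimes>\<^bsub>P\<^esub> y = y \<otimes>\<^bsub>P\<^esub> x [^]\<^bsub>P\<^esub> m\<rbrakk> \<Longrightarrow> x \<otimes>\<^bsub>P\<^esub> y = y \<otimes>\<^bsub>P\<^esub> x"
    and n: "n \<in> N1"
  shows "root_commuting A n"
proof (rule root_commuting_image[OF group_P A.is_group fst_hom _ _ _ _ root])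
  show "fst ` carrier P = carrier A" using sub by (simp add: subdirect_product_def)
  show "(n, \<one>\<^bsub>B\<^esub>) \<in> carrier P" "fst (n, \<one>\<^bsub>B\<^esub>) = n" using n by (simp_all add: N1_def)
  fix g :: "'a \<times> 'b" and k :: nat
  assume "g \<in> carrier P" and e: "fst g \<otimes>\<^bsub>A\<^esub> n [^]\<^bsub>A\<^esub> k = n [^]\<^bsub>A\<^esub> k \<otimes>\<^bsub>A\<^esub> fst g"
  then show "g \<otimes>\<^bsub>P\<^esub> (n, \<one>\<^bsub>B\<^esub>) [^]\<^bsub>P\<^esub> k = (n, \<one>\<^bsub>B\<^esub>) [^]\<^bsub>P\<^esub> k \<otimes>\<^bsub>P\<^esub> g"
    by (cases g) (auto simp: P_nat_pow dest: G_closed)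
qed

lemma N2_root_commuting:
  assumes root: "\<And>x y m. \<lbrakk>x \<in> carrier P; y \<in> carrier P; 0 < (m::nat);
      x [^]\<^bsub>P\<^esub> m \<otimes>\<^bsub>P\<^esub> y = y \<otimes>\<^bsub>P\<^esub> x [^]\<^bsub>P\<^esub> m\<rbrakk> \<Longrightarrow> x \<otimes>\<^bsub>P\<^esub> y = y \<otimes>\<^bsub>P\<^esub> x"
    and n: "n \<in> N2"
  shows "root_commuting B n"
proof (rule root_commuting_image[OF group_P B.is_group snd_hom _ _ _ _ root])
  show "snd ` carrier P = carrier B" using sub by (simp add: subdirect_product_def)
  show "(\<one>\<^bsub>A\<^esub>, n) \<in> carrier P" "snd (\<one>\<^bsub>A\<^esub>, n) = n" using n by (simp_all add: N2_def)
  fix g :: "'a \<times> 'b" and k :: nat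
  assume "g \<in> carrier P" and e: "snd g \<otimes>\<^bsub>B\<^esub> n [^]\<^bsub>B\<^esub> k = n [^]\<^bsub>B\<^esub> k \<otimes>\<^bsub>B\<^esub> snd g"
  then show "g \<otimes>\<^bsub>P\<^esub> (\<one>\<^bsub>A\<^esub>, n) [^]\<^bsub>P\<^esub> k = (\<one>\<^bsub>A\<^esub>, n) [^]\<^bsub>P\<^esub> k \<otimes>\<^bsub>P\<^esub> g"
    by (cases g) (auto simp: P_nat_pow dest: G_closed)
qed

text \<open>If \<open>(u, v)\<close> conjugates one pair to the other, then
  \<open>inv u \<otimes> a\<close> centralizes \<open>h\<close> and \<open>v\<close> centralizes
  \<open>k\<close>, so both are powers. Modulo \<open>N2\<close> this writes \<open>b\<close> as a
  power of \<open>b [^] m\<close>.\<close>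

lemma conjugate_imp_power:
  assumes ab: "(a, b) \<in> G" and hb: "(h, b [^]\<^bsub>B\<^esub> m) \<in> G" and hk: "(h, k) \<in> G"
    and ch: "\<And>v. \<lbrakk>v \<in> carrier A; v \<otimes>\<^bsub>A\<^esub> h = h \<otimes>\<^bsub>A\<^esub> v\<rbrakk> \<Longrightarrow> \<exists>i::int. v = h [^]\<^bsub>A\<^esub> i"
    and ck: "\<And>v. \<lbrakk>v \<in> carrier B; v \<otimes>\<^bsub>B\<^esub> k = k \<otimes>\<^bsub>B\<^esub> v\<rbrakk> \<Longrightarrow> \<exists>i::int. v = k [^]\<^bsub>B\<^esub> i"
    and conj: "conjugate_in P (h, k) (a \<otimes>\<^bsub>A\<^esub> h \<otimes>\<^bsub>A\<^esub> inv\<^bsub>A\<^esub> a, k)"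
  shows "\<exists>t::int. (\<one>\<^bsub>A\<^esub>, b [^]\<^bsub>B\<^esub> (1 - int m * t)) \<in> G"
proof -
  have c: "a \<in> carrier A" "b \<in> carrier B" "h \<in> carrier A" "k \<in> carrier B"
    using G_closed[OF ab] G_closed[OF hk] by auto
  obtain u v where uv: "(u, v) \<in> G"
    and e: "(a \<otimes>\<^bsub>A\<^esub> h \<otimes>\<^bsub>A\<^esub> inv\<^bsub>A\<^esub> a, k) = (u, v) \<otimes>\<^bsub>P\<^esub> (h, k) \<otimes>\<^bsub>P\<^esub> inv\<^bsub>P\<^esub> (u, v)"
    using conj by (auto simp: conjugate_in_def)
  have uvc: "u \<in> carrier A" "v \<in> carrier B" using G_closed[OF uv] by auto
  have e1: "a \<otimes>\<^bsub>A\<^esub> h \<otimes>\<^bsub>A\<^esub> inv\<^bsub>A\<^esub> a = u \<otimes>\<^bsub>A\<^esub> h \<otimes>\<^bsub>A\<^esub> inv\<^bsub>A\<^esub> u"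
    and e2: "k = v \<otimes>\<^bsub>B\<^esub> k \<otimes>\<^bsub>B\<^esub> inv\<^bsub>B\<^esub> v"
    using e uv by (simp_all add: P_inv)
  have "(inv\<^bsub>A\<^esub> u \<otimes>\<^bsub>A\<^esub> a) \<otimes>\<^bsub>A\<^esub> h = inv\<^bsub>A\<^esub> u \<otimes>\<^bsub>A\<^esub> (a \<otimes>\<^bsub>A\<^esub> h \<otimes>\<^bsub>A\<^esub> inv\<^bsub>A\<^esub> a) \<otimes>\<^bsub>A\<^esub> a"
    using c uvc by (simp add: A.m_assoc)
  also have "\<dots> = h \<otimes>\<^bsub>A\<^esub> (inv\<^bsub>A\<^esub> u \<otimes>\<^bsub>A\<^esub> a)" unfolding e1 using c uvc by (simp add: A.m_assoc)
  finally obtain i :: int where i: "inv\<^bsub>A\<^esub> u \<otimes>\<^bsub>A\<^esub> a = h [^]\<^bsub>A\<^esub> i" using ch c uvc by blast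
  have "v \<otimes>\<^bsub>B\<^esub> k = (v \<otimes>\<^bsub>B\<^esub> k \<otimes>\<^bsub>B\<^esub> inv\<^bsub>B\<^esub> v) \<otimes>\<^bsub>B\<^esub> v" using c uvc by (simp add: B.m_assoc)
  then have "v \<otimes>\<^bsub>B\<^esub> k = k \<otimes>\<^bsub>B\<^esub> v" using e2 by simp
  then obtain j :: int where j: "v = k [^]\<^bsub>B\<^esub> j" using ck uvc by blast
  have u: "inv\<^bsub>A\<^esub> u = h [^]\<^bsub>A\<^esub> i \<otimes>\<^bsub>A\<^esub> inv\<^bsub>A\<^esub> a" using c uvc by (simp add: i[symmetric] A.m_assoc)
  \<comment> \<open>\<open>x\<close> equals \<open>inv u\<close> times the \<open>j\<close>-th power
    of \<open>h\<close>, and multiplying \<open>inv (u, v)\<close> by the \<open>j\<close>-th power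
    of \<open>(h, k)\<close> kills the second coordinate. Reading the same word in
    \<open>(h, b [^] m)\<close> and \<open>(a, b)\<close> gives the partner
    \<open>y\<close>.\<close>
  define x where "x = h [^]\<^bsub>A\<^esub> i \<otimes>\<^bsub>A\<^esub> inv\<^bsub>A\<^esub> a \<otimes>\<^bsub>A\<^esub> h [^]\<^bsub>A\<^esub> j"
  have x: "x \<in> carrier A" using c by (simp add: x_def)
  have "(inv\<^bsub>A\<^esub> u \<otimes>\<^bsub>A\<^esub> h [^]\<^bsub>A\<^esub> j, inv\<^bsub>B\<^esub> v \<otimes>\<^bsub>B\<^esub> k [^]\<^bsub>B\<^esub> j) \<in> G"
    by (intro G_mult G_inv G_int_pow uv hk)
  then have x1: "(x, \<one>\<^bsub>B\<^esub>) \<in> G" using c by (simp add: x_def u j)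
  define y where "y = (b [^]\<^bsub>B\<^esub> m) [^]\<^bsub>B\<^esub> i \<otimes>\<^bsub>B\<^esub> inv\<^bsub>B\<^esub> b \<otimes>\<^bsub>B\<^esub> (b [^]\<^bsub>B\<^esub> m) [^]\<^bsub>B\<^esub> j"
  have "(x, y) \<in> G" unfolding x_def y_def by (intro G_mult G_inv G_int_pow ab hb)
  from G_mult[OF G_inv[OF this] x1] have y1: "(\<one>\<^bsub>A\<^esub>, inv\<^bsub>B\<^esub> y) \<in> G"
    using x c by (simp add: y_def)
  have "y = b [^]\<^bsub>B\<^esub> (int m * i) \<otimes>\<^bsub>B\<^esub> b [^]\<^bsub>B\<^esub> (- 1 :: int) \<otimes>\<^bsub>B\<^esub> b [^]\<^bsub>B\<^esub> (int m * j)"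
    using c by (simp add: y_def int_pow_int[symmetric] B.int_pow_pow B.int_pow_neg)
  also have "\<dots> = b [^]\<^bsub>B\<^esub> (int m * i + - 1 + int m * j)" using c by (simp only: B.int_pow_mult)
  finally have "inv\<^bsub>B\<^esub> y = b [^]\<^bsub>B\<^esub> (- (int m * i + - 1 + int m * j))" using c by (simp only: B.int_pow_neg)
  also have "- (int m * i + - 1 + int m * j) = 1 - int m * (i + j)" by (simp add: algebra_simps)
  finally show ?thesis using y1 by (intro exI[of _ "i + j"]) simp
qed

text \<open>In a finite \<open>p\<close>-group, \<open>a\<close> is a power of \<open>a\<^sup>m\<close> up to an element \<open>e\<close> of the kernel. As \<open>b\<^sup>m\<close> commutes
  with the powers of \<open>b\<close>, the commutator of \<open>(h, b\<^sup>m)\<close> with \<open>(e, f)\<close> is \<open>([h, e], 1)\<close>, which makes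
  conjugation by \<open>e\<close> in the first coordinate alone invisible.\<close>

lemma p_quotient_conjugate:
  assumes M: "finite_p_group p M" and \<phi>: "\<phi> \<in> hom P M" and m: "coprime m p" "m \<noteq> 0"
    and ab: "(a, b) \<in> G" and hb: "(h, b [^]\<^bsub>B\<^esub> m) \<in> G" and n: "(\<one>\<^bsub>A\<^esub>, n) \<in> G"
  shows "conjugate_in M (\<phi> (h, n \<otimes>\<^bsub>B\<^esub> b [^]\<^bsub>B\<^esub> m)) (\<phi> (a \<otimes>\<^bsub>A\<^esub> h \<otimes>\<^bsub>A\<^esub> inv\<^bsub>A\<^esub> a, n \<otimes>\<^bsub>B\<^esub> b [^]\<^bsub>B\<^esub> m))"
proof -
  interpret P: group P by (rule group_P)
  interpret M: group M using M by (simp add: finite_p_group_def)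
  interpret h: group_hom P M \<phi> by unfold_locales (rule \<phi>)
  have c: "a \<in> carrier A" "b \<in> carrier B" "h \<in> carrier A" "n \<in> carrier B"
    using G_closed[OF ab] G_closed[OF hb] G_closed[OF n] by auto
  obtain r s where rs: "m * r = order M * s + 1" using finite_p_group_power_inverse[OF M m] by blast
  \<comment> \<open>By \<open>rs\<close> the power \<open>a [^] (m * r)\<close> equals
    \<open>e \<otimes> a\<close>, and the exponent is a multiple of the order of \<open>M\<close>,
    so \<open>\<phi>\<close> kills \<open>(e, f)\<close>.\<close>
  define e where "e = a [^]\<^bsub>A\<^esub> (order M * s)"
  define f where "f = b [^]\<^bsub>B\<^esub> (order M * s)"
  have ec: "e \<in> carrier A" "f \<in> carrier B" using c by (simp_all add: e_def f_def)
  have ef: "(e, f) \<in> G" unfolding e_def f_def by (rule G_nat_pow[OF ab])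
  have "\<phi> (e, f) = \<phi> ((a, b) [^]\<^bsub>P\<^esub> (order M * s))" by (simp only: P_nat_pow e_def f_def)
  also have "\<dots> = (\<phi> (a, b) [^]\<^bsub>M\<^esub> order M) [^]\<^bsub>M\<^esub> s" using ab by (simp add: h.hom_nat_pow M.nat_pow_pow)
  also have "\<dots> = \<one>\<^bsub>M\<^esub>" using ab by (simp add: M.pow_order_eq_1)
  finally have \<phi>ef: "\<phi> (e, f) = \<one>\<^bsub>M\<^esub>" .
  have fb: "f \<otimes>\<^bsub>B\<^esub> b [^]\<^bsub>B\<^esub> m = b [^]\<^bsub>B\<^esub> m \<otimes>\<^bsub>B\<^esub> f"
    using c by (simp add: f_def B.nat_pow_mult add.commute)
  \<comment> \<open>\<open>h\<close> and \<open>a [^] m\<close> have the common partner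
    \<open>b [^] m\<close>, so \<open>x\<close> lies in \<open>N1\<close>. As \<open>h [^] r\<close>
    commutes with \<open>h\<close>, conjugating \<open>h\<close> by \<open>x\<close> or by
    \<open>e \<otimes> a\<close> gives the same \<open>h'\<close>.\<close>
  define x where "x = a [^]\<^bsub>A\<^esub> (m * r) \<otimes>\<^bsub>A\<^esub> inv\<^bsub>A\<^esub> (h [^]\<^bsub>A\<^esub> r)"
  have xc: "x \<in> carrier A" using c by (simp add: x_def)
  have "(x, b [^]\<^bsub>B\<^esub> (m * r) \<otimes>\<^bsub>B\<^esub> inv\<^bsub>B\<^esub> ((b [^]\<^bsub>B\<^esub> m) [^]\<^bsub>B\<^esub> r)) \<in> G"
    unfolding x_def by (intro G_mult G_inv G_nat_pow ab hb)
  then have x1: "(x, \<one>\<^bsub>B\<^esub>) \<in> G" using c by (simp add: B.nat_pow_pow)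
  have xh: "x \<otimes>\<^bsub>A\<^esub> h [^]\<^bsub>A\<^esub> r = e \<otimes>\<^bsub>A\<^esub> a" using c by (simp add: x_def A.m_assoc rs e_def)
  define h' where "h' = x \<otimes>\<^bsub>A\<^esub> h \<otimes>\<^bsub>A\<^esub> inv\<^bsub>A\<^esub> x"
  have h'c: "h' \<in> carrier A" using c xc by (simp add: h'_def)
  have h'G: "(h', b [^]\<^bsub>B\<^esub> m) \<in> G"
    using G_mult[OF G_mult[OF x1 hb] G_inv[OF x1]] c by (simp add: h'_def)
  have hr: "h [^]\<^bsub>A\<^esub> r \<otimes>\<^bsub>A\<^esub> h = h \<otimes>\<^bsub>A\<^esub> h [^]\<^bsub>A\<^esub> r"
    by (rule A.commute_nat_pow[OF c(3,3) refl, symmetric])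
  have h'e: "h' \<otimes>\<^bsub>A\<^esub> (e \<otimes>\<^bsub>A\<^esub> a) = (e \<otimes>\<^bsub>A\<^esub> a) \<otimes>\<^bsub>A\<^esub> h"
  proof -
    have "h' \<otimes>\<^bsub>A\<^esub> (x \<otimes>\<^bsub>A\<^esub> h [^]\<^bsub>A\<^esub> r) = x \<otimes>\<^bsub>A\<^esub> (h \<otimes>\<^bsub>A\<^esub> h [^]\<^bsub>A\<^esub> r)"
      using c xc by (simp add: h'_def A.m_assoc)
    also have "\<dots> = (x \<otimes>\<^bsub>A\<^esub> h [^]\<^bsub>A\<^esub> r) \<otimes>\<^bsub>A\<^esub> h" unfolding hr[symmetric] using c xc by (simp add: A.m_assoc)
    finally show ?thesis by (simp add: xh)
  qed
  have "inv\<^bsub>A\<^esub> e \<otimes>\<^bsub>A\<^esub> h' \<otimes>\<^bsub>A\<^esub> e = inv\<^bsub>A\<^esub> e \<otimes>\<^bsub>A\<^esub> (h' \<otimes>\<^bsub>A\<^esub> (e \<otimes>\<^bsub>A\<^esub> a)) \<otimes>\<^bsub>A\<^esub> inv\<^bsub>A\<^esub> a"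
    using c ec h'c by (simp add: A.m_assoc)
  also have "\<dots> = a \<otimes>\<^bsub>A\<^esub> h \<otimes>\<^bsub>A\<^esub> inv\<^bsub>A\<^esub> a" unfolding h'e using c ec by (simp add: A.m_assoc)
  finally have ah: "a \<otimes>\<^bsub>A\<^esub> h \<otimes>\<^bsub>A\<^esub> inv\<^bsub>A\<^esub> a = inv\<^bsub>A\<^esub> e \<otimes>\<^bsub>A\<^esub> h' \<otimes>\<^bsub>A\<^esub> e" by simp
  have EF: "(e, f) \<in> carrier P" and H': "(h', b [^]\<^bsub>B\<^esub> m) \<in> carrier P" using ef h'G by simp_all
  \<comment> \<open>\<open>f\<close> commutes with \<open>b [^] m\<close>, so conjugation by
    \<open>(e, f)\<close> leaves the second coordinate unchanged.\<close>
  have eq: "(inv\<^bsub>A\<^esub> e \<otimes>\<^bsub>A\<^esub> h' \<otimes>\<^bsub>A\<^esub> e, b [^]\<^bsub>B\<^esub> m) = inv\<^bsub>P\<^esub> (e, f) \<otimes>\<^bsub>P\<^esub> (h', b [^]\<^bsub>B\<^esub> m) \<otimes>\<^bsub>P\<^esub> (e, f)"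
    using ec c ef by (simp add: P_inv B.m_assoc fb[symmetric])
  have "\<phi> (inv\<^bsub>A\<^esub> e \<otimes>\<^bsub>A\<^esub> h' \<otimes>\<^bsub>A\<^esub> e, b [^]\<^bsub>B\<^esub> m)
      = inv\<^bsub>M\<^esub> \<one>\<^bsub>M\<^esub> \<otimes>\<^bsub>M\<^esub> \<phi> (h', b [^]\<^bsub>B\<^esub> m) \<otimes>\<^bsub>M\<^esub> \<one>\<^bsub>M\<^esub>"
    unfolding eq by (simp only: h.hom_mult h.hom_inv P.m_closed P.inv_closed EF H' \<phi>ef)
  then have step1: "\<phi> (a \<otimes>\<^bsub>A\<^esub> h \<otimes>\<^bsub>A\<^esub> inv\<^bsub>A\<^esub> a, b [^]\<^bsub>B\<^esub> m) = \<phi> (h', b [^]\<^bsub>B\<^esub> m)"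
    using h.hom_closed[OF H'] by (simp add: ah)
  have ahG: "(a \<otimes>\<^bsub>A\<^esub> h \<otimes>\<^bsub>A\<^esub> inv\<^bsub>A\<^esub> a, b [^]\<^bsub>B\<^esub> m) \<in> G"
  proof -
    have "(a \<otimes>\<^bsub>A\<^esub> h \<otimes>\<^bsub>A\<^esub> inv\<^bsub>A\<^esub> a, b \<otimes>\<^bsub>B\<^esub> b [^]\<^bsub>B\<^esub> m \<otimes>\<^bsub>B\<^esub> inv\<^bsub>B\<^esub> b) \<in> G"
      by (intro G_mult G_inv ab hb)
    moreover have "b \<otimes>\<^bsub>B\<^esub> b [^]\<^bsub>B\<^esub> m = b [^]\<^bsub>B\<^esub> m \<otimes>\<^bsub>B\<^esub> b" by (rule B.commute_nat_pow[OF c(2,2) refl])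
    ultimately show ?thesis using c by (simp add: B.m_assoc)
  qed
  have split: "\<phi> (y, n \<otimes>\<^bsub>B\<^esub> z) = \<phi> (\<one>\<^bsub>A\<^esub>, n) \<otimes>\<^bsub>M\<^esub> \<phi> (y, z)" if "(y, z) \<in> G" for y z
    using h.hom_mult[of "(\<one>\<^bsub>A\<^esub>, n)" "(y, z)"] n that G_closed[OF that] by simp
  have nhG: "(h, n \<otimes>\<^bsub>B\<^esub> b [^]\<^bsub>B\<^esub> m) \<in> G" using G_mult[OF n hb] c by simp
  have "\<phi> (a \<otimes>\<^bsub>A\<^esub> h \<otimes>\<^bsub>A\<^esub> inv\<^bsub>A\<^esub> a, n \<otimes>\<^bsub>B\<^esub> b [^]\<^bsub>B\<^esub> m) = \<phi> (h', n \<otimes>\<^bsub>B\<^esub> b [^]\<^bsub>B\<^esub> m)"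
    using split[OF ahG] split[OF h'G] step1 by simp
  also have "(h', n \<otimes>\<^bsub>B\<^esub> b [^]\<^bsub>B\<^esub> m) = (x, \<one>\<^bsub>B\<^esub>) \<otimes>\<^bsub>P\<^esub> (h, n \<otimes>\<^bsub>B\<^esub> b [^]\<^bsub>B\<^esub> m) \<otimes>\<^bsub>P\<^esub> inv\<^bsub>P\<^esub> (x, \<one>\<^bsub>B\<^esub>)"
    using x1 c by (simp add: P_inv h'_def)
  also have "\<phi> \<dots> = \<phi> (x, \<one>\<^bsub>B\<^esub>) \<otimes>\<^bsub>M\<^esub> \<phi> (h, n \<otimes>\<^bsub>B\<^esub> b [^]\<^bsub>B\<^esub> m) \<otimes>\<^bsub>M\<^esub> inv\<^bsub>M\<^esub> \<phi> (x, \<one>\<^bsub>B\<^esub>)"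
    using h.hom_mult h.hom_inv x1 nhG P.m_closed P.inv_closed
    by (simp del: mult_DirProd)
  finally show ?thesis using x1 h.hom_closed[of "(x, \<one>\<^bsub>B\<^esub>)"]
    by (auto simp: conjugate_in_def)
qed

text \<open>\<open>h\<close> and \<open>k\<close> are chosen in the cosets of \<open>a [^] m\<close>
  and \<open>b [^] m\<close> so that they generate their centralizers. No finite
  \<open>p\<close>-quotient distinguishes the two pairs by \<open>p_quotient_conjugate\<close>, so
  they are conjugate in \<open>G\<close>.\<close>

lemma p_conjugacy_separable_power:
  assumes cs: "p_conjugacy_separable p P" and m: "coprime m p" "m \<noteq> 0" and ab: "(a, b) \<in> G"
    and cA: "\<And>x. x \<in> carrier A \<Longrightarrow> \<exists>n\<in>N1. \<forall>v\<in>carrier A. v \<otimes>\<^bsub>A\<^esub> (n \<otimes>\<^bsub>A\<^esub> x) = (n \<otimes>\<^bsub>A\<^esub> x) \<otimes>\<^bsub>A\<^esub> v \<longrightarrow>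
      (\<exists>k::int. v = (n \<otimes>\<^bsub>A\<^esub> x) [^]\<^bsub>A\<^esub> k)"
    and cB: "\<And>x. x \<in> carrier B \<Longrightarrow> \<exists>n\<in>N2. \<forall>v\<in>carrier B. v \<otimes>\<^bsub>B\<^esub> (n \<otimes>\<^bsub>B\<^esub> x) = (n \<otimes>\<^bsub>B\<^esub> x) \<otimes>\<^bsub>B\<^esub> v \<longrightarrow>
      (\<exists>k::int. v = (n \<otimes>\<^bsub>B\<^esub> x) [^]\<^bsub>B\<^esub> k)"
  shows "\<exists>t::int. (\<one>\<^bsub>A\<^esub>, b [^]\<^bsub>B\<^esub> (1 - int m * t)) \<in> G"
proof -
  have c: "a \<in> carrier A" "b \<in> carrier B" using G_closed[OF ab] by auto
  obtain n1 where n1: "n1 \<in> N1" and ch: "\<And>v. \<lbrakk>v \<in> carrier A; v \<otimes>\<^bsub>A\<^esub> (n1 \<otimes>\<^bsub>A\<^esub> a [^]\<^bsub>A\<^esub> m) = (n1 \<otimes>\<^bsub>A\<^esub> a [^]\<^bsub>A\<^esub> m) \<otimes>\<^bsub>A\<^esub> v\<rbrakk> \<Longrightarrow>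
      \<exists>k::int. v = (n1 \<otimes>\<^bsub>A\<^esub> a [^]\<^bsub>A\<^esub> m) [^]\<^bsub>A\<^esub> k" using cA[of "a [^]\<^bsub>A\<^esub> m"] c by blast
  obtain n2 where n2: "n2 \<in> N2" and ck: "\<And>v. \<lbrakk>v \<in> carrier B; v \<otimes>\<^bsub>B\<^esub> (n2 \<otimes>\<^bsub>B\<^esub> b [^]\<^bsub>B\<^esub> m) = (n2 \<otimes>\<^bsub>B\<^esub> b [^]\<^bsub>B\<^esub> m) \<otimes>\<^bsub>B\<^esub> v\<rbrakk> \<Longrightarrow>
      \<exists>k::int. v = (n2 \<otimes>\<^bsub>B\<^esub> b [^]\<^bsub>B\<^esub> m) [^]\<^bsub>B\<^esub> k" using cB[of "b [^]\<^bsub>B\<^esub> m"] c by blast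
  define h where "h = n1 \<otimes>\<^bsub>A\<^esub> a [^]\<^bsub>A\<^esub> m"
  define k where "k = n2 \<otimes>\<^bsub>B\<^esub> b [^]\<^bsub>B\<^esub> m"
  have n1G: "(n1, \<one>\<^bsub>B\<^esub>) \<in> G" and n2G: "(\<one>\<^bsub>A\<^esub>, n2) \<in> G" using n1 n2 by (auto simp: N1_def N2_def)
  have hb: "(h, b [^]\<^bsub>B\<^esub> m) \<in> G" using G_mult[OF n1G G_nat_pow[OF ab, of m]] c by (simp add: h_def)
  have hc: "h \<in> carrier A" using G_closed[OF hb] by simp
  have hk: "(h, k) \<in> G" using G_mult[OF n2G hb] hc by (simp add: k_def)
  have ahk: "(a \<otimes>\<^bsub>A\<^esub> h \<otimes>\<^bsub>A\<^esub> inv\<^bsub>A\<^esub> a, k) \<in> G"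
  proof -
    have "(a \<otimes>\<^bsub>A\<^esub> h \<otimes>\<^bsub>A\<^esub> inv\<^bsub>A\<^esub> a, b \<otimes>\<^bsub>B\<^esub> b [^]\<^bsub>B\<^esub> m \<otimes>\<^bsub>B\<^esub> inv\<^bsub>B\<^esub> b) \<in> G"
      by (intro G_mult G_inv ab hb)
    moreover have "b \<otimes>\<^bsub>B\<^esub> b [^]\<^bsub>B\<^esub> m = b [^]\<^bsub>B\<^esub> m \<otimes>\<^bsub>B\<^esub> b" by (rule B.commute_nat_pow[OF c(2,2) refl])
    ultimately have "(a \<otimes>\<^bsub>A\<^esub> h \<otimes>\<^bsub>A\<^esub> inv\<^bsub>A\<^esub> a, b [^]\<^bsub>B\<^esub> m) \<in> G" using c by (simp add: B.m_assoc)
    from G_mult[OF n2G this] show ?thesis using hc c by (simp add: k_def)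
  qed
  have "conjugate_in P (h, k) (a \<otimes>\<^bsub>A\<^esub> h \<otimes>\<^bsub>A\<^esub> inv\<^bsub>A\<^esub> a, k)"
  proof (rule ccontr)
    assume "\<not> ?thesis"
    then obtain M :: "nat monoid" and \<phi> where M: "finite_p_group p M" "\<phi> \<in> hom P M"
      "\<not> conjugate_in M (\<phi> (h, k)) (\<phi> (a \<otimes>\<^bsub>A\<^esub> h \<otimes>\<^bsub>A\<^esub> inv\<^bsub>A\<^esub> a, k))"
      using cs hk ahk unfolding p_conjugacy_separable_def by fastforce
    then show False using p_quotient_conjugate[OF M(1,2) m ab hb n2G] by (simp add: k_def)
  qed
  then show ?thesis
    by (rule conjugate_imp_power[OF ab hb hk, rotated 2]) (use ch ck in \<open>auto simp: h_def k_def\<close>)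
qed

end

section \<open>Triviality of the common quotient of the two factors\<close>

theorem corollary7p10:
  fixes F1 :: "('a, 'm) monoid_scheme" and F2 :: "('b, 'n) monoid_scheme"
    and G :: "('a \<times> 'b) set" and p q :: nat
  assumes "acylindrically_hyperbolic TYPE('s) F1"
    and "acylindrically_hyperbolic TYPE('t) F2"
    and "no_nontrivial_finite_normal_subgroups F1"
    and "no_nontrivial_finite_normal_subgroups F2"
    and "full_subdirect_product G F1 F2"
    and "prime p" and "prime q" and "p \<noteq> q"
    and "p_conjugacy_separable p ((F1 \<times>\<times> F2)\<lparr>carrier := G\<rparr>)"
    and "p_conjugacy_separable q ((F1 \<times>\<times> F2)\<lparr>carrier := G\<rparr>)"
  shows "G = carrier (F1 \<times>\<times> F2)"
proof -
  interpret subdirect F1 F2 G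
    using assms(1,2,5)
    by (simp add: subdirect_def subdirect_axioms_def acylindrically_hyperbolic_def full_subdirect_product_def)
  have one_in: "(\<one>\<^bsub>F1\<^esub>, \<one>\<^bsub>F2\<^esub>) \<in> G" by (rule G_one)
  have N1: "N1 \<noteq> {\<one>\<^bsub>F1\<^esub>}"
  proof
    assume "N1 = {\<one>\<^bsub>F1\<^esub>}"
    then have "G \<inter> (carrier F1 \<times> {\<one>\<^bsub>F2\<^esub>}) = {\<one>\<^bsub>F1 \<times>\<times> F2\<^esub>}" using one_in by (auto simp: N1_def)
    then show False using assms(5) by (simp add: full_subdirect_product_def)
  qed
  have N2: "N2 \<noteq> {\<one>\<^bsub>F2\<^esub>}"
  proof
    assume "N2 = {\<one>\<^bsub>F2\<^esub>}"
    then have "G \<inter> ({\<one>\<^bsub>F1\<^esub>} \<times> carrier F2) = {\<one>\<^bsub>F1 \<times>\<times> F2\<^esub>}" using one_in by (auto simp: N2_def)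
    then show False using assms(5) by (simp add: full_subdirect_product_def)
  qed
  note root = two_primes_commute_root[OF group_P assms(6,7,8,9,10)]
  have rc1: "root_commuting F1 n" if "n \<in> N1" for n
    by (rule N1_root_commuting[OF _ that]) (rule root, assumption+)
  have rc2: "root_commuting F2 n" if "n \<in> N2" for n
    by (rule N2_root_commuting[OF _ that]) (rule root, assumption+)
  note cA = acylindrically_hyperbolic_cyclic_centralizer[OF assms(1,3) N1_normal N1 rc1]
  note cB = acylindrically_hyperbolic_cyclic_centralizer[OF assms(2,4) N2_normal N2 rc2]
  \<comment> \<open>It suffices that \<open>N2\<close> contains every second coordinate: then
    \<open>G\<close> contains both factors.\<close>
  have snd_in: "(\<one>\<^bsub>F1\<^esub>, b) \<in> G" if ab: "(a, b) \<in> G" for a b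
  proof -
    have b: "b \<in> carrier F2" using G_closed[OF ab] by simp
    have "coprime q p" using primes_coprime assms(6-8) by blast
    moreover have q2: "2 \<le> q" using assms(7) by (rule prime_ge_2_nat)
    then have "q \<noteq> 0" by simp
    ultimately obtain t :: int where t: "(\<one>\<^bsub>F1\<^esub>, b [^]\<^bsub>F2\<^esub> (1 - int q * t)) \<in> G"
      using p_conjugacy_separable_power[OF assms(9) _ _ ab cA cB] by blast
    \<comment> \<open>The exponent obtained from \<open>p\<close> with \<open>q\<close> in place of
      \<open>m\<close> is prime to \<open>q\<close>, so its absolute value can serve as
      \<open>m\<close> for the prime \<open>q\<close>.\<close>
    define m where "m = nat \<bar>1 - int q * t\<bar>"
    have "coprime (1 - int q * t) (int q)"
    proof (rule coprimeI)
      fix r assume r: "r dvd 1 - int q * t" "r dvd int q"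
      have "r dvd (1 - int q * t) + int q * t" by (intro dvd_add dvd_mult2 r)
      then show "is_unit r" by simp
    qed
    then have mq: "coprime m q" unfolding m_def
      by (metis abs_of_nat coprime_abs_left_iff coprime_int_iff nat_0_le abs_ge_zero)
    have m0: "m \<noteq> 0"
    proof
      assume "m = 0"
      then have "q = 1" using mq by simp
      then show False using q2 by simp
    qed
    obtain t' :: int where t': "(\<one>\<^bsub>F1\<^esub>, b [^]\<^bsub>F2\<^esub> (1 - int m * t')) \<in> G"
      using p_conjugacy_separable_power[OF assms(10) mq m0 ab cA cB] by blast
    \<comment> \<open>\<open>\<sigma>\<close> is the sign lost by the absolute value. With it
      \<open>N2\<close> contains both \<open>b [^] (int m * t')\<close> and
      \<open>b [^] (1 - int m * t')\<close>, hence their product \<open>b\<close>.\<close>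
    obtain \<sigma> :: int where \<sigma>: "int m = (1 - int q * t) * \<sigma>"
      by (cases "0 \<le> 1 - int q * t") (auto simp: m_def intro: that[of 1] that[of "-1"])
    have "((\<one>\<^bsub>F1\<^esub>) [^]\<^bsub>F1\<^esub> (\<sigma> * t'), (b [^]\<^bsub>F2\<^esub> (1 - int q * t)) [^]\<^bsub>F2\<^esub> (\<sigma> * t')) \<in> G"
      by (rule G_int_pow[OF t])
    then have "(\<one>\<^bsub>F1\<^esub>, b [^]\<^bsub>F2\<^esub> (int m * t')) \<in> G" using b by (simp add: B.int_pow_pow \<sigma> mult.assoc)
    from G_mult[OF t' this] have "(\<one>\<^bsub>F1\<^esub>, b [^]\<^bsub>F2\<^esub> (1 - int m * t' + int m * t')) \<in> G"
      using b by (simp only: B.int_pow_mult A.l_one A.one_closed)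
    then show ?thesis using b by simp
  qed
  have "carrier F1 \<times> carrier F2 \<subseteq> G"
  proof clarify
    fix a b assume a: "a \<in> carrier F1" and b: "b \<in> carrier F2"
    obtain b' where b': "(a, b') \<in> G" using lift_fst[OF a] by blast
    obtain a' where a': "(a', b) \<in> G" using lift_snd[OF b] by blast
    have "(a, \<one>\<^bsub>F2\<^esub>) \<in> G"
      using G_mult[OF b' G_inv[OF snd_in[OF b']]] a G_closed[OF b'] by simp
    from G_mult[OF this snd_in[OF a']] show "(a, b) \<in> G" using a b by simp
  qed
  then show ?thesis using subgroup.subset[OF subgroup_G] by auto
qed

end
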